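(* Let $X=\{X_t\}_{t\ge 0}$ be a transient Hunt process on $\mathbb{R}$ satisfying the standing assumptions listed in the context, let $g:\mathbb{R}\to[0,\infty)$ be a continuous reward function, and let $r\ge 0$ be a discount rate such that $$\mathbf{E}_x\Big(\sup_{t\ge 0}e^{-rt}g(X_t)\Big)<\infty,\qquad x\in\mathbb{R}.$$ Assume that there exist $x^*\in\mathbb{R}$ and a Radon measure $\sigma$ with support on the set $[x^*,\infty)$ such that the function $$V(x):=\int_{[x^*,\infty)}G_r(x,y)\,\sigma(dy),\qquad x\in\mathbb{R},$$ satisfies the following conditions: (a) $V$ is continuous; (b) $V(x)\to 0$ as $x\to-\infty$; (c) $V(x)=g(x)$ when $x\ge x^*$; (d) $V(x)\ge g(x)$ when $x<x^*$. Let $\tau^*=\inf\{t\ge 0: X_t\ge x^*\}$. Then $\tau^*$ is an optimal stopping time and $V$ is the value function of the optimal stopping problem for $X$ with reward function $g$ and discount rate $r$, that is, $$V(x)=\sup_{\tau\in\mathcal{M}}\mathbf{E}_x\big(e^{-r\tau}g(X_\tau)\big)=\mathbf{E}_x\big(e^{-r\tau^*}g(X_{\tau^*})\big),\qquad x\in\mathbb{R}.$$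
   Context: Standing assumptions on $X$. $X=\{X_t\}_{t\ge0}$ is a transient Hunt process with values in $\mathbb{R}$ (a strong Markov process, quasi-left-continuous on $[0,\infty)$, with right-continuous sample paths having left limits). $\mathbf{P}_x,\mathbf{E}_x$ denote probability and expectation when $X_0=x$. The resolvent is $G_r(x,A)=\int_0^\infty e^{-rt}\mathbf{P}_x(X_t\in A)\,dt$ for $r\ge 0$, $x\in\mathbb{R}$, $A$ Borel, and $G_rf(x)=\int f(y)\,G_r(x,dy)$. Let $\mathcal{B}_o$ be the set of bounded measurable functions with compact support. It is assumed that there are a $\sigma$-finite measure $m$ on $\mathbb{R}$ (the duality measure) and a dual resolvent $\{\widehat G_r: r\ge 0\}$, i.e. $\int m(dx) f(x)G_rg(x)=\int m(dx)\,\widehat G_rf(x)\,g(x)$ for all $f,g\in\mathcal{B}_o$, $r\ge 0$, and that $\{\widehat G_r\}$ is the resolvent of a transient Hunt process $\widehat X$ on $\mathbb{R}$. Moreover: (h1) $G_r(x,dy)=G_r(x,y)\,m(dy)$; (h2) $\sup_{x\in A}G_0(x,B)<\infty$ for all compact $A,B$; (h3) $x\mapsto\widehat G_rf(x)$ is continuous and finite for every $f\in\mathcal{B}_o$. The density $G_r(x,y)$ is the Green (potential) kernel: for each $r\ge0$, $(x,y)\mapsto G_r(x,y)$ is jointly measurable, $\widehat G_r(y,dx)=G_r(x,y)\,m(dx)$, $x\mapsto G_r(x,y)$ is $r$-excessive for $X$ for each $y$, and $y\mapsto G_r(x,y)$ is $r$-excessive for $\widehat X$ for each $x$. A measurable $f:\mathbb{R}\to[0,+\infty]$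 is $r$-excessive for $X$ if for all $x$: $e^{-rt}\mathbf{E}_x(f(X_t))\le f(x)$ for all $t\ge 0$, and $e^{-rt}\mathbf{E}_x(f(X_t))\to f(x)$ as $t\to 0$ (analogously for $\widehat X$). $\mathcal{M}$ is the set of all stopping times (values in $[0,+\infty]$) with respect to the natural filtration generated by $X$. On $\{\tau=+\infty\}$ one sets $e^{-r\tau}g(X_\tau):=\limsup_{t\to\infty}e^{-rt}g(X_t)$. *)

theory Defs
  imports "HOL-Probability.Probability"
begin

section \<open>Filtration and stopping times\<close>

text \<open>
  A Markov family is given by a measurable sample space \<open>M\<close>, laws \<open>P x\<close> on it (one for every
  starting point \<open>x\<close>) and coordinates \<open>X t\<close>; only \<open>t \<ge> 0\<close> is relevant.
  Random times are \<open>ennreal\<close>-valued, and filtrations are accordingly indexed by \<open>[0, \<infinity>]\<close>,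
  so that the library notion of stopping time applies.
\<close>

definition raw_filtration ::
    "'w measure \<Rightarrow> (real \<Rightarrow> 'w \<Rightarrow> real) \<Rightarrow> ennreal \<Rightarrow> 'w measure" where
  "raw_filtration M X t =
     sigma (space M) {X s -` B \<inter> space M | s B. 0 \<le> s \<and> ennreal s \<le> t \<and> B \<in> sets borel}"

text \<open>
  Completion with respect to all laws \<open>P\<^sub>\<mu> = \<integral> P\<^sub>x \<mu>(dx)\<close>, for arbitrary initial distributions
  \<open>\<mu>\<close>; the integral below is \<open>P\<^sub>\<mu> N\<close>.
\<close>

definition completed_filtration ::
    "'w measure \<Rightarrow> (real \<Rightarrow> 'w measure) \<Rightarrow> (real \<Rightarrow> 'w \<Rightarrow> real) \<Rightarrow> ennreal \<Rightarrow> 'w measure" where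
  "completed_filtration M P X t =
     sigma (space M) {A. A \<subseteq> space M \<and>
       (\<forall>\<mu>\<in>space (prob_algebra borel). \<exists>B\<in>sets (raw_filtration M X t).
          \<exists>N\<in>sets (raw_filtration M X \<infinity>).
            (A - B) \<union> (B - A) \<subseteq> N \<and> (\<integral>\<^sup>+x. emeasure (P x) N \<partial>\<mu>) = 0)}"

text \<open>
  The natural filtration of a Hunt process is, as usual in the theory, the augmented one. (For the
  raw filtration the entrance time into a closed set need not be a stopping time.)
  For \<open>t < \<infinity>\<close> this is the intersection over all \<open>s > t\<close>; for \<open>t = \<infinity>\<close> the only index is \<open>s = \<infinity>\<close>.
\<close>

definition natural_filtration ::
    "'w measure \<Rightarrow> (real \<Rightarrow> 'w measure) \<Rightarrow> (real \<Rightarrow> 'w \<Rightarrow> real) \<Rightarrow> ennreal \<Rightarrow> 'w measure" where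
  "natural_filtration M P X t =
     sigma (space M) {A. \<forall>s. t < s \<or> s = \<infinity> \<longrightarrow> A \<in> sets (completed_filtration M P X s)}"

definition stopping_times ::
    "'w measure \<Rightarrow> (real \<Rightarrow> 'w measure) \<Rightarrow> (real \<Rightarrow> 'w \<Rightarrow> real) \<Rightarrow> ('w \<Rightarrow> ennreal) set" where
  "stopping_times M P X = {\<tau>. stopping_time (natural_filtration M P X) \<tau>}"


section \<open>Transient Hunt processes\<close>

text \<open>
  The value of the process at a random time; meaningful only where the time is finite.
\<close>

definition at_time :: "(real \<Rightarrow> 'w \<Rightarrow> real) \<Rightarrow> ('w \<Rightarrow> ennreal) \<Rightarrow> 'w \<Rightarrow> real" where
  "at_time X T \<omega> = X (enn2real (T \<omega>)) \<omega>"

text \<open>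
  Events and functions depending on a stopping time of the augmented filtration are measurable
  only for the completed laws, hence \<open>completion (P x)\<close> in the strong Markov property.
\<close>

locale hunt_process =
  fixes M :: "'w measure" and P :: "real \<Rightarrow> 'w measure" and X :: "real \<Rightarrow> 'w \<Rightarrow> real"
  assumes kernel: "P \<in> borel \<rightarrow>\<^sub>M prob_algebra M"
    and measurable_X: "\<And>t. 0 \<le> t \<Longrightarrow> X t \<in> borel_measurable M"
    and start: "\<And>x. AE \<omega> in P x. X 0 \<omega> = x"
    and right_continuous:
      "\<And>\<omega> t. \<omega> \<in> space M \<Longrightarrow> 0 \<le> t \<Longrightarrow> continuous (at_right t) (\<lambda>s. X s \<omega>)"
    and left_limits:
      "\<And>\<omega> t. \<omega> \<in> space M \<Longrightarrow> 0 < t \<Longrightarrow> \<exists>l. ((\<lambda>s. X s \<omega>) \<longlongrightarrow> l) (at_left t)"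
    and strong_markov:
      "\<And>x T A t B. T \<in> stopping_times M P X \<Longrightarrow>
         A \<in> sets (filtration.pre_sigma (space M) (natural_filtration M P X) T) \<Longrightarrow>
         0 \<le> t \<Longrightarrow> B \<in> sets borel \<Longrightarrow>
         emeasure (completion (P x)) {\<omega>\<in>A. T \<omega> < \<infinity> \<and> X (enn2real (T \<omega>) + t) \<omega> \<in> B} =
         (\<integral>\<^sup>+\<omega>\<in>{\<omega>\<in>A. T \<omega> < \<infinity>}. emeasure (P (at_time X T \<omega>)) {\<omega>'\<in>space M. X t \<omega>' \<in> B}
            \<partial>completion (P x))"
    and quasi_left_continuous:
      "\<And>x T. (\<And>n::nat. T n \<in> stopping_times M P X) \<Longrightarrow>
         (\<And>n \<omega>. \<omega> \<in> space M \<Longrightarrow> T n \<omega> \<le> T (Suc n) \<omega>) \<Longrightarrow>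
         AE \<omega> in P x. (SUP n. T n \<omega>) < \<infinity> \<longrightarrow>
           (\<lambda>n. at_time X (T n) \<omega>) \<longlonglongrightarrow> at_time X (\<lambda>\<omega>. SUP n. T n \<omega>) \<omega>"

text \<open>Transience: almost surely, every compact set is eventually left for good.\<close>

locale transient_hunt_process = hunt_process M P X
  for M :: "'w measure" and P :: "real \<Rightarrow> 'w measure" and X :: "real \<Rightarrow> 'w \<Rightarrow> real" +
  assumes transient:
    "\<And>x K. compact K \<Longrightarrow> AE \<omega> in P x. eventually (\<lambda>t. X t \<omega> \<notin> K) at_top"


section \<open>Resolvents, excessive functions and duality\<close>

definition resolvent ::
    "(real \<Rightarrow> 'w measure) \<Rightarrow> (real \<Rightarrow> 'w \<Rightarrow> real) \<Rightarrow> real \<Rightarrow> real \<Rightarrow> real measure" where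
  "resolvent P X r x = measure_of UNIV (sets borel)
     (\<lambda>A. \<integral>\<^sup>+t\<in>{0..}. ennreal (exp (- r * t)) * emeasure (P x) {\<omega>\<in>space (P x). X t \<omega> \<in> A}
        \<partial>lborel)"

definition excessive ::
    "(real \<Rightarrow> 'w measure) \<Rightarrow> (real \<Rightarrow> 'w \<Rightarrow> real) \<Rightarrow> real \<Rightarrow> (real \<Rightarrow> ennreal) \<Rightarrow> bool" where
  "excessive P X r f \<longleftrightarrow> f \<in> borel_measurable borel \<and>
     (\<forall>x. (\<forall>t\<ge>0. ennreal (exp (- r * t)) * (\<integral>\<^sup>+\<omega>. f (X t \<omega>) \<partial>P x) \<le> f x) \<and>
          ((\<lambda>t. ennreal (exp (- r * t)) * (\<integral>\<^sup>+\<omega>. f (X t \<omega>) \<partial>P x)) \<longlongrightarrow> f x) (at_right 0))"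

definition bounded_compact_support :: "(real \<Rightarrow> real) set" where
  "bounded_compact_support =
     {f. f \<in> borel_measurable borel \<and> bounded (range f) \<and> (\<exists>K. compact K \<and> (\<forall>x. x \<notin> K \<longrightarrow> f x = 0))}"

text \<open>
  The unprimed process is the given one, the primed process its dual; \<open>m\<close> is the duality measure
  and \<open>G\<close> the Green kernel. The duality identity is stated for nonnegative functions, where both
  sides exist in \<open>[0, \<infinity>]\<close>; it extends to signed functions by linearity.
\<close>

locale dual_hunt_processes =
  X: transient_hunt_process M P X + dual: transient_hunt_process M' P' X'
  for M :: "'w measure" and P :: "real \<Rightarrow> 'w measure" and X :: "real \<Rightarrow> 'w \<Rightarrow> real"
    and M' :: "'v measure" and P' :: "real \<Rightarrow> 'v measure" and X' :: "real \<Rightarrow> 'v \<Rightarrow> real" +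
  fixes m :: "real measure" and G :: "real \<Rightarrow> real \<Rightarrow> real \<Rightarrow> ennreal"
  assumes sigma_finite_m: "sigma_finite_measure m"
    and sets_m: "sets m = sets borel"
    and duality:
      "\<And>r f h. 0 \<le> r \<Longrightarrow> f \<in> bounded_compact_support \<Longrightarrow> h \<in> bounded_compact_support \<Longrightarrow>
         (\<And>x. 0 \<le> f x) \<Longrightarrow> (\<And>x. 0 \<le> h x) \<Longrightarrow>
         (\<integral>\<^sup>+x. ennreal (f x) * (\<integral>\<^sup>+y. ennreal (h y) \<partial>resolvent P X r x) \<partial>m) =
         (\<integral>\<^sup>+x. (\<integral>\<^sup>+y. ennreal (f y) \<partial>resolvent P' X' r x) * ennreal (h x) \<partial>m)"
    and h1: "\<And>r x. 0 \<le> r \<Longrightarrow> resolvent P X r x = density m (G r x)"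
    and h2: "\<And>A B. compact A \<Longrightarrow> compact B \<Longrightarrow> (SUP x\<in>A. emeasure (resolvent P X 0 x) B) < \<infinity>"
    and h3_finite:
      "\<And>r f x. 0 \<le> r \<Longrightarrow> f \<in> bounded_compact_support \<Longrightarrow> integrable (resolvent P' X' r x) f"
    and h3_continuous:
      "\<And>r f. 0 \<le> r \<Longrightarrow> f \<in> bounded_compact_support \<Longrightarrow>
         continuous_on UNIV (\<lambda>x. \<integral>y. f y \<partial>resolvent P' X' r x)"
    and green_measurable:
      "\<And>r. 0 \<le> r \<Longrightarrow> (\<lambda>(x, y). G r x y) \<in> borel_measurable (borel \<Otimes>\<^sub>M borel)"
    and green_dual: "\<And>r y. 0 \<le> r \<Longrightarrow> resolvent P' X' r y = density m (\<lambda>x. G r x y)"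
    and green_excessive: "\<And>r y. 0 \<le> r \<Longrightarrow> excessive P X r (\<lambda>x. G r x y)"
    and green_dual_excessive: "\<And>r x. 0 \<le> r \<Longrightarrow> excessive P' X' r (\<lambda>y. G r x y)"


section \<open>Optimal stopping\<close>

definition discounted_reward ::
    "(real \<Rightarrow> 'w \<Rightarrow> real) \<Rightarrow> (real \<Rightarrow> real) \<Rightarrow> real \<Rightarrow> ('w \<Rightarrow> ennreal) \<Rightarrow> 'w \<Rightarrow> ennreal" where
  "discounted_reward X g r \<tau> \<omega> =
     (if \<tau> \<omega> = \<infinity> then Limsup at_top (\<lambda>t. ennreal (exp (- r * t) * g (X t \<omega>)))
      else ennreal (exp (- r * enn2real (\<tau> \<omega>)) * g (at_time X \<tau> \<omega>)))"

definition expected_reward ::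
    "(real \<Rightarrow> 'w measure) \<Rightarrow> (real \<Rightarrow> 'w \<Rightarrow> real) \<Rightarrow> (real \<Rightarrow> real) \<Rightarrow> real \<Rightarrow>
     ('w \<Rightarrow> ennreal) \<Rightarrow> real \<Rightarrow> ennreal" where
  "expected_reward P X g r \<tau> x = (\<integral>\<^sup>+\<omega>. discounted_reward X g r \<tau> \<omega> \<partial>completion (P x))"

definition entrance_time :: "(real \<Rightarrow> 'w \<Rightarrow> real) \<Rightarrow> real set \<Rightarrow> 'w \<Rightarrow> ennreal" where
  "entrance_time X S \<omega> = Inf {ennreal t | t. 0 \<le> t \<and> X t \<omega> \<in> S}"

definition radon_measure :: "real measure \<Rightarrow> bool" where
  "radon_measure \<sigma> \<longleftrightarrow> sets \<sigma> = sets borel \<and> (\<forall>K. compact K \<longrightarrow> emeasure \<sigma> K < \<infinity>)"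

end

theory Submission
  imports Defs
begin

text \<open>
  The function \<open>V\<close> is a potential, hence \<open>e\<^bsup>-rt\<^esup>V(X\<^sub>t)\<close> is a nonnegative supermartingale dominating the
  reward process; this bounds the gain of every stopping time by \<open>V\<close>. Two points need work: the
  value \<open>V\<close> has to be attained at \<open>\<tau>\<^sup>*\<close>, and the limsup that is paid on \<open>{\<tau> = \<infinity>}\<close> has to be
  controlled.

  \<^item> Attainment. For an open set \<open>S\<close> with entrance time \<open>\<rho>\<close>, the balayage identity
    \<open>G\<^sub>r(x,y) = E\<^sub>x(e\<^bsup>-r\<rho>\<^esup>G\<^sub>r(X\<^sub>\<rho>,y))\<close> holds for every \<open>y \<in> S\<close> (lemma \<open>green_balayage\<close>). The strong
    Markov property gives it after integration in \<open>y\<close> against functions that vanish off \<open>S\<close>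
    (\<open>resolvent_at_entrance\<close>), so for almost every \<open>y\<close>. Both sides are coexcessive in \<open>y\<close>, and a
    coexcessive function is determined on an open set by its values almost everywhere there: by the
    continuity of the dual resolvent it is a supremum of continuous functions, hence lower
    semicontinuous, and therefore recovered at \<open>y\<close> from its restriction to \<open>S\<close>
    (\<open>coexcessive_localization\<close>).

    The identity is applied to \<open>S\<^sub>n = (x\<^sup>* - 1/n, \<infinity>)\<close>, in which the whole support of \<open>\<sigma>\<close> consists of
    interior points, and gives \<open>V(x) = E\<^sub>x(e\<^bsup>-r\<tau>\<^sub>n\<^esup>V(X\<^bsub>\<tau>\<^sub>n\<^esub>))\<close> for the entrance times \<open>\<tau>\<^sub>n\<close>. They increase
    to \<open>\<tau>\<^sup>*\<close> by quasi-left-continuity, and continuity of \<open>V\<close> together with the integrable bound on the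
    rewards allows the passage to the limit (\<open>V_le_expected_reward\<close>). On \<open>{\<tau>\<^sup>* = \<infinity>}\<close> nothing is
    lost: by transience the path leaves \<open>[x\<^sup>* - 1, x\<^sup>*]\<close> for good, so \<open>\<tau>\<^sub>n = \<infinity>\<close> for large \<open>n\<close>.
    Approximation by open sets is also what shows that \<open>\<tau>\<^sup>*\<close> is a stopping time of the augmented
    filtration (\<open>entrance_time_closed_stopping\<close>).

  \<^item> The limsup at infinity vanishes almost surely (\<open>AE_limsup_reward\<close>). Indeed
    \<open>e\<^bsup>-rn\<^esup>E\<^sub>x(V(X\<^sub>n))\<close> tends to \<open>0\<close>: the part of the potential that comes from \<open>\<sigma>\<close> on \<open>[x\<^sup>*,k]\<close> is, by
    balayage from time \<open>n\<close> on, at most a constant times the probability of visiting a bounded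
    neighbourhood of \<open>[x\<^sup>*,k]\<close> after time \<open>n\<close>, which is small by transience, and the rest is at
    most the potential of \<open>\<sigma>\<close> restricted to \<open>(k,\<infinity>)\<close>, which is small for large \<open>k\<close> because \<open>V(x)\<close> is
    finite. The maximal inequality for supermartingales turns this into almost sure convergence
    of the rewards.

  With the limsup out of the way, the upper bound for an arbitrary stopping time follows from
  optional stopping on finite time grids and Fatou's lemma, since the rewards are right-continuous
  (\<open>expected_reward_le_V\<close>).
\<close>

section \<open>Analytic preliminaries\<close>

definition entrance_after ::
    "(real \<Rightarrow> 'w \<Rightarrow> real) \<Rightarrow> real \<Rightarrow> real set \<Rightarrow> 'w \<Rightarrow> ennreal" where
  "entrance_after X s S \<omega> = Inf {ennreal t | t. s \<le> t \<and> X t \<omega> \<in> S}"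

lemma entrance_time_eq: "entrance_time X S = entrance_after X 0 S"
  by (auto simp: entrance_time_def entrance_after_def)

text \<open>
  The grid with mesh \<open>1/(k+1)\<close> starting at \<open>s\<close>; the shift by one avoids a division by zero.
\<close>

definition grid :: "real \<Rightarrow> nat \<Rightarrow> nat \<Rightarrow> real" where
  "grid s k i = s + real i / real (Suc k)"

lemma grid_nonneg: "0 \<le> s \<Longrightarrow> 0 \<le> grid s k i"
  by (simp add: grid_def)

lemma mono_grid: "mono (grid s k)"
  by (auto simp: mono_def grid_def divide_right_mono)

text \<open>
  A grid point in \<open>[t,b)\<close> exists as soon as the mesh is smaller than \<open>b - t\<close>. The quadratic bound on
  its index makes each grid finite, while its range \<open>[s, s + k + 1)\<close> still exhausts the half line as
  the mesh is refined.
\<close>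

lemma grid_hits:
  assumes "s \<le> t" "t < b"
  shows "eventually (\<lambda>k. \<exists>i<(Suc k)\<^sup>2. t \<le> grid s k i \<and> grid s k i < b) sequentially"
proof -
  obtain k0 :: nat where k0: "1 / (b - t) + (t - s) + 1 < real k0" using reals_Archimedean2 by blast
  show ?thesis unfolding eventually_sequentially
  proof (rule exI[of _ k0], intro allI impI)
    fix k assume k: "k0 \<le> k"
    define n where "n = real (Suc k)"
    have n: "1 / (b - t) + (t - s) + 1 < n" "0 < n" using k0 k by (auto simp: n_def)
    have "0 < 1 / (b - t)" using assms by simp
    \<comment> \<open>The first grid point that is not before \<open>t\<close>.\<close>
    define i where "i = nat \<lceil>(t - s) * n\<rceil>"
    have i: "(t - s) * n \<le> real i" "real i < (t - s) * n + 1"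
      using assms n by (auto simp: i_def) linarith+
    have grid_i: "grid s k i = s + real i / n" by (simp add: grid_def n_def)
    have "t \<le> grid s k i" unfolding grid_i using i n by (simp add: field_simps)
    moreover have "grid s k i < b"
    proof -
      have "1 / (b - t) < n" using n assms by linarith
      then have "1 / n < b - t" using assms n by (simp add: field_simps)
      moreover have "real i / n < (t - s) + 1 / n" using i n by (simp add: field_simps)
      ultimately show ?thesis unfolding grid_i by linarith
    qed
    moreover have "i < (Suc k)\<^sup>2"
    proof -
      have "(t - s) + 1 \<le> n" using n \<open>0 < 1 / (b - t)\<close> by linarith
      have "1 \<le> n" by (simp add: n_def)
      have "real i < (t - s) * n + 1" by (rule i)
      also have "\<dots> \<le> (t - s) * n + n" using \<open>1 \<le> n\<close> by simp
      also have "\<dots> = ((t - s) + 1) * n" by (simp add: algebra_simps)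
      also have "\<dots> \<le> n * n" using \<open>(t - s) + 1 \<le> n\<close> n by (intro mult_right_mono) auto
      also have "\<dots> = real ((Suc k)\<^sup>2)" unfolding n_def by (simp only: of_nat_power power2_eq_square of_nat_mult)
      finally show ?thesis by (simp only: of_nat_less_iff)
    qed
    ultimately show "\<exists>i<(Suc k)\<^sup>2. t \<le> grid s k i \<and> grid s k i < b" by blast
  qed
qed

lemma exponential_integral_full:
  assumes "0 < (l::real)"
  shows "(\<integral>\<^sup>+t\<in>{0..}. ennreal (l * exp (- l * t)) \<partial>lborel) = 1"
proof -
  have "(\<integral>\<^sup>+t. ennreal (l * exp (- l * t)) * indicator {0..} t \<partial>lborel) = ennreal (0 - (- exp (- l * 0)))"
  proof (rule nn_integral_FTC_atLeast)
    show "((\<lambda>t. - exp (- l * t)) \<longlongrightarrow> 0) at_top" using assms by real_asymp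
  qed (use assms in \<open>auto intro!: derivative_eq_intros\<close>)
  then show ?thesis by simp
qed

lemma exponential_integral_initial:
  assumes "0 < (l::real)" "0 \<le> d"
  shows "(\<integral>\<^sup>+t\<in>{0..d}. ennreal (l * exp (- l * t)) \<partial>lborel) = ennreal (1 - exp (- l * d))"
proof -
  have "(\<integral>\<^sup>+t. ennreal (l * exp (- l * t)) * indicator {0..d} t \<partial>lborel) =
      ennreal ((- exp (- l * d)) - (- exp (- l * 0)))"
    by (rule nn_integral_FTC_Icc) (use assms in \<open>auto intro!: derivative_eq_intros\<close>)
  then show ?thesis by simp
qed

text \<open>
  The factor \<open>l e\<^bsup>-lt\<^esup>\<close> on the right is a probability density on \<open>[0,\<infinity>)\<close>, so \<open>l\<close> times the resolvent of
  index \<open>r + l\<close> averages the discounted semigroup over an exponential time.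
\<close>

lemma discount_split:
  assumes "0 < (l::real)"
  shows "ennreal l * (ennreal (exp (- (r + l) * t)) * y) =
      ennreal (l * exp (- l * t)) * (ennreal (exp (- r * t)) * y)"
proof -
  have "l * exp (- (r + l) * t) = (l * exp (- l * t)) * exp (- r * t)"
    by (simp add: exp_add[symmetric] algebra_simps)
  moreover have "ennreal l * (ennreal (exp (- (r + l) * t)) * y) = ennreal (l * exp (- (r + l) * t)) * y"
    using assms by (simp add: mult.assoc ennreal_mult del: minus_add_distrib)
  ultimately show ?thesis
    using assms by (simp add: mult.assoc ennreal_mult del: minus_add_distrib)
qed

lemma radon_measure_sigma_finite:
  assumes "radon_measure \<sigma>"
  shows "sigma_finite_measure \<sigma>"
proof (rule sigma_finite_measure.intro, rule exI[of _ "range (\<lambda>n::nat. {- real n..real n})"], intro conjI ballI)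
  have sets_sigma: "sets \<sigma> = sets borel" using assms by (simp add: radon_measure_def)
  have "x \<in> (\<Union>n::nat. {- real n..real n})" for x
  proof -
    obtain n :: nat where "\<bar>x\<bar> \<le> real n" using real_arch_simple by blast
    then show ?thesis by (intro UN_I[of n]) auto
  qed
  then show "\<Union> (range (\<lambda>n::nat. {- real n..real n})) = space \<sigma>"
    unfolding sets_eq_imp_space_eq[OF sets_sigma] space_borel by blast
  fix a assume "a \<in> range (\<lambda>n::nat. {- real n..real n})"
  then have "compact a" by auto
  then show "emeasure \<sigma> a \<noteq> \<infinity>" using assms by (auto simp: radon_measure_def)
qed (auto simp: assms[unfolded radon_measure_def])

lemma nn_integral_eq_on_subalgebra:
  assumes "subalgebra A F" "subalgebra B F"
    and "\<And>S. S \<in> sets F \<Longrightarrow> emeasure A S = emeasure B S"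
    and "h \<in> borel_measurable F"
  shows "(\<integral>\<^sup>+x. h x \<partial>A) = (\<integral>\<^sup>+x. h x \<partial>B)"
proof -
  have "restr_to_subalg A F = restr_to_subalg B F"
    using assms(1-3) by (intro measure_eqI)
      (auto simp: sets_restr_to_subalg emeasure_restr_to_subalg)
  then show ?thesis
    using nn_integral_subalgebra2[OF assms(1,4)] nn_integral_subalgebra2[OF assms(2,4)] by simp
qed

section \<open>Measurability of paths and the augmented filtration\<close>

context hunt_process
begin

lemma sets_P [measurable_cong, simp]: "sets (P x) = sets M"
  and prob_space_P: "prob_space (P x)"
proof -
  have "P x \<in> space (prob_algebra M)"
    using measurable_space[OF kernel, of x] by simp
  then show "sets (P x) = sets M" "prob_space (P x)"
    by (auto simp: space_prob_algebra)
qed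

lemma space_P [simp]: "space (P x) = space M"
  using sets_P by (rule sets_eq_imp_space_eq)

lemma kernel_subprob [measurable]: "P \<in> borel \<rightarrow>\<^sub>M subprob_algebra M"
  by (rule measurable_prob_algebraD[OF kernel])

lemma X_tendsto_right:
  "\<omega> \<in> space M \<Longrightarrow> 0 \<le> t \<Longrightarrow> ((\<lambda>s. X s \<omega>) \<longlongrightarrow> X t \<omega>) (at_right t)"
  using right_continuous[of \<omega> t] by (simp add: continuous_within)

text \<open>
  Right-continuous processes are jointly measurable. The \<sigma>-algebra \<open>F\<close> is arbitrary because the
  lemma is needed for the original, the raw and the completed \<sigma>-algebras; the truncation at \<open>0\<close> is
  there since nothing is known about negative times.
\<close>

lemma X_path_measurable:
  assumes "space F = space M" and "\<And>t. 0 \<le> t \<Longrightarrow> X t \<in> borel_measurable F"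
  shows "(\<lambda>(t, \<omega>). X (max 0 t) \<omega>) \<in> borel_measurable (borel \<Otimes>\<^sub>M F)"
proof -
  \<comment> \<open>Approximation of the time from strictly above, by countably many values.\<close>
  define d :: "nat \<Rightarrow> real \<Rightarrow> real"
    where "d n t = (of_int \<lfloor>real (Suc n) * max 0 t\<rfloor> + 1) / real (Suc n)" for n t
  have d_gt: "max 0 t < d n t" for n t
  proof -
    have "real (Suc n) * max 0 t < of_int \<lfloor>real (Suc n) * max 0 t\<rfloor> + 1" by linarith
    then have "max 0 t * real (Suc n) < of_int \<lfloor>real (Suc n) * max 0 t\<rfloor> + 1"
      by (simp only: mult.commute)
    then show ?thesis unfolding d_def by (simp only: pos_less_divide_eq of_nat_0_less_iff zero_less_Suc)
  qed
  have d_le: "d n t \<le> max 0 t + 1 / real (Suc n)" for n t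
  proof -
    have "of_int \<lfloor>real (Suc n) * max 0 t\<rfloor> + 1 \<le> real (Suc n) * max 0 t + 1" by linarith
    then have "d n t \<le> (real (Suc n) * max 0 t + 1) / real (Suc n)"
      unfolding d_def by (rule divide_right_mono) simp
    then show ?thesis by (simp add: add_divide_distrib)
  qed
  have d_lim: "(\<lambda>n. d n t) \<longlonglongrightarrow> max 0 t" for t
  proof (rule tendsto_sandwich[of "\<lambda>_. max 0 t" _ _ "\<lambda>n. max 0 t + 1 / real (Suc n)"])
    show "(\<lambda>n. max 0 t + 1 / real (Suc n)) \<longlonglongrightarrow> max 0 t"
      using tendsto_add[OF tendsto_const LIMSEQ_inverse_real_of_nat, of "max 0 t"]
      by (simp add: inverse_eq_divide)
  qed (use d_gt d_le in \<open>auto intro!: always_eventually less_imp_le\<close>)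
  have meas: "(\<lambda>p. X (d n (fst p)) (snd p)) \<in> borel_measurable (borel \<Otimes>\<^sub>M F)" for n
  proof -
    have "(\<lambda>p. (\<lambda>(i::int) p. X (max 0 ((of_int i + 1) / real (Suc n))) (snd p))
              \<lfloor>real (Suc n) * max 0 (fst p)\<rfloor> p) \<in> borel_measurable (borel \<Otimes>\<^sub>M F)"
    proof (rule measurable_compose_countable[where
          f="\<lambda>(i::int) p. X (max 0 ((of_int i + 1) / real (Suc n))) (snd p)"
          and g="\<lambda>p. \<lfloor>real (Suc n) * max 0 (fst p)\<rfloor>"])
      show "(\<lambda>p. X (max 0 ((of_int i + 1) / real (Suc n))) (snd p))
          \<in> borel_measurable (borel \<Otimes>\<^sub>M F)" for i :: int
        by (rule measurable_compose[OF measurable_snd]) (use assms(2) in simp)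
    qed measurable
    moreover have "max 0 ((of_int \<lfloor>real (Suc n) * max 0 t\<rfloor> + 1) / real (Suc n)) = d n t" for t
      using d_gt[of t n] by (simp add: d_def)
    ultimately show ?thesis by simp
  qed
  have "(\<lambda>p. X (max 0 (fst p)) (snd p)) \<in> borel_measurable (borel \<Otimes>\<^sub>M F)"
  proof (rule borel_measurable_LIMSEQ_metric[OF meas])
    fix p :: "real \<times> 'w" assume "p \<in> space (borel \<Otimes>\<^sub>M F)"
    then have p: "snd p \<in> space M" using assms(1) by (simp add: space_pair_measure mem_Times_iff)
    have "filterlim (\<lambda>n. d n (fst p)) (at_right (max 0 (fst p))) sequentially"
      unfolding filterlim_at using d_lim d_gt[of "fst p"] by (simp add: less_imp_neq[symmetric] less_imp_le)
    then show "(\<lambda>n. X (d n (fst p)) (snd p)) \<longlonglongrightarrow> X (max 0 (fst p)) (snd p)"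
      by (rule filterlim_compose[OF X_tendsto_right[OF p max.cobounded1]])
  qed
  then show ?thesis by (simp only: case_prod_beta')
qed

lemma X_random_time_measurable:
  assumes "space F = space M" and "\<And>t. 0 \<le> t \<Longrightarrow> X t \<in> borel_measurable F"
    and [measurable]: "T \<in> borel_measurable F" and "0 \<le> t"
  shows "(\<lambda>\<omega>. X (enn2real (T \<omega>) + t) \<omega>) \<in> borel_measurable F"
proof -
  have "(\<lambda>\<omega>. (enn2real (T \<omega>) + t, \<omega>)) \<in> F \<rightarrow>\<^sub>M borel \<Otimes>\<^sub>M F" by measurable
  from measurable_compose[OF this X_path_measurable[OF assms(1,2)]]
  show ?thesis using \<open>0 \<le> t\<close> by (simp add: max_absorb2)
qed

lemma at_time_measurable:
  assumes "space F = space M" and "\<And>t. 0 \<le> t \<Longrightarrow> X t \<in> borel_measurable F"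
    and "T \<in> borel_measurable F"
  shows "at_time X T \<in> borel_measurable F"
  using X_random_time_measurable[OF assms, of 0] by (simp add: at_time_def[abs_def])

lemma raw_generators_subset:
  "{X s -` B \<inter> space M | s B. 0 \<le> s \<and> ennreal s \<le> t \<and> B \<in> sets borel} \<subseteq> Pow (space M)"
  by auto

lemma space_raw [simp]: "space (raw_filtration M X t) = space M"
  unfolding raw_filtration_def by (rule space_measure_of[OF raw_generators_subset])

lemma X_measurable_raw:
  assumes "0 \<le> s" "ennreal s \<le> t"
  shows "X s \<in> borel_measurable (raw_filtration M X t)"
proof (rule measurableI)
  fix B :: "real set" assume "B \<in> sets borel"
  then show "X s -` B \<inter> space (raw_filtration M X t) \<in> sets (raw_filtration M X t)"
    unfolding space_raw using assms
    by (auto simp: raw_filtration_def sets_measure_of[OF raw_generators_subset])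
qed simp

lemma raw_subset_M: "sets (raw_filtration M X t) \<subseteq> sets M"
proof -
  have "{X s -` B \<inter> space M | s B. 0 \<le> s \<and> ennreal s \<le> t \<and> B \<in> sets borel} \<subseteq> sets M"
    using measurable_X by (auto intro: measurable_sets)
  then show ?thesis
    unfolding raw_filtration_def sets_measure_of[OF raw_generators_subset]
    by (rule sets.sigma_sets_subset)
qed

lemma raw_mono: "s \<le> t \<Longrightarrow> sets (raw_filtration M X s) \<subseteq> sets (raw_filtration M X t)"
  unfolding raw_filtration_def sets_measure_of[OF raw_generators_subset]
  by (rule sigma_sets_mono') (fastforce intro: order_trans)

lemma completed_generators_subset: "{A. A \<subseteq> space M \<and>
       (\<forall>\<mu>\<in>space (prob_algebra borel). \<exists>B\<in>sets (raw_filtration M X t).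
          \<exists>N\<in>sets (raw_filtration M X \<infinity>).
            (A - B) \<union> (B - A) \<subseteq> N \<and> (\<integral>\<^sup>+x. emeasure (P x) N \<partial>\<mu>) = 0)} \<subseteq> Pow (space M)"
  by auto

lemma space_completed [simp]: "space (completed_filtration M P X t) = space M"
  unfolding completed_filtration_def by (rule space_measure_of[OF completed_generators_subset])

lemma natural_generators_subset:
  "{A. \<forall>s. t < s \<or> s = \<infinity> \<longrightarrow> A \<in> sets (completed_filtration M P X s)} \<subseteq> Pow (space M)"
proof safe
  fix A a assume "\<forall>s. t < s \<or> s = \<infinity> \<longrightarrow> A \<in> sets (completed_filtration M P X s)" "a \<in> A"
  then have "A \<in> sets (completed_filtration M P X \<infinity>)" by auto
  from sets.sets_into_space[OF this] \<open>a \<in> A\<close> show "a \<in> space M"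
    by auto
qed

lemma completed_subset_completion:
  "sets (completed_filtration M P X t) \<subseteq> sets (completion (P x))"
proof -
  have "A \<in> sets (completion (P x))"
    if sub: "A \<subseteq> space M" and A: "\<forall>\<mu>\<in>space (prob_algebra borel). \<exists>B\<in>sets (raw_filtration M X t).
          \<exists>N\<in>sets (raw_filtration M X \<infinity>).
            (A - B) \<union> (B - A) \<subseteq> N \<and> (\<integral>\<^sup>+x. emeasure (P x) N \<partial>\<mu>) = 0" for A
  proof -
    \<comment> \<open>Completeness for all initial laws is used for the point mass at \<open>x\<close>.\<close>
    have "return borel x \<in> space (prob_algebra borel)"
      by (simp add: space_prob_algebra prob_space_return)
    from bspec[OF A this] obtain B N where B': "B \<in> sets (raw_filtration M X t)"
      and N': "N \<in> sets (raw_filtration M X \<infinity>)" and sub: "(A - B) \<union> (B - A) \<subseteq> N"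
      and z: "(\<integral>\<^sup>+x. emeasure (P x) N \<partial>return borel x) = 0"
      by (elim bexE conjE)
    have B: "B \<in> sets M" and N: "N \<in> sets M"
      using subsetD[OF raw_subset_M B'] subsetD[OF raw_subset_M N'] by auto
    have "(\<integral>\<^sup>+x. emeasure (P x) N \<partial>return borel x) = emeasure (P x) N"
    proof (rule nn_integral_return)
      show "(\<lambda>x. emeasure (P x) N) \<in> borel_measurable borel"
        by (rule measurable_compose[OF kernel_subprob measurable_emeasure_subprob_algebra[OF N]])
    qed simp
    then have N0: "N \<in> null_sets (P x)" using z N by (simp add: null_sets_def)
    have "A - B \<in> null_sets (completion (P x))" "B - A \<in> null_sets (completion (P x))"
      by (rule null_sets_completion_subset[OF _ null_sets_completionI[OF N0]], use sub in blast)+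
    moreover have "B \<in> sets (completion (P x))" using B by simp
    moreover have "A = (B - (B - A)) \<union> (A - B)" by blast
    ultimately show ?thesis by (metis null_setsD2 sets.Diff sets.Un)
  qed
  then show ?thesis
    unfolding completed_filtration_def sets_measure_of[OF completed_generators_subset]
    unfolding space_P[of x, symmetric] space_completion[of "P x", symmetric]
    by (intro sets.sigma_sets_subset) auto
qed

lemma natural_subset_completion:
  "sets (natural_filtration M P X t) \<subseteq> sets (completion (P x))"
proof -
  have "{A. \<forall>s. t < s \<or> s = \<infinity> \<longrightarrow> A \<in> sets (completed_filtration M P X s)}
      \<subseteq> sets (completion (P x))"
    using completed_subset_completion[of \<infinity> x] by auto
  then show ?thesis
    unfolding natural_filtration_def sets_measure_of[OF natural_generators_subset]
    unfolding space_P[of x, symmetric] space_completion[of "P x", symmetric]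
    by (rule sets.sigma_sets_subset)
qed

lemma space_natural [simp]: "space (natural_filtration M P X t) = space M"
  unfolding natural_filtration_def by (rule space_measure_of[OF natural_generators_subset])

lemma filtration_natural: "filtration (space M) (natural_filtration M P X)"
proof
  fix s t :: ennreal assume "s \<le> t"
  then show "sets (natural_filtration M P X s) \<subseteq> sets (natural_filtration M P X t)"
    unfolding natural_filtration_def sets_measure_of[OF natural_generators_subset]
    by (intro sigma_sets_mono') (auto intro: order.strict_trans1)
qed simp

text \<open>
  Membership in the augmented filtration is always obtained in this way: the event agrees, up to
  one raw null set common to all starting points, with an event of the immediate raw future.
  Such a null set is null for every initial distribution.
\<close>

lemma natural_filtrationI:
  assumes "A \<subseteq> space M" and "\<And>s. t < s \<or> s = \<infinity> \<Longrightarrow> B \<in> sets (raw_filtration M X s)"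
    and "N \<in> sets (raw_filtration M X \<infinity>)" and "\<And>x. emeasure (P x) N = 0"
    and "(A - B) \<union> (B - A) \<subseteq> N"
  shows "A \<in> sets (natural_filtration M P X t)"
proof -
  have "A \<in> sets (completed_filtration M P X s)" if "t < s \<or> s = \<infinity>" for s
    unfolding completed_filtration_def sets_measure_of[OF completed_generators_subset]
    by (intro sigma_sets.Basic CollectI conjI ballI assms(1)
          bexI[OF _ assms(2)[OF that]] bexI[OF _ assms(3)] assms(5)) (simp add: assms(4))
  then show ?thesis
    unfolding natural_filtration_def sets_measure_of[OF natural_generators_subset]
    by (intro sigma_sets.Basic) auto
qed

lemma X_measurable_natural:
  assumes "0 \<le> s" "ennreal s \<le> t"
  shows "X s \<in> borel_measurable (natural_filtration M P X t)"
proof (rule measurableI)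
  fix B :: "real set" assume B: "B \<in> sets borel"
  show "X s -` B \<inter> space (natural_filtration M P X t) \<in> sets (natural_filtration M P X t)"
  proof (rule natural_filtrationI[where B="X s -` B \<inter> space M" and N="{}"])
    fix u assume "t < u \<or> u = \<infinity>"
    then have "ennreal s \<le> u" using assms(2) by auto
    from measurable_sets[OF X_measurable_raw[OF assms(1) this] B]
    show "X s -` B \<inter> space M \<in> sets (raw_filtration M X u)" by simp
  qed auto
qed simp

text \<open>
  The augmented filtration is right-continuous, so the strict inequalities \<open>S < u\<close> in the raw
  filtration suffice, and it is complete, so \<open>S\<close> matters only off a null set.
\<close>

lemma stopping_timesI:
  assumes S: "\<And>u. 0 < u \<Longrightarrow> {\<omega>\<in>space M. S \<omega> < ennreal u} \<in> sets (raw_filtration M X (ennreal u))"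
    and N: "N \<in> sets (raw_filtration M X \<infinity>)" "\<And>x. emeasure (P x) N = 0"
    and eq: "\<And>\<omega>. \<omega> \<in> space M \<Longrightarrow> \<omega> \<notin> N \<Longrightarrow> T \<omega> = S \<omega>"
  shows "T \<in> stopping_times M P X"
proof -
  have "{\<omega>\<in>space M. T \<omega> \<le> t} \<in> sets (natural_filtration M P X t)" for t
  proof (cases "t = \<infinity>")
    case True
    then show ?thesis using sets.top[of "natural_filtration M P X t"] by simp
  next
    case False
    show ?thesis
    proof (rule natural_filtrationI[where B="{\<omega>\<in>space M. S \<omega> \<le> t}" and N=N])
      fix s assume "t < s \<or> s = \<infinity>"
      then have ts: "t < s" using False by (auto simp: less_top)
      define D where "D = {q::rat. 0 < q \<and> t < ennreal (of_rat q) \<and> ennreal (of_rat q) < s}"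
      have dense: "\<exists>q\<in>D. ennreal (of_rat q) < y" if "t < y" for y
      proof -
        have "t < min y s" using that ts by simp
        then obtain q where "0 < q" "t < ennreal (real_of_rat q)" "ennreal (real_of_rat q) < min y s"
          by (smt (verit, best) ennreal_rat_dense ennreal_less_zero_iff not_gr_zero of_rat_less_0_iff
              zero_less_of_rat_iff order.strict_trans ennreal_0 ennreal_neg less_eq_real_def not_le)
        then show ?thesis by (auto simp: D_def)
      qed
      \<comment> \<open>Right-continuity: only times in \<open>(t,s)\<close> are inspected, so the event is known at time \<open>s\<close>.\<close>
      have "{\<omega>\<in>space M. S \<omega> \<le> t} = (\<Inter>q\<in>D. {\<omega>\<in>space M. S \<omega> < ennreal (of_rat q)})"
        (is "?L = ?R")
      proof (rule set_eqI)
        fix \<omega>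
        obtain q0 where q0: "q0 \<in> D" using dense[OF ts] by auto
        show "\<omega> \<in> ?L \<longleftrightarrow> \<omega> \<in> ?R"
        proof
          show "\<omega> \<in> ?L \<Longrightarrow> \<omega> \<in> ?R" by (auto simp: D_def)
          assume R: "\<omega> \<in> ?R"
          then have "\<omega> \<in> space M" using q0 by auto
          moreover have "S \<omega> \<le> t"
          proof (rule ccontr)
            assume "\<not> S \<omega> \<le> t"
            then obtain q where "q \<in> D" "ennreal (of_rat q) < S \<omega>" using dense[of "S \<omega>"] by (auto simp: not_le)
            then show False using R by auto
          qed
          ultimately show "\<omega> \<in> ?L" by simp
        qed
      qed
      also have "\<dots> \<in> sets (raw_filtration M X s)"
      proof (rule sets.countable_INT')
        show "D \<noteq> {}" using dense[OF ts] by auto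
        have "{\<omega>\<in>space M. S \<omega> < ennreal (of_rat q)} \<in> sets (raw_filtration M X s)" if "q \<in> D" for q
          using S[of "of_rat q"] raw_mono[of "ennreal (of_rat q)" s] that
          by (auto simp: D_def dest: less_imp_le)
        then show "(\<lambda>q. {\<omega>\<in>space M. S \<omega> < ennreal (of_rat q)}) ` D \<subseteq> sets (raw_filtration M X s)"
          by blast
      qed simp
      finally show "{\<omega>\<in>space M. S \<omega> \<le> t} \<in> sets (raw_filtration M X s)" .
    qed (use N eq sets.sets_into_space[OF N(1)] in auto)
  qed
  then show ?thesis
    by (simp add: stopping_times_def stopping_time_def pred_def)
qed

text \<open>
  By right-continuity a visit to an open set persists for a short time, so rational times detect it.
\<close>

lemma entrance_after_less_iff:
  assumes "\<omega> \<in> space M" "open S" "0 \<le> s" "0 < u"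
  shows "entrance_after X s S \<omega> < ennreal u \<longleftrightarrow> (\<exists>q\<in>{q\<in>\<rat>. s \<le> q \<and> q < u}. X q \<omega> \<in> S)"
proof
  assume "entrance_after X s S \<omega> < ennreal u"
  then obtain t where t: "s \<le> t" "X t \<omega> \<in> S" and "ennreal t < ennreal u"
    unfolding entrance_after_def Inf_less_iff by blast
  then have "t < u" using \<open>0 \<le> s\<close> by (simp add: ennreal_less_iff)
  note t = t this
  have "eventually (\<lambda>q. X q \<omega> \<in> S) (at_right t)"
    using topological_tendstoD[OF X_tendsto_right[OF assms(1)] \<open>open S\<close> t(2)] t \<open>0 \<le> s\<close> by simp
  then obtain b where b: "t < b" "\<And>q. t < q \<Longrightarrow> q < b \<Longrightarrow> X q \<omega> \<in> S"
    by (auto simp: eventually_at_right_field)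
  obtain q where "q \<in> \<rat>" "t < q" "q < min b u"
    using Rats_dense_in_real[of t "min b u"] b t by auto
  then show "\<exists>q\<in>{q\<in>\<rat>. s \<le> q \<and> q < u}. X q \<omega> \<in> S" using b(2)[of q] t(1) by (intro bexI[of _ q]) simp_all
next
  assume "\<exists>q\<in>{q\<in>\<rat>. s \<le> q \<and> q < u}. X q \<omega> \<in> S"
  then obtain q where "s \<le> q" "q < u" "X q \<omega> \<in> S" by auto
  then show "entrance_after X s S \<omega> < ennreal u"
    unfolding entrance_after_def Inf_less_iff using \<open>0 \<le> s\<close> \<open>0 < u\<close>
    by (intro bexI[of _ "ennreal q"]) (auto simp: ennreal_less_iff)
qed

lemma entrance_after_open_raw:
  assumes "open S" "0 \<le> s" "0 < u"
  shows "{\<omega>\<in>space M. entrance_after X s S \<omega> < ennreal u} \<in> sets (raw_filtration M X (ennreal u))"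
proof -
  have "{\<omega>\<in>space M. entrance_after X s S \<omega> < ennreal u} =
      (\<Union>q\<in>{q\<in>\<rat>. s \<le> q \<and> q < u}. X q -` S \<inter> space (raw_filtration M X (ennreal u)))"
    (is "?L = ?R")
  proof (rule set_eqI)
    show "\<omega> \<in> ?L \<longleftrightarrow> \<omega> \<in> ?R" for \<omega>
      using entrance_after_less_iff[OF _ assms, of \<omega>] by (cases "\<omega> \<in> space M") simp_all
  qed
  also have "\<dots> \<in> sets (raw_filtration M X (ennreal u))"
  proof (rule sets.countable_UN'')
    show "countable {q\<in>\<rat>. s \<le> q \<and> q < u}"
      by (rule countable_subset[OF _ countable_rat]) auto
    fix q assume "q \<in> {q\<in>\<rat>. s \<le> q \<and> q < u}"
    then have "X q \<in> borel_measurable (raw_filtration M X (ennreal u))"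
      using assms by (intro X_measurable_raw) (auto intro!: ennreal_leI)
    then show "X q -` S \<inter> space (raw_filtration M X (ennreal u)) \<in> sets (raw_filtration M X (ennreal u))"
      by (rule measurable_sets) (use assms in simp)
  qed
  finally show ?thesis .
qed

lemma entrance_after_open_stopping:
  assumes "open S" "0 \<le> s"
  shows "entrance_after X s S \<in> stopping_times M P X"
  by (rule stopping_timesI[where S="entrance_after X s S" and N="{}"])
     (use entrance_after_open_raw[OF assms] in auto)

text \<open>
  At its entrance time the path is a limit from the right of visited points, so only the closure is reached.
\<close>

lemma entrance_after_closure:
  assumes "\<omega> \<in> space M" "0 \<le> s" "entrance_after X s S \<omega> < \<infinity>"
  shows "at_time X (entrance_after X s S) \<omega> \<in> closure S"
proof (rule ccontr)
  define t where "t = enn2real (entrance_after X s S \<omega>)"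
  have t: "entrance_after X s S \<omega> = ennreal t" "0 \<le> t"
    using assms by (auto simp: t_def less_top)
  assume "at_time X (entrance_after X s S) \<omega> \<notin> closure S"
  then have nin: "X t \<omega> \<in> - closure S" by (simp add: at_time_def t_def)
  have "eventually (\<lambda>q. X q \<omega> \<in> - closure S) (at_right t)"
    using topological_tendstoD[OF X_tendsto_right[OF assms(1) t(2)] open_Compl[OF closed_closure] nin] .
  then obtain b where b: "t < b" "\<And>q. t < q \<Longrightarrow> q < b \<Longrightarrow> X q \<omega> \<notin> closure S"
    by (auto simp: eventually_at_right_field)
  have "entrance_after X s S \<omega> < ennreal b" using t b by (simp add: ennreal_less_iff)
  then obtain q where q: "s \<le> q" "X q \<omega> \<in> S" "ennreal q < ennreal b"
    unfolding entrance_after_def Inf_less_iff by auto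
  have "entrance_after X s S \<omega> \<le> ennreal q"
    unfolding entrance_after_def using q by (intro Inf_lower) auto
  then have "t \<le> q" using t q assms by (simp add: ennreal_le_iff)
  moreover have "q \<noteq> t" using q nin closure_subset[of S] by auto
  moreover have "q < b" using q b t assms by (simp add: ennreal_less_iff)
  ultimately have "X q \<omega> \<notin> closure S" using b by auto
  then show False using q closure_subset[of S] by auto
qed


section \<open>The strong Markov property for functions\<close>

lemma X_measurable_completion: "0 \<le> t \<Longrightarrow> X t \<in> borel_measurable (completion (P x))"
  using measurable_X[of t] by (intro measurable_completion) simp

lemma stopping_times_iff: "T \<in> stopping_times M P X \<longleftrightarrow> stopping_time (natural_filtration M P X) T"
  by (simp add: stopping_times_def)

lemma stopping_times_measurable:
  assumes "T \<in> stopping_times M P X"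
  shows "T \<in> borel_measurable (completion (P x))"
proof (rule measurable_stopping_time)
  show "stopping_time (natural_filtration M P X) T" using assms by (simp add: stopping_times_iff)
qed (use natural_subset_completion in auto)

lemma pre_sigma_subalgebra:
  assumes "T \<in> stopping_times M P X"
  shows "subalgebra (completion (P x)) (filtration.pre_sigma (space M) (natural_filtration M P X) T)"
proof -
  interpret F: filtration "space M" "natural_filtration M P X" by (rule filtration_natural)
  have "A \<in> sets (completion (P x))" if "A \<in> sets (F.pre_sigma T)" for A
    using F.sets_pre_sigmaD[of T A \<infinity>] that assms natural_subset_completion[of \<infinity> x]
    by (auto simp: stopping_times_iff)
  then show ?thesis by (auto simp: subalgebra_def F.space_pre_sigma)
qed

definition transition :: "real \<Rightarrow> (real \<Rightarrow> ennreal) \<Rightarrow> real \<Rightarrow> ennreal" where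
  "transition t f x = (\<integral>\<^sup>+\<omega>. f (X t \<omega>) \<partial>P x)"

lemma transition_0: "transition 0 v x = v x"
proof -
  interpret Px: prob_space "P x" by (rule prob_space_P)
  have "transition 0 v x = (\<integral>\<^sup>+\<omega>. v x \<partial>P x)"
    unfolding transition_def using start[of x] by (intro nn_integral_cong_AE) auto
  then show ?thesis using Px.emeasure_space_1 by simp
qed

lemma transition_path_measurable:
  assumes [measurable]: "f \<in> borel_measurable borel"
  shows "(\<lambda>(t, x). transition (max 0 t) f x) \<in> borel_measurable (borel \<Otimes>\<^sub>M borel)"
proof -
  have "(\<lambda>(p, \<omega>). f (X (max 0 (fst p)) \<omega>))
      \<in> borel_measurable ((borel \<Otimes>\<^sub>M borel :: (real \<times> real) measure) \<Otimes>\<^sub>M M)"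
  proof -
    have "(\<lambda>q. (fst (fst q), snd q)) \<in>
        (borel \<Otimes>\<^sub>M borel :: (real \<times> real) measure) \<Otimes>\<^sub>M M \<rightarrow>\<^sub>M borel \<Otimes>\<^sub>M M"
      by measurable
    from measurable_compose[OF measurable_compose[OF this X_path_measurable[OF refl measurable_X]] assms]
    show ?thesis by (simp add: case_prod_beta')
  qed
  moreover have "(\<lambda>p. P (snd p)) \<in> (borel \<Otimes>\<^sub>M borel :: (real \<times> real) measure) \<rightarrow>\<^sub>M subprob_algebra M"
    by measurable
  ultimately have "(\<lambda>p. \<integral>\<^sup>+\<omega>. f (X (max 0 (fst p)) \<omega>) \<partial>P (snd p))
      \<in> borel_measurable (borel \<Otimes>\<^sub>M borel :: (real \<times> real) measure)"
    by (rule nn_integral_measurable_subprob_algebra2)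
  then show ?thesis by (simp only: transition_def case_prod_beta')
qed

lemma transition_measurable:
  assumes "f \<in> borel_measurable borel" "0 \<le> t"
  shows "transition t f \<in> borel_measurable borel"
proof -
  have "(\<lambda>x::real. (t, x)) \<in> borel \<rightarrow>\<^sub>M (borel \<Otimes>\<^sub>M borel)" by measurable
  from measurable_compose[OF this transition_path_measurable[OF assms(1)]] show ?thesis
    using assms(2) by (simp add: max_absorb2)
qed

text \<open>
  The strong Markov property for events extends to a weight that is measurable with respect to the
  past of \<open>T\<close>, by comparing two measures on that \<sigma>-algebra, and then to functions of the
  future position by approximation with simple functions.
\<close>

lemma strong_markov_weighted:
  assumes T: "T \<in> stopping_times M P X"
    and h: "h \<in> borel_measurable (filtration.pre_sigma (space M) (natural_filtration M P X) T)"
    and f: "f \<in> borel_measurable borel" and t: "0 \<le> t"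
  shows "(\<integral>\<^sup>+\<omega>\<in>{\<omega>. T \<omega> < \<infinity>}. h \<omega> * f (X (enn2real (T \<omega>) + t) \<omega>) \<partial>completion (P x)) =
    (\<integral>\<^sup>+\<omega>\<in>{\<omega>. T \<omega> < \<infinity>}. h \<omega> * transition t f (at_time X T \<omega>) \<partial>completion (P x))"
proof -
  let ?F = "filtration.pre_sigma (space M) (natural_filtration M P X) T"
  let ?C = "completion (P x)"
  have sub: "subalgebra ?C ?F" by (rule pre_sigma_subalgebra[OF T])
  have [measurable]: "T \<in> borel_measurable ?C" by (rule stopping_times_measurable[OF T])
  have [measurable]: "(\<lambda>\<omega>. X (enn2real (T \<omega>) + t) \<omega>) \<in> borel_measurable ?C"
    by (rule X_random_time_measurable) (use X_measurable_completion t in auto)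
  have [measurable]: "at_time X T \<in> borel_measurable ?C"
    by (rule at_time_measurable) (use X_measurable_completion in auto)
  have hC [measurable]: "h \<in> borel_measurable ?C"
    by (rule measurable_from_subalg[OF sub h])
  show ?thesis using f
  proof (induction rule: borel_measurable_induct)
    case (cong f g)
    then show ?case by (simp add: transition_def)
  next
    case (set B)
    have [measurable]: "B \<in> sets borel" by (rule set)
    have tr: "transition t (indicator B) z = emeasure (P z) {\<omega>'\<in>space M. X t \<omega>' \<in> B}" for z
    proof -
      have "{\<omega>'\<in>space M. X t \<omega>' \<in> B} \<in> sets (P z)"
        using measurable_sets[OF measurable_X[OF t] \<open>B \<in> sets borel\<close>]
        by (simp add: vimage_def Int_def conj_commute)
      then have "emeasure (P z) {\<omega>'\<in>space M. X t \<omega>' \<in> B} =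
          (\<integral>\<^sup>+\<omega>. indicator {\<omega>'\<in>space M. X t \<omega>' \<in> B} \<omega> \<partial>P z)" by simp
      also have "\<dots> = transition t (indicator B) z"
        unfolding transition_def by (intro nn_integral_cong) (auto simp: indicator_def)
      finally show ?thesis ..
    qed
    have trm [measurable]: "transition t (indicator B) \<in> borel_measurable borel"
      by (rule transition_measurable) (use t in auto)
    \<comment> \<open>The two densities give the two sides of the property for events the same mass on the past of \<open>T\<close>.\<close>
    define a where "a = (\<lambda>\<omega>. indicator B (X (enn2real (T \<omega>) + t) \<omega>) * indicator {\<omega>. T \<omega> < \<infinity>} \<omega> :: ennreal)"
    define b where "b = (\<lambda>\<omega>. transition t (indicator B) (at_time X T \<omega>) * indicator {\<omega>. T \<omega> < \<infinity>} \<omega>)"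
    have [measurable]: "a \<in> borel_measurable ?C" "b \<in> borel_measurable ?C"
      unfolding a_def b_def by measurable
    have "(\<integral>\<^sup>+\<omega>. h \<omega> \<partial>density ?C a) = (\<integral>\<^sup>+\<omega>. h \<omega> \<partial>density ?C b)"
    proof (rule nn_integral_eq_on_subalgebra[OF _ _ _ h])
      fix A assume A: "A \<in> sets ?F"
      have AC [measurable]: "A \<in> sets ?C" using A sub by (auto simp: subalgebra_def)
      have AM: "A \<subseteq> space M" using sets.sets_into_space[OF AC] by simp
      have "emeasure (density ?C a) A = (\<integral>\<^sup>+\<omega>. indicator {\<omega>\<in>A. T \<omega> < \<infinity> \<and> X (enn2real (T \<omega>) + t) \<omega> \<in> B} \<omega> \<partial>?C)"
        unfolding emeasure_density[OF \<open>a \<in> borel_measurable ?C\<close> AC]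
        by (rule nn_integral_cong) (auto simp: a_def indicator_def)
      also have "\<dots> = emeasure ?C {\<omega>\<in>A. T \<omega> < \<infinity> \<and> X (enn2real (T \<omega>) + t) \<omega> \<in> B}"
      proof (rule nn_integral_indicator)
        have "{\<omega>\<in>space ?C. \<omega> \<in> A \<and> T \<omega> < \<infinity> \<and> X (enn2real (T \<omega>) + t) \<omega> \<in> B} \<in> sets ?C"
          by measurable
        then show "{\<omega>\<in>A. T \<omega> < \<infinity> \<and> X (enn2real (T \<omega>) + t) \<omega> \<in> B} \<in> sets ?C"
          using AM by (simp add: subset_eq cong: conj_cong)
      qed
      also have "\<dots> = (\<integral>\<^sup>+\<omega>\<in>{\<omega>\<in>A. T \<omega> < \<infinity>}. emeasure (P (at_time X T \<omega>)) {\<omega>'\<in>space M. X t \<omega>' \<in> B} \<partial>?C)"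
        by (rule strong_markov[OF T A t \<open>B \<in> sets borel\<close>])
      also have "\<dots> = emeasure (density ?C b) A"
        unfolding emeasure_density[OF \<open>b \<in> borel_measurable ?C\<close> AC]
        by (rule nn_integral_cong) (auto simp: b_def tr indicator_def)
      finally show "emeasure (density ?C a) A = emeasure (density ?C b) A" .
    qed (use sub in \<open>auto simp: subalgebra_def\<close>)
    then have "(\<integral>\<^sup>+\<omega>. a \<omega> * h \<omega> \<partial>?C) = (\<integral>\<^sup>+\<omega>. b \<omega> * h \<omega> \<partial>?C)"
      by (simp only: nn_integral_density[OF \<open>a \<in> borel_measurable ?C\<close> hC]
          nn_integral_density[OF \<open>b \<in> borel_measurable ?C\<close> hC])
    then show ?case unfolding a_def b_def by (simp only: mult_ac)
  next
    case (mult f c)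
    have [measurable]: "transition t f \<in> borel_measurable borel" "f \<in> borel_measurable borel"
      using transition_measurable mult t by auto
    have tr: "transition t (\<lambda>y. c * f y) z = c * transition t f z" for z
      unfolding transition_def using measurable_X[OF t] by (subst nn_integral_cmult) auto
    have "(\<integral>\<^sup>+\<omega>\<in>{\<omega>. T \<omega> < \<infinity>}. h \<omega> * (c * f (X (enn2real (T \<omega>) + t) \<omega>)) \<partial>?C)
        = c * (\<integral>\<^sup>+\<omega>\<in>{\<omega>. T \<omega> < \<infinity>}. h \<omega> * f (X (enn2real (T \<omega>) + t) \<omega>) \<partial>?C)"
      by (subst nn_integral_cmult[symmetric]) (auto simp: mult_ac)
    also have "\<dots> = c * (\<integral>\<^sup>+\<omega>\<in>{\<omega>. T \<omega> < \<infinity>}. h \<omega> * transition t f (at_time X T \<omega>) \<partial>?C)"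
      by (simp only: mult.IH)
    also have "\<dots> = (\<integral>\<^sup>+\<omega>\<in>{\<omega>. T \<omega> < \<infinity>}. h \<omega> * (c * transition t f (at_time X T \<omega>)) \<partial>?C)"
      by (subst nn_integral_cmult[symmetric]) (auto simp: mult_ac)
    finally show ?case by (simp only: tr)
  next
    case (add f g)
    have [measurable]: "transition t f \<in> borel_measurable borel" "transition t g \<in> borel_measurable borel"
      "f \<in> borel_measurable borel" "g \<in> borel_measurable borel"
      using transition_measurable add t by auto
    have tr: "transition t (\<lambda>y. g y + f y) z = transition t g z + transition t f z" for z
      unfolding transition_def using measurable_X[OF t] by (subst nn_integral_add) auto
    have "(\<integral>\<^sup>+\<omega>\<in>{\<omega>. T \<omega> < \<infinity>}. h \<omega> * (g (X (enn2real (T \<omega>) + t) \<omega>) + f (X (enn2real (T \<omega>) + t) \<omega>)) \<partial>?C)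
        = (\<integral>\<^sup>+\<omega>\<in>{\<omega>. T \<omega> < \<infinity>}. h \<omega> * g (X (enn2real (T \<omega>) + t) \<omega>) \<partial>?C) +
          (\<integral>\<^sup>+\<omega>\<in>{\<omega>. T \<omega> < \<infinity>}. h \<omega> * f (X (enn2real (T \<omega>) + t) \<omega>) \<partial>?C)"
      by (subst nn_integral_add[symmetric]) (auto simp: distrib_left distrib_right)
    also have "\<dots> = (\<integral>\<^sup>+\<omega>\<in>{\<omega>. T \<omega> < \<infinity>}. h \<omega> * transition t g (at_time X T \<omega>) \<partial>?C) +
        (\<integral>\<^sup>+\<omega>\<in>{\<omega>. T \<omega> < \<infinity>}. h \<omega> * transition t f (at_time X T \<omega>) \<partial>?C)"
      by (simp only: add.IH)
    also have "\<dots> = (\<integral>\<^sup>+\<omega>\<in>{\<omega>. T \<omega> < \<infinity>}. h \<omega> * (transition t g (at_time X T \<omega>) + transition t f (at_time X T \<omega>)) \<partial>?C)"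
      by (subst nn_integral_add[symmetric]) (auto simp: distrib_left distrib_right)
    finally show ?case by (simp only: tr)
  next
    case (seq U)
    have Um [measurable]: "U i \<in> borel_measurable borel" for i by (rule seq)
    have [measurable]: "transition t (U i) \<in> borel_measurable borel" for i
      using transition_measurable[OF Um t] .
    have inc: "incseq (\<lambda>i. U i y)" for y using seq(3) by (auto simp: incseq_def le_fun_def)
    have tr: "transition t (\<lambda>y. SUP i. U i y) z = (SUP i. transition t (U i) z)" for z
      unfolding transition_def using measurable_X[OF t]
      by (intro nn_integral_monotone_convergence_SUP)
         (use seq(3) in \<open>auto simp: incseq_def le_fun_def\<close>)
    have trinc: "incseq (\<lambda>i. transition t (U i) z)" for z
      unfolding transition_def using inc by (auto simp: incseq_def intro!: nn_integral_mono)
    have sup: "(\<integral>\<^sup>+\<omega>. (SUP i. h \<omega> * W i \<omega> * indicator {\<omega>. T \<omega> < \<infinity>} \<omega>) \<partial>?C)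
        = (SUP i. \<integral>\<^sup>+\<omega>. h \<omega> * W i \<omega> * indicator {\<omega>. T \<omega> < \<infinity>} \<omega> \<partial>?C)"
      if [measurable]: "\<And>i. W i \<in> borel_measurable ?C" and "\<And>\<omega>. incseq (\<lambda>i. W i \<omega>)" for W
      using that(2) by (intro nn_integral_monotone_convergence_SUP)
        (auto simp: incseq_def le_fun_def intro!: mult_right_mono mult_left_mono)
    have SUPeq: "(SUP i. U i) y = (SUP i. U i y)" for y by (simp add: image_image)
    have "(\<integral>\<^sup>+\<omega>\<in>{\<omega>. T \<omega> < \<infinity>}. h \<omega> * (SUP i. U i (X (enn2real (T \<omega>) + t) \<omega>)) \<partial>?C)
       = (SUP i. \<integral>\<^sup>+\<omega>\<in>{\<omega>. T \<omega> < \<infinity>}. h \<omega> * U i (X (enn2real (T \<omega>) + t) \<omega>) \<partial>?C)"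
      by (subst sup[symmetric]) (use inc in \<open>auto simp: SUP_mult_left_ennreal SUP_mult_right_ennreal\<close>)
    also have "\<dots> = (SUP i. \<integral>\<^sup>+\<omega>\<in>{\<omega>. T \<omega> < \<infinity>}. h \<omega> * transition t (U i) (at_time X T \<omega>) \<partial>?C)"
      by (simp only: seq.IH)
    also have "\<dots> = (\<integral>\<^sup>+\<omega>\<in>{\<omega>. T \<omega> < \<infinity>}. h \<omega> * (SUP i. transition t (U i) (at_time X T \<omega>)) \<partial>?C)"
      by (subst sup[symmetric]) (use trinc in \<open>auto simp: SUP_mult_left_ennreal SUP_mult_right_ennreal\<close>)
    finally show ?case by (simp only: tr[symmetric] SUPeq)
  qed
qed


text \<open>
  The resolvent is defined by its values on sets; it is identified with the image under the path
  map of a weighted product measure, which also shows that these values form a measure.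
\<close>

lemma nn_integral_resolvent:
  assumes f: "f \<in> borel_measurable borel"
  shows "(\<integral>\<^sup>+y. f y \<partial>resolvent P X r x) =
    (\<integral>\<^sup>+t\<in>{0..}. ennreal (exp (- r * t)) * transition t f x \<partial>lborel)"
proof -
  interpret Px: prob_space "P x" by (rule prob_space_P)
  interpret L: pair_sigma_finite "lborel :: real measure" "P x" ..
  define w :: "real \<times> 'w \<Rightarrow> ennreal" where "w p = ennreal (exp (- r * fst p)) * indicator {0..} (fst p)" for p
  define Z where "Z p = X (max 0 (fst p)) (snd p)" for p
  have [measurable]: "w \<in> borel_measurable (lborel \<Otimes>\<^sub>M P x)" unfolding w_def by measurable
  have [measurable]: "Z \<in> borel_measurable (lborel \<Otimes>\<^sub>M P x)"
    using X_path_measurable[OF refl measurable_X]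
    by (simp add: Z_def[abs_def] case_prod_beta' cong: measurable_cong_sets)
  define N where "N = distr (density (lborel \<Otimes>\<^sub>M P x) w) borel Z"
  have N_integral: "(\<integral>\<^sup>+y. h y \<partial>N) =
      (\<integral>\<^sup>+t\<in>{0..}. ennreal (exp (- r * t)) * transition t h x \<partial>lborel)"
    if [measurable]: "h \<in> borel_measurable borel" for h
  proof -
    have "(\<integral>\<^sup>+y. h y \<partial>N) = (\<integral>\<^sup>+p. w p * h (Z p) \<partial>(lborel \<Otimes>\<^sub>M P x))"
      unfolding N_def by (simp add: nn_integral_distr nn_integral_density)
    also have "\<dots> = (\<integral>\<^sup>+t. \<integral>\<^sup>+\<omega>. w (t, \<omega>) * h (Z (t, \<omega>)) \<partial>P x \<partial>lborel)"
      by (rule Px.nn_integral_fst[symmetric]) measurable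
    also have "\<dots> = (\<integral>\<^sup>+t\<in>{0..}. ennreal (exp (- r * t)) * transition t h x \<partial>lborel)"
    proof (rule nn_integral_cong)
      fix t :: real
      show "(\<integral>\<^sup>+\<omega>. w (t, \<omega>) * h (Z (t, \<omega>)) \<partial>P x) =
          ennreal (exp (- r * t)) * transition t h x * indicator {0..} t"
        using measurable_X[of t] unfolding w_def Z_def transition_def
        by (cases "0 \<le> t") (simp_all add: nn_integral_cmult)
    qed
    finally show ?thesis .
  qed
  have N_sets: "emeasure N A = (\<integral>\<^sup>+t\<in>{0..}. ennreal (exp (- r * t)) *
      emeasure (P x) {\<omega>\<in>space (P x). X t \<omega> \<in> A} \<partial>lborel)" if A: "A \<in> sets borel" for A
  proof -
    have "emeasure N A = (\<integral>\<^sup>+y. indicator A y \<partial>N)" using A by (simp add: N_def)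
    also have "\<dots> = (\<integral>\<^sup>+t\<in>{0..}. ennreal (exp (- r * t)) * transition t (indicator A) x \<partial>lborel)"
      by (rule N_integral) (use A in simp)
    also have "\<dots> = (\<integral>\<^sup>+t\<in>{0..}. ennreal (exp (- r * t)) *
      emeasure (P x) {\<omega>\<in>space (P x). X t \<omega> \<in> A} \<partial>lborel)"
    proof (rule nn_integral_cong)
      fix t :: real
      show "ennreal (exp (- r * t)) * transition t (indicator A) x * indicator {0..} t =
          ennreal (exp (- r * t)) * emeasure (P x) {\<omega>\<in>space (P x). X t \<omega> \<in> A} * indicator {0..} t"
      proof (cases "0 \<le> t")
        case True
        have "{\<omega>\<in>space (P x). X t \<omega> \<in> A} \<in> sets (P x)"
          using measurable_sets[OF measurable_X[OF True] A]
          by (simp add: vimage_def Int_def conj_commute)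
        from nn_integral_indicator[OF this]
        have "emeasure (P x) {\<omega>\<in>space (P x). X t \<omega> \<in> A} =
            (\<integral>\<^sup>+\<omega>. indicator {\<omega>\<in>space (P x). X t \<omega> \<in> A} \<omega> \<partial>P x)" ..
        also have "\<dots> = transition t (indicator A) x"
          unfolding transition_def by (intro nn_integral_cong) (auto simp: indicator_def)
        finally show ?thesis by simp
      qed simp
    qed
    finally show ?thesis .
  qed
  have "resolvent P X r x = measure_of (space N) (sets N) (emeasure N)"
    unfolding resolvent_def
  proof -
    have sp: "space N = UNIV" "sets N = sets borel" by (auto simp: N_def)
    show "measure_of UNIV (sets borel) (\<lambda>A. \<integral>\<^sup>+t\<in>{0..}. ennreal (exp (- r * t)) *
        emeasure (P x) {\<omega> \<in> space (P x). X t \<omega> \<in> A} \<partial>lborel) = measure_of (space N) (sets N) (emeasure N)"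
      unfolding sp
    proof (rule measure_of_eq)
      fix A :: "real set" assume "A \<in> sigma_sets UNIV (sets borel)"
      then have "A \<in> sets borel" using sets.sigma_sets_eq[of "borel :: real measure"] by simp
      then show "(\<integral>\<^sup>+t\<in>{0..}. ennreal (exp (- r * t)) *
        emeasure (P x) {\<omega> \<in> space (P x). X t \<omega> \<in> A} \<partial>lborel) = emeasure N A"
        by (rule N_sets[symmetric])
    qed simp
  qed
  then have "resolvent P X r x = N" by (simp only: measure_of_of_measure)
  then show ?thesis using N_integral[OF f] by simp
qed

text \<open>
  With the time truncated at \<open>0\<close> the integrand is measurable on the whole line.
\<close>

lemma nn_integral_resolvent_max:
  assumes f: "f \<in> borel_measurable borel"
  shows "(\<integral>\<^sup>+y. f y \<partial>resolvent P X r x) =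
    (\<integral>\<^sup>+t. ennreal (exp (- r * t)) * transition (max 0 t) f x * indicator {0..} t \<partial>lborel)"
  unfolding nn_integral_resolvent[OF f]
  by (intro nn_integral_cong) (auto simp: indicator_def max_absorb2)

text \<open>
  The discount factor \<open>e\<^bsup>-rT\<^esup>\<close>, put to zero on \<open>{T = \<infinity>}\<close>, where the position at time \<open>T\<close> has no
  meaning.
\<close>

definition discount :: "real \<Rightarrow> ('w \<Rightarrow> ennreal) \<Rightarrow> 'w \<Rightarrow> ennreal" where
  "discount r T \<omega> = ennreal (exp (- r * enn2real (T \<omega>))) * indicator {\<omega>. T \<omega> < \<infinity>} \<omega>"

lemma discount_measurable:
  assumes [measurable]: "T \<in> borel_measurable F"
  shows "discount r T \<in> borel_measurable F"
  unfolding discount_def[abs_def] by measurable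

lemma strong_markov_discounted:
  assumes T: "T \<in> stopping_times M P X"
    and f: "f \<in> borel_measurable borel" and t: "0 \<le> t"
  shows "(\<integral>\<^sup>+\<omega>. discount r T \<omega> * f (X (enn2real (T \<omega>) + t) \<omega>) \<partial>P x) =
    (\<integral>\<^sup>+\<omega>. discount r T \<omega> * transition t f (at_time X T \<omega>) \<partial>P x)"
proof -
  interpret F: filtration "space M" "natural_filtration M P X" by (rule filtration_natural)
  have "T \<in> borel_measurable (F.pre_sigma T)"
    using T by (intro F.measurable_stopping_time_pre_sigma) (simp add: stopping_times_iff)
  then have [measurable]: "discount r T \<in> borel_measurable (F.pre_sigma T)" by (rule discount_measurable)
  have absorb: "discount r T \<omega> * y * indicator {\<omega>. T \<omega> < \<infinity>} \<omega> = discount r T \<omega> * y" for \<omega> y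
    by (simp add: discount_def indicator_def)
  from strong_markov_weighted[OF T \<open>discount r T \<in> borel_measurable (F.pre_sigma T)\<close> f t, of x]
  show ?thesis
    by (simp only: absorb nn_integral_completion)
qed

text \<open>
  The discounted occupation of \<open>f\<close> after \<open>T\<close> is the resolvent seen from \<open>X\<^sub>T\<close>: the strong Markov
  property at each time lag, integrated over the lag.
\<close>

lemma occupation_after_stopping_time:
  assumes T: "T \<in> stopping_times M P X"
    and f [measurable]: "f \<in> borel_measurable borel"
  shows "(\<integral>\<^sup>+\<omega>. discount r T \<omega> * (\<integral>\<^sup>+y. f y \<partial>resolvent P X r (at_time X T \<omega>)) \<partial>P x) =
    (\<integral>\<^sup>+\<omega>. (\<integral>\<^sup>+t\<in>{t. 0 \<le> t \<and> T \<omega> \<le> ennreal t}. ennreal (exp (- r * t)) * f (X t \<omega>) \<partial>lborel) \<partial>P x)"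
proof -
  let ?C = "completion (P x)"
  interpret Px: prob_space "P x" by (rule prob_space_P)
  interpret C: prob_space ?C by (rule Px.prob_space_completion)
  interpret L: pair_sigma_finite "lborel :: real measure" ?C ..
  have Tm [measurable]: "T \<in> borel_measurable ?C" by (rule stopping_times_measurable[OF T])
  have [measurable]: "discount r T \<in> borel_measurable ?C" by (rule discount_measurable[OF Tm])
  have Z [measurable]: "at_time X T \<in> borel_measurable ?C"
    by (rule at_time_measurable) (use X_measurable_completion in auto)
  have m1: "(\<lambda>p. transition (max 0 (fst p)) f (at_time X T (snd p))) \<in> borel_measurable (lborel \<Otimes>\<^sub>M ?C)"
  proof -
    have "(\<lambda>p. (fst p, at_time X T (snd p))) \<in> lborel \<Otimes>\<^sub>M ?C \<rightarrow>\<^sub>M borel \<Otimes>\<^sub>M borel" by measurable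
    from measurable_compose[OF this transition_path_measurable[OF f]] show ?thesis by (simp add: comp_def)
  qed
  have m2: "(\<lambda>p. f (X (enn2real (T (snd p)) + max 0 (fst p)) (snd p))) \<in> borel_measurable (lborel \<Otimes>\<^sub>M ?C)"
  proof -
    have "(\<lambda>p. (enn2real (T (snd p)) + max 0 (fst p), snd p)) \<in> lborel \<Otimes>\<^sub>M ?C \<rightarrow>\<^sub>M borel \<Otimes>\<^sub>M ?C" by measurable
    from measurable_compose[OF measurable_compose[OF this X_path_measurable] f]
    show ?thesis using X_measurable_completion by (simp add: max_absorb2)
  qed
  have m3: "(\<lambda>p. f (X (max 0 (fst p)) (snd p))) \<in> borel_measurable (lborel \<Otimes>\<^sub>M ?C)"
  proof -
    have "(\<lambda>p. p) \<in> lborel \<Otimes>\<^sub>M ?C \<rightarrow>\<^sub>M borel \<Otimes>\<^sub>M ?C" by measurable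
    from measurable_compose[OF measurable_compose[OF this X_path_measurable] f]
    show ?thesis using X_measurable_completion by (simp add: case_prod_beta')
  qed
  define e where "e t = ennreal (exp (- r * t)) * indicator {0..} t" for t :: real
  have [measurable]: "e \<in> borel_measurable borel" unfolding e_def by measurable
  have "(\<integral>\<^sup>+\<omega>. discount r T \<omega> * (\<integral>\<^sup>+y. f y \<partial>resolvent P X r (at_time X T \<omega>)) \<partial>?C) =
      (\<integral>\<^sup>+\<omega>. \<integral>\<^sup>+t. e t * (discount r T \<omega> * transition (max 0 t) f (at_time X T \<omega>)) \<partial>lborel \<partial>?C)"
  proof (rule nn_integral_cong)
    fix \<omega> assume w: "\<omega> \<in> space ?C"
    have "(\<integral>\<^sup>+y. f y \<partial>resolvent P X r (at_time X T \<omega>)) =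
        (\<integral>\<^sup>+t. e t * transition (max 0 t) f (at_time X T \<omega>) \<partial>lborel)"
      unfolding nn_integral_resolvent_max[OF f] e_def by (simp add: mult_ac)
    moreover have "(\<lambda>t. e t * transition (max 0 t) f (at_time X T \<omega>)) \<in> borel_measurable lborel"
      using measurable_Pair1[OF m1 w] by simp
    ultimately show "discount r T \<omega> * (\<integral>\<^sup>+y. f y \<partial>resolvent P X r (at_time X T \<omega>)) =
        (\<integral>\<^sup>+t. e t * (discount r T \<omega> * transition (max 0 t) f (at_time X T \<omega>)) \<partial>lborel)"
      by (simp add: nn_integral_cmult[symmetric] mult_ac)
  qed
  also have "\<dots> = (\<integral>\<^sup>+t. \<integral>\<^sup>+\<omega>. e t * (discount r T \<omega> * transition (max 0 t) f (at_time X T \<omega>)) \<partial>?C \<partial>lborel)"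
    by (rule L.Fubini') (use m1 in measurable)
  also have "\<dots> = (\<integral>\<^sup>+t. \<integral>\<^sup>+\<omega>. e t * (discount r T \<omega> * f (X (enn2real (T \<omega>) + max 0 t) \<omega>)) \<partial>?C \<partial>lborel)"
  proof (rule nn_integral_cong)
    fix t :: real
    have "transition (max 0 t) f \<in> borel_measurable borel" by (rule transition_measurable[OF f]) simp
    then have [measurable]: "(\<lambda>\<omega>. transition (max 0 t) f (at_time X T \<omega>)) \<in> borel_measurable ?C"
      by (rule measurable_compose[OF Z])
    have "(\<lambda>\<omega>. X (enn2real (T \<omega>) + max 0 t) \<omega>) \<in> borel_measurable ?C"
      by (rule X_random_time_measurable) (use X_measurable_completion in auto)
    then have [measurable]: "(\<lambda>\<omega>. f (X (enn2real (T \<omega>) + max 0 t) \<omega>)) \<in> borel_measurable ?C"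
      by (rule measurable_compose[OF _ f])
    show "(\<integral>\<^sup>+\<omega>. e t * (discount r T \<omega> * transition (max 0 t) f (at_time X T \<omega>)) \<partial>?C) =
        (\<integral>\<^sup>+\<omega>. e t * (discount r T \<omega> * f (X (enn2real (T \<omega>) + max 0 t) \<omega>)) \<partial>?C)"
      using strong_markov_discounted[OF T f, of "max 0 t" x r]
      by (subst (1 2) nn_integral_cmult) (auto simp: nn_integral_completion)
  qed
  also have "\<dots> = (\<integral>\<^sup>+\<omega>. \<integral>\<^sup>+t. e t * (discount r T \<omega> * f (X (enn2real (T \<omega>) + max 0 t) \<omega>)) \<partial>lborel \<partial>?C)"
    by (rule L.Fubini'[symmetric]) (use m2 in measurable)
  also have "\<dots> = (\<integral>\<^sup>+\<omega>. (\<integral>\<^sup>+t\<in>{t. 0 \<le> t \<and> T \<omega> \<le> ennreal t}. ennreal (exp (- r * t)) * f (X t \<omega>) \<partial>lborel) \<partial>?C)"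
  proof (rule nn_integral_cong)
    fix \<omega> assume w: "\<omega> \<in> space ?C"
    have [measurable]: "(\<lambda>t. f (X (max 0 t) \<omega>)) \<in> borel_measurable borel"
      using measurable_Pair1[OF m3 w] by simp
    show "(\<integral>\<^sup>+t. e t * (discount r T \<omega> * f (X (enn2real (T \<omega>) + max 0 t) \<omega>)) \<partial>lborel) =
      (\<integral>\<^sup>+t\<in>{t. 0 \<le> t \<and> T \<omega> \<le> ennreal t}. ennreal (exp (- r * t)) * f (X t \<omega>) \<partial>lborel)"
    proof (cases "T \<omega>")
      case (real s)
      \<comment> \<open>Substitution of the absolute time by the lag after \<open>s\<close>.\<close>
      have "(\<integral>\<^sup>+t\<in>{t. 0 \<le> t \<and> T \<omega> \<le> ennreal t}. ennreal (exp (- r * t)) * f (X t \<omega>) \<partial>lborel) =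
          (\<integral>\<^sup>+t. ennreal (exp (- r * t)) * f (X (max 0 t) \<omega>) * indicator {s..} t \<partial>lborel)"
        using real by (intro nn_integral_cong) (auto simp: indicator_def ennreal_le_iff2)
      also have "\<dots> = (\<integral>\<^sup>+t. ennreal (exp (- r * (s + 1 * t))) * f (X (max 0 (s + 1 * t)) \<omega>) * indicator {s..} (s + 1 * t) \<partial>lborel)"
        by (subst nn_integral_real_affine[where c=1 and t=s]) simp_all
      also have "\<dots> = (\<integral>\<^sup>+t. e t * (discount r T \<omega> * f (X (enn2real (T \<omega>) + max 0 t) \<omega>)) \<partial>lborel)"
      proof (rule nn_integral_cong)
        fix t :: real
        have "ennreal (exp (- r * (s + 1 * t))) = ennreal (exp (- r * t)) * ennreal (exp (- r * s))"
          by (simp add: ennreal_mult[symmetric] exp_add[symmetric] algebra_simps)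
        then show "ennreal (exp (- r * (s + 1 * t))) * f (X (max 0 (s + 1 * t)) \<omega>) * indicator {s..} (s + 1 * t) =
            e t * (discount r T \<omega> * f (X (enn2real (T \<omega>) + max 0 t) \<omega>))"
          using real by (cases "0 \<le> t") (simp_all add: e_def discount_def mult.assoc)
      qed
      finally show ?thesis ..
    next
      case top
      then show ?thesis by (simp add: discount_def top_unique)
    qed
  qed
  finally show ?thesis by (simp only: nn_integral_completion)
qed


section \<open>Excessive functions and the resolvent\<close>

lemma sets_resolvent [simp, measurable_cong]: "sets (resolvent P X r x) = sets borel"
  unfolding resolvent_def
  by (subst sets_measure_of) (use sets.sigma_sets_eq[of "borel :: real measure"] in auto)

lemma space_resolvent [simp]: "space (resolvent P X r x) = UNIV"
  using sets_eq_imp_space_eq[OF sets_resolvent] by simp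

text \<open>
  A mean of the discounted semigroup over an exponential time inherits a uniform bound.
\<close>

lemma resolvent_le:
  assumes f: "f \<in> borel_measurable borel" and "0 < l"
    and bound: "\<And>t. 0 \<le> t \<Longrightarrow> ennreal (exp (- r * t)) * transition t f x \<le> b"
  shows "ennreal l * (\<integral>\<^sup>+y. f y \<partial>resolvent P X (r + l) x) \<le> b"
proof -
  have [measurable]: "(\<lambda>t. transition (max 0 t) f x) \<in> borel_measurable borel"
    using measurable_Pair1[OF transition_path_measurable[OF f], of x] by simp
  have "ennreal l * (\<integral>\<^sup>+y. f y \<partial>resolvent P X (r + l) x) =
      (\<integral>\<^sup>+t. ennreal l * (ennreal (exp (- (r + l) * t)) * transition (max 0 t) f x * indicator {0..} t) \<partial>lborel)"
    unfolding nn_integral_resolvent_max[OF f] by (subst nn_integral_cmult) auto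
  also have "\<dots> \<le> (\<integral>\<^sup>+t. ennreal (l * exp (- l * t)) * indicator {0..} t * b \<partial>lborel)"
  proof (rule nn_integral_mono)
    fix t :: real
    show "ennreal l * (ennreal (exp (- (r + l) * t)) * transition (max 0 t) f x * indicator {0..} t)
        \<le> ennreal (l * exp (- l * t)) * indicator {0..} t * b"
    proof (cases "0 \<le> t")
      case True
      then have "ennreal l * (ennreal (exp (- (r + l) * t)) * transition (max 0 t) f x) \<le>
          ennreal (l * exp (- l * t)) * b"
        unfolding discount_split[OF \<open>0 < l\<close>] using bound[OF True] by (intro mult_left_mono) (auto simp: max_absorb2)
      then show ?thesis using True by simp
    qed simp
  qed
  also have "\<dots> = 1 * b"
    by (subst nn_integral_multc) (use exponential_integral_full[OF \<open>0 < l\<close>] in auto)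
  finally show ?thesis by simp
qed

text \<open>
  For large rates the exponential law concentrates at time \<open>0\<close>, so only the behaviour of the semigroup
  near \<open>0\<close> counts.
\<close>

lemma resolvent_liminf_ge:
  assumes f: "f \<in> borel_measurable borel" and "c < top"
    and ev: "eventually (\<lambda>t. c \<le> ennreal (exp (- r * t)) * transition t f x) (at_right 0)"
  shows "c \<le> liminf (\<lambda>n. ennreal (real (Suc n)) * (\<integral>\<^sup>+y. f y \<partial>resolvent P X (r + real (Suc n)) x))"
proof -
  obtain d where d: "0 < d" "\<And>t. 0 < t \<Longrightarrow> t < d \<Longrightarrow> c \<le> ennreal (exp (- r * t)) * transition t f x"
    using ev by (auto simp: eventually_at_right_field)
  have [measurable]: "(\<lambda>t. transition (max 0 t) f x) \<in> borel_measurable borel"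
    using measurable_Pair1[OF transition_path_measurable[OF f], of x] by simp
  have le: "c * ennreal (1 - exp (- real (Suc n) * (d / 2))) \<le>
      ennreal (real (Suc n)) * (\<integral>\<^sup>+y. f y \<partial>resolvent P X (r + real (Suc n)) x)" for n
  proof -
    define l where "l = real (Suc n)"
    have "0 < l" by (simp add: l_def)
    have "c * ennreal (1 - exp (- l * (d / 2))) = c * (\<integral>\<^sup>+t\<in>{0..d / 2}. ennreal (l * exp (- l * t)) \<partial>lborel)"
      using exponential_integral_initial[OF \<open>0 < l\<close>, of "d / 2"] d by simp
    also have "\<dots> = (\<integral>\<^sup>+t. c * (ennreal (l * exp (- l * t)) * indicator {0..d / 2} t) \<partial>lborel)"
      by (rule nn_integral_cmult[symmetric]) auto
    also have "\<dots> \<le> (\<integral>\<^sup>+t. ennreal l * (ennreal (exp (- (r + l) * t)) * transition (max 0 t) f x * indicator {0..} t) \<partial>lborel)"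
    proof (rule nn_integral_mono_AE)
      show "AE t in lborel. c * (ennreal (l * exp (- l * t)) * indicator {0..d / 2} t) \<le>
        ennreal l * (ennreal (exp (- (r + l) * t)) * transition (max 0 t) f x * indicator {0..} t)"
        using AE_lborel_singleton[of "0::real"]
      proof eventually_elim
        case (elim t)
        show ?case
        proof (cases "t \<in> {0..d / 2}")
          case True
          then have "0 < t" "t < d" using elim d by auto
          then have "ennreal (l * exp (- l * t)) * c \<le>
              ennreal (l * exp (- l * t)) * (ennreal (exp (- r * t)) * transition t f x)"
            by (intro mult_left_mono d(2)) auto
          also have "\<dots> = ennreal l * (ennreal (exp (- (r + l) * t)) * transition t f x)"
            by (rule discount_split[OF \<open>0 < l\<close>, symmetric])
          finally show ?thesis using True \<open>0 < t\<close> by (simp add: mult.commute max_absorb2)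
        qed simp
      qed
    qed
    also have "\<dots> = ennreal l * (\<integral>\<^sup>+y. f y \<partial>resolvent P X (r + l) x)"
      unfolding nn_integral_resolvent_max[OF f] by (subst nn_integral_cmult) auto
    finally show ?thesis by (simp add: l_def)
  qed
  have "(\<lambda>n. 1 - exp (- real (Suc n) * (d / 2))) \<longlonglongrightarrow> 1" using d(1) by real_asymp
  then have "(\<lambda>n. c * ennreal (1 - exp (- real (Suc n) * (d / 2)))) \<longlonglongrightarrow> c * ennreal 1"
    using \<open>c < top\<close> by (intro ennreal_tendsto_cmult tendsto_ennrealI)
  then have "c = liminf (\<lambda>n. c * ennreal (1 - exp (- real (Suc n) * (d / 2))))"
    by (simp add: lim_imp_Liminf)
  also have "\<dots> \<le> liminf (\<lambda>n. ennreal (real (Suc n)) * (\<integral>\<^sup>+y. f y \<partial>resolvent P X (r + real (Suc n)) x))"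
    by (intro Liminf_mono always_eventually allI le)
  finally show ?thesis .
qed

text \<open>
  Excessivity read off from the resolvent instead of the semigroup. The lower bound asks only for a
  limes inferior, so that Fatou's lemma makes the notion stable under integration over a parameter.
\<close>

definition resolvent_excessive :: "real \<Rightarrow> (real \<Rightarrow> ennreal) \<Rightarrow> bool" where
  "resolvent_excessive r u \<longleftrightarrow> u \<in> borel_measurable borel \<and>
     (\<forall>x. (\<forall>l>0. ennreal l * (\<integral>\<^sup>+y. u y \<partial>resolvent P X (r + l) x) \<le> u x) \<and>
       u x \<le> liminf (\<lambda>n. ennreal (real (Suc n)) * (\<integral>\<^sup>+y. u y \<partial>resolvent P X (r + real (Suc n)) x)))"

lemma resolvent_excessive_le:
  "resolvent_excessive r u \<Longrightarrow> 0 < l \<Longrightarrow> ennreal l * (\<integral>\<^sup>+y. u y \<partial>resolvent P X (r + l) x) \<le> u x"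
  by (simp add: resolvent_excessive_def)

lemma excessive_imp_resolvent_excessive:
  assumes "excessive P X r u"
  shows "resolvent_excessive r u"
  unfolding resolvent_excessive_def
proof (intro conjI allI impI)
  show u: "u \<in> borel_measurable borel" using assms by (simp add: excessive_def)
  fix x
  show "ennreal l * (\<integral>\<^sup>+y. u y \<partial>resolvent P X (r + l) x) \<le> u x" if "0 < l" for l
    using assms by (intro resolvent_le[OF u that]) (auto simp: excessive_def transition_def)
  show "u x \<le> liminf (\<lambda>n. ennreal (real (Suc n)) * (\<integral>\<^sup>+y. u y \<partial>resolvent P X (r + real (Suc n)) x))"
  proof (rule dense_le)
    fix c assume "c < u x"
    moreover have "((\<lambda>t. ennreal (exp (- r * t)) * transition t u x) \<longlongrightarrow> u x) (at_right 0)"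
      using assms by (auto simp: excessive_def transition_def)
    ultimately have "eventually (\<lambda>t. c < ennreal (exp (- r * t)) * transition t u x) (at_right 0)"
      by (simp add: order_tendstoD(1))
    then show "c \<le> liminf (\<lambda>n. ennreal (real (Suc n)) * (\<integral>\<^sup>+y. u y \<partial>resolvent P X (r + real (Suc n)) x))"
      using \<open>c < u x\<close> by (intro resolvent_liminf_ge[OF u]) (auto elim!: eventually_mono intro: less_imp_le order.strict_trans2[OF _ top_greatest])
  qed
qed

text \<open>
  Paths start at \<open>x\<close> and are right-continuous, so they stay in an open neighbourhood of \<open>x\<close> for a while.
\<close>

lemma transition_open_tendsto_1:
  assumes "open U" "x \<in> U"
  shows "((\<lambda>t. transition t (indicator U) x) \<longlongrightarrow> 1) (at_right 0)"
  unfolding tendsto_at_iff_sequentially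
proof (intro allI impI)
  fix s :: "nat \<Rightarrow> real" assume s: "\<forall>i. s i \<in> {0<..} - {0}" "s \<longlonglongrightarrow> 0"
  interpret Px: prob_space "P x" by (rule prob_space_P)
  have [measurable]: "X (s i) \<in> borel_measurable M" for i using s by (intro measurable_X) (auto simp: less_imp_le)
  have "(\<lambda>i. \<integral>\<^sup>+\<omega>. indicator U (X (s i) \<omega>) \<partial>P x) \<longlonglongrightarrow> (\<integral>\<^sup>+\<omega>. 1 \<partial>P x)"
  proof (rule nn_integral_dominated_convergence[where w="\<lambda>_. 1"])
    show "AE \<omega> in P x. (\<lambda>i. indicator U (X (s i) \<omega>) :: ennreal) \<longlonglongrightarrow> 1"
      using start[of x] AE_space
    proof eventually_elim
      case (elim \<omega>)
      have "filterlim s (at_right 0) sequentially"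
        using s unfolding filterlim_at by (simp add: less_imp_neq[symmetric])
      then have "(\<lambda>i. X (s i) \<omega>) \<longlonglongrightarrow> x"
        using filterlim_compose[OF X_tendsto_right[of \<omega> 0]] elim by simp
      from topological_tendstoD[OF this assms]
      show ?case by (intro tendsto_eventually) (auto elim!: eventually_mono)
    qed
    have [measurable]: "U \<in> sets borel" using \<open>open U\<close> by simp
    show "(\<lambda>\<omega>. indicator U (X (s i) \<omega>) :: ennreal) \<in> borel_measurable (P x)" for i
      by measurable
  qed (auto simp: indicator_def Px.emeasure_space_1[simplified])
  then show "((\<lambda>t. transition t (indicator U) x) \<circ> s) \<longlonglongrightarrow> 1"
    using Px.emeasure_space_1 by (simp add: transition_def comp_def)
qed

lemma emeasure_resolvent_le:
  assumes "0 \<le> r" "0 < l"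
  shows "ennreal l * emeasure (resolvent P X (r + l) x) UNIV \<le> 1"
proof -
  have "ennreal l * (\<integral>\<^sup>+y. 1 \<partial>resolvent P X (r + l) x) \<le> 1"
  proof (rule resolvent_le[OF _ \<open>0 < l\<close>])
    fix t :: real assume "0 \<le> t"
    have "transition t (\<lambda>_. 1) x = 1"
      using prob_space.emeasure_space_1[OF prob_space_P, of x] by (simp add: transition_def)
    then show "ennreal (exp (- r * t)) * transition t (\<lambda>_. 1) x \<le> 1"
      using \<open>0 \<le> t\<close> \<open>0 \<le> r\<close> by (simp add: ennreal_le_1)
  qed simp
  then show ?thesis by simp
qed

lemma finite_measure_resolvent:
  assumes "0 \<le> r" "0 < l"
  shows "finite_measure (resolvent P X (r + l) x)"
proof (rule finite_measureI)
  show "emeasure (resolvent P X (r + l) x) (space (resolvent P X (r + l) x)) \<noteq> \<infinity>"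
  proof
    assume "emeasure (resolvent P X (r + l) x) (space (resolvent P X (r + l) x)) = \<infinity>"
    then show False using emeasure_resolvent_le[OF assms, of x] assms
      by (simp add: ennreal_mult_top top_unique)
  qed
qed

text \<open>
  The upper bound passes through the integral by Tonelli's theorem, the lower bound by Fatou's lemma.
\<close>

lemma resolvent_excessive_integral:
  assumes "0 \<le> r" and mu: "sigma_finite_measure \<mu>"
    and k [measurable]: "(\<lambda>(z, y). k z y) \<in> borel_measurable (\<mu> \<Otimes>\<^sub>M borel)"
    and ex: "\<And>z. resolvent_excessive r (k z)"
  shows "resolvent_excessive r (\<lambda>y. \<integral>\<^sup>+z. k z y \<partial>\<mu>)"
  unfolding resolvent_excessive_def
proof (intro conjI allI impI)
  interpret mu: sigma_finite_measure \<mu> by (rule mu)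
  show "(\<lambda>y. \<integral>\<^sup>+z. k z y \<partial>\<mu>) \<in> borel_measurable borel" by measurable
  fix x
  have [measurable]: "k z \<in> borel_measurable borel" for z using ex by (simp add: resolvent_excessive_def)
  have swap: "ennreal l * (\<integral>\<^sup>+y. (\<integral>\<^sup>+z. k z y \<partial>\<mu>) \<partial>resolvent P X (r + l) x) =
      (\<integral>\<^sup>+z. ennreal l * (\<integral>\<^sup>+y. k z y \<partial>resolvent P X (r + l) x) \<partial>\<mu>)" if "0 < l" for l
  proof -
    interpret R: finite_measure "resolvent P X (r + l) x" by (rule finite_measure_resolvent[OF assms(1) that])
    interpret pair_sigma_finite \<mu> "resolvent P X (r + l) x" ..
    have "(\<integral>\<^sup>+y. (\<integral>\<^sup>+z. k z y \<partial>\<mu>) \<partial>resolvent P X (r + l) x) = (\<integral>\<^sup>+z. (\<integral>\<^sup>+y. k z y \<partial>resolvent P X (r + l) x) \<partial>\<mu>)"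
      by (rule Fubini') measurable
    then show ?thesis by (simp add: nn_integral_cmult)
  qed
  have ub: "ennreal l * (\<integral>\<^sup>+y. k z y \<partial>resolvent P X (r + l) x) \<le> k z x" if "0 < l" for l z
    using ex[of z] that by (auto simp: resolvent_excessive_def)
  show "ennreal l * (\<integral>\<^sup>+y. (\<integral>\<^sup>+z. k z y \<partial>\<mu>) \<partial>resolvent P X (r + l) x) \<le> (\<integral>\<^sup>+z. k z x \<partial>\<mu>)" if "0 < l" for l
    unfolding swap[OF that] by (intro nn_integral_mono ub that)
  have "(\<integral>\<^sup>+z. k z x \<partial>\<mu>) \<le>
      (\<integral>\<^sup>+z. liminf (\<lambda>n. ennreal (real (Suc n)) * (\<integral>\<^sup>+y. k z y \<partial>resolvent P X (r + real (Suc n)) x)) \<partial>\<mu>)"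
    using ex by (intro nn_integral_mono) (simp add: resolvent_excessive_def)
  also have "\<dots> \<le> liminf (\<lambda>n. \<integral>\<^sup>+z. ennreal (real (Suc n)) * (\<integral>\<^sup>+y. k z y \<partial>resolvent P X (r + real (Suc n)) x) \<partial>\<mu>)"
  proof (rule nn_integral_liminf)
    fix n
    interpret R: finite_measure "resolvent P X (r + real (Suc n)) x"
      by (rule finite_measure_resolvent[OF assms(1)]) simp
    show "(\<lambda>z. ennreal (real (Suc n)) * (\<integral>\<^sup>+y. k z y \<partial>resolvent P X (r + real (Suc n)) x)) \<in> borel_measurable \<mu>"
      by measurable
  qed
  also have "\<dots> = liminf (\<lambda>n. ennreal (real (Suc n)) * (\<integral>\<^sup>+y. (\<integral>\<^sup>+z. k z y \<partial>\<mu>) \<partial>resolvent P X (r + real (Suc n)) x))"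
    by (simp only: swap of_nat_0_less_iff zero_less_Suc)
  finally show "(\<integral>\<^sup>+z. k z x \<partial>\<mu>) \<le> \<dots>" .
qed


section \<open>Laws at stopping times and supermartingales\<close>

lemma const_stopping_time: "(\<lambda>_. c) \<in> stopping_times M P X"
  by (simp add: stopping_times_iff stopping_time_const)

lemma at_time_const: "0 \<le> s \<Longrightarrow> at_time X (\<lambda>_. ennreal s) = X s"
  by (simp add: at_time_def fun_eq_iff)

lemma at_time_measurable_completion:
  "T \<in> stopping_times M P X \<Longrightarrow> at_time X T \<in> borel_measurable (completion (P x))"
  by (rule at_time_measurable) (use X_measurable_completion stopping_times_measurable in auto)

lemma discount_measurable_completion:
  "T \<in> stopping_times M P X \<Longrightarrow> discount r T \<in> borel_measurable (completion (P x))"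
  by (rule discount_measurable[OF stopping_times_measurable])

lemma discount_le_1: "0 \<le> r \<Longrightarrow> discount r T \<omega> \<le> 1"
  by (auto simp: discount_def indicator_def ennreal_le_1)

text \<open>
  The discounted law of \<open>X\<^sub>T\<close> on \<open>{T < \<infinity>}\<close>, a measure of mass at most one.
\<close>

definition stopped_law :: "real \<Rightarrow> ('w \<Rightarrow> ennreal) \<Rightarrow> real \<Rightarrow> real measure" where
  "stopped_law r T x = distr (density (completion (P x)) (discount r T)) borel (at_time X T)"

lemma sets_stopped_law [simp, measurable_cong]: "sets (stopped_law r T x) = sets borel"
  by (simp add: stopped_law_def)

lemma nn_integral_stopped_law:
  assumes T: "T \<in> stopping_times M P X" and "f \<in> borel_measurable borel"
  shows "(\<integral>\<^sup>+z. f z \<partial>stopped_law r T x) = (\<integral>\<^sup>+\<omega>. discount r T \<omega> * f (at_time X T \<omega>) \<partial>P x)"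
proof -
  note [measurable] = at_time_measurable_completion[OF T] discount_measurable_completion[OF T] assms(2)
  have "(\<integral>\<^sup>+z. f z \<partial>stopped_law r T x) =
      (\<integral>\<^sup>+\<omega>. discount r T \<omega> * f (at_time X T \<omega>) \<partial>completion (P x))"
    unfolding stopped_law_def by (subst nn_integral_distr) (simp_all add: nn_integral_density)
  then show ?thesis by (simp add: nn_integral_completion)
qed

lemma stopped_law_const:
  assumes [measurable]: "f \<in> borel_measurable borel" and t: "0 \<le> t"
  shows "(\<integral>\<^sup>+z. f z \<partial>stopped_law r (\<lambda>_. ennreal t) x) = ennreal (exp (- r * t)) * transition t f x"
proof -
  have [measurable]: "X t \<in> borel_measurable M" by (rule measurable_X[OF t])
  have "(\<integral>\<^sup>+z. f z \<partial>stopped_law r (\<lambda>_. ennreal t) x) = (\<integral>\<^sup>+\<omega>. ennreal (exp (- r * t)) * f (X t \<omega>) \<partial>P x)"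
    using nn_integral_stopped_law[OF const_stopping_time assms(1), of r "ennreal t" x] t
    by (simp add: at_time_const discount_def)
  also have "\<dots> = ennreal (exp (- r * t)) * transition t f x"
    unfolding transition_def by (rule nn_integral_cmult) measurable
  finally show ?thesis .
qed

lemma finite_measure_stopped_law:
  assumes T: "T \<in> stopping_times M P X" and "0 \<le> r"
  shows "finite_measure (stopped_law r T x)"
proof (rule finite_measureI)
  interpret Px: prob_space "P x" by (rule prob_space_P)
  have "emeasure (stopped_law r T x) (space (stopped_law r T x)) = (\<integral>\<^sup>+\<omega>. discount r T \<omega> * 1 \<partial>P x)"
    using nn_integral_stopped_law[OF T, of "\<lambda>_. 1" r x] by simp
  also have "\<dots> \<le> (\<integral>\<^sup>+\<omega>. 1 \<partial>P x)"
    using discount_le_1[OF \<open>0 \<le> r\<close>] by (intro nn_integral_mono) auto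
  also have "\<dots> < top" using Px.emeasure_space_1 by simp
  finally show "emeasure (stopped_law r T x) (space (stopped_law r T x)) \<noteq> \<infinity>" by simp
qed

lemma resolvent_measurable:
  assumes f: "f \<in> borel_measurable borel"
  shows "(\<lambda>z. \<integral>\<^sup>+v. f v \<partial>resolvent P X r z) \<in> borel_measurable borel"
proof -
  have "(\<lambda>p. (snd p, fst p)) \<in> borel \<Otimes>\<^sub>M lborel \<rightarrow>\<^sub>M borel \<Otimes>\<^sub>M (borel :: real measure)"
    by measurable
  from measurable_compose[OF this transition_path_measurable[OF f]]
  have [measurable]: "(\<lambda>p. transition (max 0 (snd p)) f (fst p)) \<in> borel_measurable (borel \<Otimes>\<^sub>M lborel)"
    by simp
  show ?thesis unfolding nn_integral_resolvent_max[OF f] by measurable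
qed

lemma entrance_after_ge: "ennreal s \<le> entrance_after X s S \<omega>"
  unfolding entrance_after_def by (intro Inf_greatest) (auto intro: ennreal_leI)

text \<open>
  Between time \<open>s\<close> and the next entrance into \<open>S\<close> a function vanishing off \<open>S\<close> collects nothing, so
  the occupations after the two times coincide.
\<close>

lemma resolvent_at_entrance:
  assumes "0 \<le> s" and "open S" and f [measurable]: "f \<in> borel_measurable borel"
    and z: "\<And>y. y \<notin> S \<Longrightarrow> f y = 0"
  shows "(\<integral>\<^sup>+z. (\<integral>\<^sup>+v. f v \<partial>resolvent P X r z) \<partial>stopped_law r (\<lambda>_. ennreal s) x) =
    (\<integral>\<^sup>+z. (\<integral>\<^sup>+v. f v \<partial>resolvent P X r z) \<partial>stopped_law r (entrance_after X s S) x)"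
proof -
  have "(\<integral>\<^sup>+t\<in>{t. 0 \<le> t \<and> ennreal s \<le> ennreal t}. ennreal (exp (- r * t)) * f (X t \<omega>) \<partial>lborel) =
      (\<integral>\<^sup>+t\<in>{t. 0 \<le> t \<and> entrance_after X s S \<omega> \<le> ennreal t}. ennreal (exp (- r * t)) * f (X t \<omega>) \<partial>lborel)" for \<omega>
  proof (rule nn_integral_cong)
    fix t :: real
    have "entrance_after X s S \<omega> \<le> ennreal t" if "s \<le> t" "X t \<omega> \<in> S"
      unfolding entrance_after_def using that by (intro Inf_lower) auto
    moreover have "ennreal s \<le> ennreal t" if "entrance_after X s S \<omega> \<le> ennreal t"
      using entrance_after_ge that by (rule order.trans)
    ultimately show "ennreal (exp (- r * t)) * f (X t \<omega>) * indicator {t. 0 \<le> t \<and> ennreal s \<le> ennreal t} t =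
        ennreal (exp (- r * t)) * f (X t \<omega>) * indicator {t. 0 \<le> t \<and> entrance_after X s S \<omega> \<le> ennreal t} t"
      using z by (cases "X t \<omega> \<in> S") (auto simp: indicator_def)
  qed
  then show ?thesis
    using entrance_after_open_stopping[OF assms(2,1)] const_stopping_time
    by (simp add: nn_integral_stopped_law resolvent_measurable occupation_after_stopping_time)
qed

text \<open>
  Excessivity without the continuity at time \<open>0\<close>; this is what the supermartingale property uses.
\<close>

definition supermedian :: "real \<Rightarrow> (real \<Rightarrow> ennreal) \<Rightarrow> bool" where
  "supermedian r v \<longleftrightarrow> v \<in> borel_measurable borel \<and>
     (\<forall>t\<ge>0. \<forall>x. ennreal (exp (- r * t)) * transition t v x \<le> v x)"

text \<open>
  The Markov property at the constant time \<open>s\<close>, applied to events of the augmented filtration.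
\<close>

lemma supermartingale:
  assumes v: "supermedian r v" and "0 \<le> s" "s \<le> t"
    and A: "A \<in> sets (natural_filtration M P X (ennreal s))"
  shows "(\<integral>\<^sup>+\<omega>\<in>A. ennreal (exp (- r * t)) * v (X t \<omega>) \<partial>completion (P x)) \<le>
    (\<integral>\<^sup>+\<omega>\<in>A. ennreal (exp (- r * s)) * v (X s \<omega>) \<partial>completion (P x))"
proof -
  interpret F: filtration "space M" "natural_filtration M P X" by (rule filtration_natural)
  let ?C = "completion (P x)"
  have vm [measurable]: "v \<in> borel_measurable borel" using v by (simp add: supermedian_def)
  have [measurable]: "X t \<in> borel_measurable ?C" "X s \<in> borel_measurable ?C"
    using assms by (auto intro: X_measurable_completion)
  have [measurable]: "A \<in> sets ?C" using A natural_subset_completion by blast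
  have [measurable]: "transition (t - s) v \<in> borel_measurable borel"
    using assms by (intro transition_measurable vm) simp
  have "A \<in> sets (F.pre_sigma (\<lambda>_. ennreal s))"
  proof (rule F.sets_pre_sigmaI[OF stopping_time_const])
    show "{\<omega>\<in>A. ennreal s \<le> u} \<in> sets (natural_filtration M P X u)" for u
      using A F.sets_F_mono[of "ennreal s" u] by (cases "ennreal s \<le> u") auto
  qed
  then have "indicator A \<in> borel_measurable (F.pre_sigma (\<lambda>_. ennreal s))" by simp
  from strong_markov_weighted[OF const_stopping_time this vm, of "t - s" x]
  have eq: "(\<integral>\<^sup>+\<omega>. indicator A \<omega> * v (X t \<omega>) \<partial>?C) = (\<integral>\<^sup>+\<omega>. indicator A \<omega> * transition (t - s) v (X s \<omega>) \<partial>?C)"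
    using assms by (simp add: at_time_const)
  have "(\<integral>\<^sup>+\<omega>\<in>A. ennreal (exp (- r * t)) * v (X t \<omega>) \<partial>?C) =
      ennreal (exp (- r * t)) * (\<integral>\<^sup>+\<omega>. indicator A \<omega> * v (X t \<omega>) \<partial>?C)"
    by (subst nn_integral_cmult[symmetric]) (auto simp: mult_ac)
  also have "\<dots> = (\<integral>\<^sup>+\<omega>\<in>A. ennreal (exp (- r * s)) * (ennreal (exp (- r * (t - s))) * transition (t - s) v (X s \<omega>)) \<partial>?C)"
  proof -
    have *: "ennreal (exp (- r * s)) * (ennreal (exp (- r * (t - s))) * y) = ennreal (exp (- r * t)) * y" for y
      by (simp add: mult.assoc[symmetric] ennreal_mult[symmetric] exp_add[symmetric] algebra_simps)
    show ?thesis
      unfolding eq * by (subst nn_integral_cmult[symmetric]) (auto simp: mult_ac)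
  qed
  also have "\<dots> \<le> (\<integral>\<^sup>+\<omega>\<in>A. ennreal (exp (- r * s)) * v (X s \<omega>) \<partial>?C)"
    using v assms by (intro nn_integral_mono mult_right_mono mult_left_mono) (auto simp: supermedian_def)
  finally show ?thesis .
qed

text \<open>
  The sets \<open>A i\<close> are the events of stopping at the \<open>i\<close>-th time. Phrasing optional stopping through
  them covers both discretised stopping times and first passages in the maximal inequality.
\<close>

lemma discrete_optional_stopping:
  fixes t :: "nat \<Rightarrow> real"
  assumes v: "supermedian r v" and t: "0 \<le> t 0" "mono t"
    and A: "\<And>i. A i \<in> sets (natural_filtration M P X (ennreal (t i)))"
    and disj: "\<And>i j. i < j \<Longrightarrow> A i \<inter> A j = {}"
  shows "(\<Sum>i<k. \<integral>\<^sup>+\<omega>\<in>A i. ennreal (exp (- r * t i)) * v (X (t i) \<omega>) \<partial>P x) \<le>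
    ennreal (exp (- r * t 0)) * transition (t 0) v x"
proof -
  interpret F: filtration "space M" "natural_filtration M P X" by (rule filtration_natural)
  let ?C = "completion (P x)"
  define I where "I i B = (\<integral>\<^sup>+\<omega>\<in>B. ennreal (exp (- r * t i)) * v (X (t i) \<omega>) \<partial>?C)" for i B
  define R where "R k = space M - (\<Union>i<k. A i)" for k
  have t_nonneg: "0 \<le> t i" for i using t monoD[OF t(2), of 0 i] by simp
  have [measurable]: "v \<in> borel_measurable borel" using v by (simp add: supermedian_def)
  have [measurable]: "X (t i) \<in> borel_measurable ?C" for i by (rule X_measurable_completion[OF t_nonneg])
  have AC [measurable]: "A i \<in> sets ?C" for i using A natural_subset_completion by blast
  have R_nat: "R (Suc k) \<in> sets (natural_filtration M P X (ennreal (t k)))" for k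
  proof -
    have "A i \<in> sets (natural_filtration M P X (ennreal (t k)))" if "i < Suc k" for i
      using A[of i] F.sets_F_mono[of "ennreal (t i)" "ennreal (t k)"] monoD[OF t(2), of i k] that
      by (auto intro: ennreal_leI)
    then have "space (natural_filtration M P X (ennreal (t k))) - (\<Union>i<Suc k. A i)
        \<in> sets (natural_filtration M P X (ennreal (t k)))" by (intro sets.compl_sets sets.finite_UN) auto
    then show ?thesis by (simp add: R_def)
  qed
  have [measurable]: "R k \<in> sets ?C" for k
    using sets.Diff[OF sets.top[of ?C] sets.finite_UN[of "{..<k}" A ?C]] AC by (simp add: R_def)
  \<comment> \<open>\<open>R k\<close> is the event that stopping has not occurred before step \<open>k\<close>.\<close>
  have "(\<Sum>i<k. I i (A i)) + I k (R k) \<le> I 0 (space M)" for k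
  proof (induction k)
    case 0
    then show ?case by (simp add: R_def)
  next
    case (Suc k)
    have "A k \<subseteq> R k" using sets.sets_into_space[OF AC[of k]] disj[of _ k] by (auto simp: R_def)
    then have "indicator (R k) \<omega> = indicator (A k) \<omega> + (indicator (R (Suc k)) \<omega> :: ennreal)" for \<omega>
      by (auto simp: R_def indicator_def lessThan_Suc)
    then have "I k (R k) = I k (A k) + I k (R (Suc k))"
      unfolding I_def by (subst nn_integral_add[symmetric]) (auto simp: distrib_left)
    moreover have "I (Suc k) (R (Suc k)) \<le> I k (R (Suc k))"
      unfolding I_def using monoD[OF t(2), of k "Suc k"] by (intro supermartingale[OF v t_nonneg _ R_nat]) simp
    ultimately have "I k (A k) + I (Suc k) (R (Suc k)) \<le> I k (R k)" by (simp add: add_left_mono)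
    then have "(\<Sum>i<k. I i (A i)) + (I k (A k) + I (Suc k) (R (Suc k))) \<le> (\<Sum>i<k. I i (A i)) + I k (R k)"
      by (rule add_left_mono)
    also have "\<dots> \<le> I 0 (space M)" by (rule Suc.IH)
    finally show ?case by (simp add: add.assoc)
  qed
  then have "(\<Sum>i<k. I i (A i)) \<le> I 0 (space M)"
    by (meson add_increasing2 dual_order.trans le_add1 le_iff_add)
  also have "I 0 (space M) = ennreal (exp (- r * t 0)) * transition (t 0) v x"
  proof -
    have "I 0 (space M) = (\<integral>\<^sup>+\<omega>. ennreal (exp (- r * t 0)) * v (X (t 0) \<omega>) \<partial>?C)"
      unfolding I_def by (intro nn_integral_cong) simp
    also have "\<dots> = ennreal (exp (- r * t 0)) * (\<integral>\<^sup>+\<omega>. v (X (t 0) \<omega>) \<partial>?C)"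
      by (rule nn_integral_cmult) measurable
    finally show ?thesis by (simp add: transition_def nn_integral_completion)
  qed
  finally show ?thesis by (simp add: I_def nn_integral_completion)
qed

section \<open>Entrance into closed half lines\<close>

lemma entrance_after_antimono: "S \<subseteq> S' \<Longrightarrow> entrance_after X s S' \<omega> \<le> entrance_after X s S \<omega>"
  unfolding entrance_after_def by (intro Inf_superset_mono) auto

text \<open>
  Entrance times into open half lines shrinking to \<open>[a,\<infinity>)\<close>. Unlike the entrance time into \<open>[a,\<infinity>)\<close>
  they are known from the raw filtration up to an infinitesimal look into the future.
\<close>

definition outer_entrance :: "real \<Rightarrow> nat \<Rightarrow> 'w \<Rightarrow> ennreal" where
  "outer_entrance a n = entrance_after X 0 {a - 1 / real (Suc n)<..}"

lemma outer_entrance_stopping: "outer_entrance a n \<in> stopping_times M P X"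
  unfolding outer_entrance_def by (rule entrance_after_open_stopping) auto

lemma outer_entrance_mono: "outer_entrance a n \<omega> \<le> outer_entrance a (Suc n) \<omega>"
  unfolding outer_entrance_def
proof (rule entrance_after_antimono)
  have "1 / real (Suc (Suc n)) \<le> 1 / real (Suc n)" by (simp add: frac_le)
  then show "{a - 1 / real (Suc (Suc n))<..} \<subseteq> {a - 1 / real (Suc n)<..}" by auto
qed

lemma outer_entrance_le: "(SUP n. outer_entrance a n \<omega>) \<le> entrance_time X {a..} \<omega>"
  unfolding outer_entrance_def entrance_time_eq
  by (intro SUP_least entrance_after_antimono) (auto intro: less_le_trans[of _ a])

lemma outer_entrance_position:
  assumes "\<omega> \<in> space M" "outer_entrance a n \<omega> < \<infinity>"
  shows "a - 1 / real (Suc n) \<le> at_time X (outer_entrance a n) \<omega>"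
  using entrance_after_closure[OF assms(1) order.refl, of "{a - 1 / real (Suc n)<..}"] assms(2)
  by (simp add: outer_entrance_def)

text \<open>
  Quasi-left-continuity: the positions at the approximating times, which are at least \<open>a - 1/(n+1)\<close>,
  converge to the position at the limiting time, which therefore lies in \<open>[a,\<infinity>)\<close>.
\<close>

lemma outer_entrance_limit:
  "AE \<omega> in P x. (SUP n. outer_entrance a n \<omega>) < \<infinity> \<longrightarrow>
     (\<lambda>n. at_time X (outer_entrance a n) \<omega>) \<longlonglongrightarrow> at_time X (\<lambda>\<omega>. SUP n. outer_entrance a n \<omega>) \<omega> \<and>
     a \<le> at_time X (\<lambda>\<omega>. SUP n. outer_entrance a n \<omega>) \<omega>"
proof -
  have "AE \<omega> in P x. (SUP n. outer_entrance a n \<omega>) < \<infinity> \<longrightarrow>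
     (\<lambda>n. at_time X (outer_entrance a n) \<omega>) \<longlonglongrightarrow> at_time X (\<lambda>\<omega>. SUP n. outer_entrance a n \<omega>) \<omega>"
    by (rule quasi_left_continuous[where T="outer_entrance a", OF outer_entrance_stopping outer_entrance_mono])
  then show ?thesis using AE_space
  proof eventually_elim
    case (elim \<omega>)
    show ?case
    proof (intro impI conjI)
      assume fin: "(SUP n. outer_entrance a n \<omega>) < \<infinity>"
      then show lim: "(\<lambda>n. at_time X (outer_entrance a n) \<omega>) \<longlonglongrightarrow> at_time X (\<lambda>\<omega>. SUP n. outer_entrance a n \<omega>) \<omega>"
        using elim by blast
      have "a - 1 / real (Suc n) \<le> at_time X (outer_entrance a n) \<omega>" for n
        using elim fin by (intro outer_entrance_position) (auto intro: SUP_lessD)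
      moreover have "(\<lambda>n. a - 1 / real (Suc n)) \<longlonglongrightarrow> a" by real_asymp
      ultimately show "a \<le> at_time X (\<lambda>\<omega>. SUP n. outer_entrance a n \<omega>) \<omega>"
        using lim by (intro LIMSEQ_le[of "\<lambda>n. a - 1 / real (Suc n)"]) auto
    qed
  qed
qed

lemma entrance_time_eq_outer:
  assumes "(SUP n. outer_entrance a n \<omega>) < \<infinity> \<Longrightarrow> a \<le> at_time X (\<lambda>\<omega>. SUP n. outer_entrance a n \<omega>) \<omega>"
  shows "entrance_time X {a..} \<omega> = (SUP n. outer_entrance a n \<omega>)"
proof (rule antisym[OF _ outer_entrance_le])
  define S where "S = (SUP n. outer_entrance a n \<omega>)"
  show "entrance_time X {a..} \<omega> \<le> S"
  proof (cases "S < \<infinity>")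
    case True
    then have "S = ennreal (enn2real S)" by (simp add: less_top[symmetric])
    moreover have "a \<le> X (enn2real S) \<omega>" using assms True by (simp add: S_def at_time_def)
    ultimately show ?thesis
      unfolding entrance_time_def by (intro Inf_lower CollectI exI[of _ "enn2real S"]) auto
  qed (simp add: not_less top_unique)
qed

text \<open>
  The entrance time agrees with the supremum of the outer entrance times except on the event that
  the supremum is finite without the path being in \<open>[a,\<infinity>)\<close>. That event is raw measurable and null for
  every starting point, so it is absorbed by the augmentation.
\<close>

lemma entrance_time_closed_stopping: "entrance_time X {a..} \<in> stopping_times M P X"
proof (rule stopping_timesI)
  let ?S = "\<lambda>\<omega>. SUP n. outer_entrance a n \<omega>"
  let ?F = "raw_filtration M X \<infinity>"
  show S: "{\<omega>\<in>space M. ?S \<omega> < ennreal u} \<in> sets (raw_filtration M X (ennreal u))" if "0 < u" for u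
  proof -
    have "{\<omega>\<in>space M. ?S \<omega> < ennreal u} =
        (\<Union>q\<in>{q\<in>\<rat>. 0 < q \<and> q < u}. \<Inter>n. {\<omega>\<in>space M. outer_entrance a n \<omega> < ennreal q})" (is "?L = ?R")
    proof (intro set_eqI iffI)
      fix \<omega> assume L: "\<omega> \<in> ?L"
      define s where "s = enn2real (?S \<omega>)"
      have "?S \<omega> < top" using L by (auto intro: order.strict_trans2[OF _ top_greatest])
      then have s: "?S \<omega> = ennreal s" "0 \<le> s" by (auto simp: s_def)
      then have "s < u" using L by (simp add: ennreal_less_iff)
      then obtain q where q: "q \<in> \<rat>" "s < q" "q < u" using Rats_dense_in_real by blast
      have "outer_entrance a n \<omega> < ennreal q" for n
      proof -
        have "outer_entrance a n \<omega> \<le> ?S \<omega>" by (rule SUP_upper) simp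
        also have "\<dots> < ennreal q" using s q by (simp add: ennreal_less_iff)
        finally show ?thesis .
      qed
      then show "\<omega> \<in> ?R" using L q s by (intro UN_I[of q]) auto
    next
      fix \<omega> assume "\<omega> \<in> ?R"
      then obtain q where q: "0 < q" "q < u" "\<And>n. \<omega> \<in> space M \<and> outer_entrance a n \<omega> < ennreal q" by blast
      then have "?S \<omega> \<le> ennreal q" by (intro SUP_least) (auto intro: less_imp_le)
      also have "\<dots> < ennreal u" using q by (simp add: ennreal_less_iff)
      finally show "\<omega> \<in> ?L" using q by simp
    qed
    also have "\<dots> \<in> sets (raw_filtration M X (ennreal u))"
    proof (rule sets.countable_UN'')
      show "countable {q\<in>\<rat>. 0 < q \<and> q < u}" by (rule countable_subset[OF _ countable_rat]) auto
      fix q assume q: "q \<in> {q\<in>\<rat>. 0 < q \<and> q < u}"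
      have "{\<omega>\<in>space M. outer_entrance a n \<omega> < ennreal q} \<in> sets (raw_filtration M X (ennreal u))" for n
        using entrance_after_open_raw[of "{a - 1 / real (Suc n)<..}" 0 q]
          raw_mono[of "ennreal q" "ennreal u"] q by (auto simp: outer_entrance_def intro: ennreal_leI)
      then show "(\<Inter>n. {\<omega>\<in>space M. outer_entrance a n \<omega> < ennreal q}) \<in> sets (raw_filtration M X (ennreal u))"
        by (intro sets.countable_INT') auto
    qed
    finally show ?thesis .
  qed
  have meas: "?S \<in> borel_measurable ?F"
  proof (rule borel_measurableI_less)
    fix y :: ennreal
    show "{\<omega>\<in>space ?F. ?S \<omega> < y} \<in> sets ?F"
    proof -
      have "{\<omega>\<in>space ?F. ?S \<omega> < y} = (\<Union>q\<in>{q\<in>\<rat>. 0 < q \<and> ennreal q \<le> y}. {\<omega>\<in>space M. ?S \<omega> < ennreal q})" (is "?L = ?R")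
      proof (intro set_eqI iffI)
        fix \<omega> assume L: "\<omega> \<in> ?L"
        then obtain q :: rat where q: "?S \<omega> < ennreal (of_rat q)" "ennreal (of_rat q) < y"
          using ennreal_rat_dense by blast
        then have "0 < real_of_rat q" by (metis ennreal_eq_0_iff not_less not_less_zero)
        then show "\<omega> \<in> ?R" using L q by (intro UN_I[of "of_rat q"]) auto
      next
        fix \<omega> assume "\<omega> \<in> ?R"
        then show "\<omega> \<in> ?L" by (auto intro: order.strict_trans2)
      qed
      also have "\<dots> \<in> sets ?F"
      proof (rule sets.countable_UN'')
        show "countable {q\<in>\<rat>. 0 < q \<and> ennreal q \<le> y}" by (rule countable_subset[OF _ countable_rat]) auto
        fix q assume "q \<in> {q\<in>\<rat>. 0 < q \<and> ennreal q \<le> y}"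
        then show "{\<omega>\<in>space M. ?S \<omega> < ennreal q} \<in> sets ?F"
          using S[of q] raw_mono[of "ennreal q" \<infinity>] by auto
      qed
      finally show ?thesis .
    qed
  qed
  have [measurable]: "at_time X ?S \<in> borel_measurable ?F"
    by (rule at_time_measurable[OF space_raw X_measurable_raw meas]) auto
  note [measurable] = meas
  show N: "{\<omega>\<in>space ?F. ?S \<omega> < \<infinity> \<and> at_time X ?S \<omega> < a} \<in> sets ?F" by measurable
  show "emeasure (P x) {\<omega>\<in>space ?F. ?S \<omega> < \<infinity> \<and> at_time X ?S \<omega> < a} = 0" for x
  proof -
    have "AE \<omega> in P x. \<not> (?S \<omega> < \<infinity> \<and> at_time X ?S \<omega> < a)"
      using outer_entrance_limit[of a x] by eventually_elim auto
    moreover have "{\<omega>\<in>space (P x). ?S \<omega> < \<infinity> \<and> at_time X ?S \<omega> < a} \<in> sets (P x)"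
      using N raw_subset_M by auto
    ultimately show ?thesis by (subst (asm) AE_iff_measurable) auto
  qed
  show "entrance_time X {a..} \<omega> = ?S \<omega>"
    if "\<omega> \<in> space M" "\<omega> \<notin> {\<omega>\<in>space ?F. ?S \<omega> < \<infinity> \<and> at_time X ?S \<omega> < a}" for \<omega>
    using that by (intro entrance_time_eq_outer) auto
qed

end

section \<open>Transience\<close>

context transient_hunt_process
begin

text \<open>
  By transience almost every path has left the compact set \<open>K\<close> for good at some time, after which \<open>S\<close>
  is no longer entered.
\<close>

lemma entrance_probability_tendsto_0:
  assumes "compact K" "S \<subseteq> K" "open S"
  shows "(\<lambda>n. \<integral>\<^sup>+\<omega>. indicator {\<omega>. entrance_after X (real n) S \<omega> < \<infinity>} \<omega> \<partial>P x) \<longlonglongrightarrow> 0"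
proof -
  let ?C = "completion (P x)"
  interpret Px: prob_space "P x" by (rule prob_space_P)
  have "(\<lambda>n. \<integral>\<^sup>+\<omega>. indicator {\<omega>. entrance_after X (real n) S \<omega> < \<infinity>} \<omega> \<partial>?C) \<longlonglongrightarrow> (\<integral>\<^sup>+\<omega>. 0 \<partial>?C)"
  proof (rule nn_integral_dominated_convergence[where w="\<lambda>_. 1"])
    show "(\<lambda>\<omega>. indicator {\<omega>. entrance_after X (real n) S \<omega> < \<infinity>} \<omega> :: ennreal) \<in> borel_measurable ?C" for n
    proof -
      have [measurable]: "entrance_after X (real n) S \<in> borel_measurable ?C"
        by (rule stopping_times_measurable[OF entrance_after_open_stopping[OF \<open>open S\<close>]]) simp
      show ?thesis by measurable
    qed
    have "AE \<omega> in P x. (\<lambda>n. indicator {\<omega>. entrance_after X (real n) S \<omega> < \<infinity>} \<omega> :: ennreal) \<longlonglongrightarrow> 0"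
      using transient[OF \<open>compact K\<close>, of x]
    proof eventually_elim
      case (elim \<omega>)
      then obtain t0 where t0: "\<And>t. t0 \<le> t \<Longrightarrow> X t \<omega> \<notin> K"
        by (auto simp: eventually_at_top_linorder)
      obtain n0 :: nat where n0: "t0 \<le> real n0" using real_arch_simple by blast
      have "entrance_after X (real n) S \<omega> = \<infinity>" if "n0 \<le> n" for n
      proof -
        have "X t \<omega> \<notin> S" if "real n \<le> t" for t
          using t0[of t] that n0 \<open>n0 \<le> n\<close> \<open>S \<subseteq> K\<close> by fastforce
        then have "{ennreal t | t. real n \<le> t \<and> X t \<omega> \<in> S} = {}" by auto
        then show ?thesis unfolding entrance_after_def by (simp only: Inf_empty) simp
      qed
      then show ?case
        by (intro tendsto_eventually) (auto simp: eventually_sequentially intro!: exI[of _ n0])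
    qed
    then show "AE \<omega> in ?C. (\<lambda>n. indicator {\<omega>. entrance_after X (real n) S \<omega> < \<infinity>} \<omega> :: ennreal) \<longlonglongrightarrow> 0"
      by (rule AE_completion)
  qed (auto simp: indicator_def Px.emeasure_space_1[simplified])
  then show ?thesis by (simp add: nn_integral_completion)
qed

end

section \<open>Coexcessive functions and balayage of the Green kernel\<close>

context dual_hunt_processes
begin

lemma green_measurable_pair [measurable]:
  assumes "0 \<le> r" and [measurable]: "f \<in> borel_measurable N" "h \<in> borel_measurable N"
  shows "(\<lambda>p. G r (f p) (h p)) \<in> borel_measurable N"
proof -
  have "(\<lambda>p. (f p, h p)) \<in> N \<rightarrow>\<^sub>M borel \<Otimes>\<^sub>M borel" by measurable
  from measurable_compose[OF this green_measurable[OF assms(1)]] show ?thesis by simp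
qed

text \<open>
  Truncation in value and in space brings \<open>u\<close> into the class of bounded functions with compact support, on
  which the dual resolvent is continuous.
\<close>

lemma dual_resolvent_truncation_continuous:
  assumes [measurable]: "u \<in> borel_measurable borel" and "0 \<le> q"
  shows "continuous_on UNIV
    (\<lambda>y. \<integral>\<^sup>+z. min (u z) (of_nat k) * indicator {- real k..real k} z \<partial>resolvent P' X' q y)"
proof -
  define h where "h z = enn2real (min (u z) (of_nat k)) * indicator {- real k..real k} z" for z
  have hm [measurable]: "h \<in> borel_measurable borel" unfolding h_def[abs_def] by measurable
  have eq: "min (u z) (of_nat k) * indicator {- real k..real k} z = ennreal (h z)" for z
  proof -
    have "min (u z) (of_nat k) < top" by (simp add: min_less_iff_disj of_nat_less_top)
    then show ?thesis by (simp add: h_def ennreal_mult'' indicator_def)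
  qed
  have h0: "0 \<le> h z" for z by (simp add: h_def)
  have hk: "h z \<le> real k" for z
  proof -
    have "enn2real (min (u z) (of_nat k)) \<le> enn2real (of_nat k)"
      by (rule enn2real_mono) (auto simp: of_nat_less_top)
    then show ?thesis by (auto simp: h_def indicator_def)
  qed
  have hB: "h \<in> bounded_compact_support"
    unfolding bounded_compact_support_def
  proof (intro CollectI conjI exI[of _ "{- real k..real k}"])
    show "bounded (range h)" using h0 hk by (intro boundedI[of _ "real k"]) auto
  qed (auto simp: h_def)
  have "(\<integral>\<^sup>+z. ennreal (h z) \<partial>resolvent P' X' q y) = ennreal (\<integral>z. h z \<partial>resolvent P' X' q y)" for y
    using h3_finite[OF assms(2) hB] h0 by (intro nn_integral_eq_integral) auto
  then show ?thesis
    unfolding eq using continuous_on_ennreal[OF h3_continuous[OF assms(2) hB]] by simp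
qed

text \<open>
  A coexcessive function is the supremum of the dual resolvents of its truncations, which are
  continuous.
\<close>

lemma coexcessive_lower_semicontinuous:
  assumes u: "dual.resolvent_excessive r u" and "0 \<le> r" and c: "c < u y"
  obtains U where "open U" "y \<in> U" "\<And>z. z \<in> U \<Longrightarrow> c < u z"
proof -
  have [measurable]: "u \<in> borel_measurable borel" using u by (simp add: dual.resolvent_excessive_def)
  have "c < liminf (\<lambda>n. ennreal (real (Suc n)) * (\<integral>\<^sup>+z. u z \<partial>resolvent P' X' (r + real (Suc n)) y))"
    using u c by (auto simp: dual.resolvent_excessive_def intro: order.strict_trans2)
  from less_LiminfD[OF this] obtain n
    where n: "c < ennreal (real (Suc n)) * (\<integral>\<^sup>+z. u z \<partial>resolvent P' X' (r + real (Suc n)) y)"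
    unfolding eventually_sequentially by blast
  define l where "l = real (Suc n)"
  define w where "w k z = min (u z) (of_nat k) * indicator {- real k..real k} z" for k z
  define W where "W k z = ennreal l * (\<integral>\<^sup>+v. w k v \<partial>resolvent P' X' (r + l) z)" for k z
  have w_sup: "(SUP k. w k z) = u z" for z
  proof -
    have inc: "incseq (\<lambda>k. w k z)"
      by (auto simp: incseq_def w_def indicator_def intro: min.coboundedI2 of_nat_mono)
    obtain k0 :: nat where k0: "\<bar>z\<bar> \<le> real k0" using real_arch_simple by blast
    have "z \<in> {- real k..real k}" if "k0 \<le> k" for k
    proof -
      have "real k0 \<le> real k" using that by simp
      with k0 show ?thesis by auto
    qed
    then have ev: "eventually (\<lambda>k. min (u z) (of_nat k) = w k z) sequentially"
      unfolding eventually_sequentially by (intro exI[of _ k0]) (simp add: w_def)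
    have "(\<lambda>k. min (u z) (of_nat k)) \<longlonglongrightarrow> min (u z) top"
      by (intro tendsto_min tendsto_const) (simp add: of_nat_tendsto_top_ennreal)
    from Lim_transform_eventually[OF this ev] have "(\<lambda>k. w k z) \<longlonglongrightarrow> u z" by simp
    with LIMSEQ_SUP[OF inc] show ?thesis by (rule LIMSEQ_unique)
  qed
  have [measurable]: "w k \<in> borel_measurable borel" for k unfolding w_def[abs_def] by measurable
  have "(SUP k. W k y) = ennreal l * (\<integral>\<^sup>+z. (SUP k. w k z) \<partial>resolvent P' X' (r + l) y)"
    unfolding W_def SUP_mult_left_ennreal[symmetric]
    by (subst nn_integral_monotone_convergence_SUP)
      (auto simp: incseq_def le_fun_def w_def indicator_def intro: min.coboundedI2 of_nat_mono)
  then have "c < (SUP k. W k y)" using n by (simp add: w_sup l_def)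
  then obtain k where k: "c < W k y" by (auto simp: less_SUP_iff)
  have "continuous_on UNIV (W k)"
    unfolding W_def[abs_def] w_def using \<open>0 \<le> r\<close>
    by (intro continuous_on_compose2[OF ennreal_continuous_on_cmult[OF _ continuous_on_id[of UNIV]]]
        dual_resolvent_truncation_continuous) (auto simp: l_def)
  then have "open (W k -` {c<..})" by (rule open_vimage[OF open_greaterThan])
  moreover have "W k z \<le> u z" for z
  proof -
    have "W k z \<le> ennreal l * (\<integral>\<^sup>+v. u v \<partial>resolvent P' X' (r + l) z)"
      unfolding W_def by (intro mult_left_mono nn_integral_mono) (auto simp: w_def indicator_def)
    also have "\<dots> \<le> u z" by (rule dual.resolvent_excessive_le[OF u]) (simp add: l_def)
    finally show ?thesis .
  qed
  ultimately show thesis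
    using k by (intro that[of "W k -` {c<..}"]) (auto intro: order.strict_trans2)
qed

text \<open>
  The values of \<open>u\<close> away from \<open>y\<close> do not contribute in the limit, although \<open>u\<close> may be
  unbounded: by lower semicontinuity \<open>u\<close> is almost \<open>u(y)\<close> or more near \<open>y\<close>, and the dual process
  started at \<open>y\<close> stays near \<open>y\<close> for short times.
\<close>

lemma coexcessive_localization:
  assumes u: "dual.resolvent_excessive r u" and "0 \<le> r" and "open S" "y \<in> S"
  shows "u y \<le> liminf (\<lambda>n. ennreal (real (Suc n)) *
    (\<integral>\<^sup>+z. u z * indicator S z \<partial>resolvent P' X' (r + real (Suc n)) y))"
proof (rule dense_le)
  fix c assume "c < u y"
  then obtain c' where c': "c < c'" "c' < u y" using dense by blast
  obtain U where U: "open U" "y \<in> U" "\<And>z. z \<in> U \<Longrightarrow> c' < u z"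
    using coexcessive_lower_semicontinuous[OF u \<open>0 \<le> r\<close> c'(2)] by blast
  have [measurable]: "u \<in> borel_measurable borel" using u by (simp add: dual.resolvent_excessive_def)
  have [measurable]: "S \<in> sets borel" using \<open>open S\<close> by simp
  have "((\<lambda>t. exp (- r * t)) \<longlongrightarrow> exp (- r * 0)) (at_right (0::real))" by (intro tendsto_intros)
  then have "((\<lambda>t. ennreal (exp (- r * t))) \<longlongrightarrow> 1) (at_right 0)"
    using tendsto_ennrealI by fastforce
  moreover have "((\<lambda>t. dual.transition t (indicator (U \<inter> S)) y) \<longlongrightarrow> 1) (at_right 0)"
    using U \<open>open S\<close> \<open>y \<in> S\<close> by (intro dual.transition_open_tendsto_1) auto
  ultimately have "((\<lambda>t. ennreal (exp (- r * t)) * dual.transition t (indicator (U \<inter> S)) y) \<longlongrightarrow> 1 * 1) (at_right 0)"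
    by (rule tendsto_mult_ennreal) simp
  moreover have "c' < top" using c' by (auto intro: order.strict_trans2[OF _ top_greatest])
  ultimately have "((\<lambda>t. c' * (ennreal (exp (- r * t)) * dual.transition t (indicator (U \<inter> S)) y)) \<longlongrightarrow> c' * (1 * 1)) (at_right 0)"
    by (rule ennreal_tendsto_cmult[rotated])
  then have "eventually (\<lambda>t. c < c' * (ennreal (exp (- r * t)) * dual.transition t (indicator (U \<inter> S)) y)) (at_right 0)"
    by (rule order_tendstoD(1)) (use c' in simp)
  then have "eventually (\<lambda>t. c \<le> ennreal (exp (- r * t)) * dual.transition t (\<lambda>z. u z * indicator S z) y) (at_right 0)"
    using eventually_at_right_less[of "0::real"]
  proof eventually_elim
    case (elim t)
    have [measurable]: "X' t \<in> borel_measurable M'" using elim by (intro dual.measurable_X) simp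
    have [measurable]: "U \<in> sets borel" using U by simp
    have "c' * dual.transition t (indicator (U \<inter> S)) y = (\<integral>\<^sup>+\<omega>. c' * indicator (U \<inter> S) (X' t \<omega>) \<partial>P' y)"
      unfolding dual.transition_def by (rule nn_integral_cmult[symmetric]) measurable
    also have "\<dots> \<le> dual.transition t (\<lambda>z. u z * indicator S z) y"
      unfolding dual.transition_def using U(3)
      by (intro nn_integral_mono) (auto simp: indicator_def less_imp_le)
    finally have "ennreal (exp (- r * t)) * (c' * dual.transition t (indicator (U \<inter> S)) y)
        \<le> ennreal (exp (- r * t)) * dual.transition t (\<lambda>z. u z * indicator S z) y"
      by (rule mult_left_mono) simp
    with elim show ?case by (simp add: mult.left_commute)
  qed
  then show "c \<le> liminf (\<lambda>n. ennreal (real (Suc n)) *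
    (\<integral>\<^sup>+z. u z * indicator S z \<partial>resolvent P' X' (r + real (Suc n)) y))"
    using \<open>c < c'\<close> by (intro dual.resolvent_liminf_ge) (auto intro: order.strict_trans2[OF _ top_greatest])
qed

lemma nn_integral_resolvent_green:
  assumes "0 \<le> r" and [measurable]: "f \<in> borel_measurable borel"
  shows "(\<integral>\<^sup>+y. f y \<partial>resolvent P X r x) = (\<integral>\<^sup>+y. G r x y * f y \<partial>m)"
    and "(\<integral>\<^sup>+y. f y \<partial>resolvent P' X' r x) = (\<integral>\<^sup>+y. G r y x * f y \<partial>m)"
proof -
  note [measurable_cong] = sets_m
  have [measurable]: "(\<lambda>y. G r x y) \<in> borel_measurable m" "(\<lambda>y. G r y x) \<in> borel_measurable m"
    using \<open>0 \<le> r\<close> by simp_all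
  show "(\<integral>\<^sup>+y. f y \<partial>resolvent P X r x) = (\<integral>\<^sup>+y. G r x y * f y \<partial>m)"
    unfolding h1[OF assms(1)] by (rule nn_integral_density) measurable
  show "(\<integral>\<^sup>+y. f y \<partial>resolvent P' X' r x) = (\<integral>\<^sup>+y. G r y x * f y \<partial>m)"
    unfolding green_dual[OF assms(1)] by (rule nn_integral_density) measurable
qed

text \<open>
  The Green potentials of \<open>\<mu>\<close> and \<open>\<nu>\<close> are coexcessive. Testing the hypothesis with
  \<open>f(v) = G\<^sub>q(v,y) 1\<^sub>S(v)\<close> shows that their restrictions to \<open>S\<close> have the same dual resolvent at \<open>y\<close>, and
  localization recovers the values at \<open>y\<close> from these.
\<close>

lemma green_integral_le_of_resolvent_eq:
  assumes "0 \<le> r" and fin: "finite_measure \<mu>" "finite_measure \<nu>"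
    and sets: "sets \<mu> = sets borel" "sets \<nu> = sets borel"
    and S: "open S" "y \<in> S"
    and eq: "\<And>f. f \<in> borel_measurable borel \<Longrightarrow> (\<And>z. z \<notin> S \<Longrightarrow> f z = 0) \<Longrightarrow>
      (\<integral>\<^sup>+z. (\<integral>\<^sup>+v. f v \<partial>resolvent P X r z) \<partial>\<mu>) = (\<integral>\<^sup>+z. (\<integral>\<^sup>+v. f v \<partial>resolvent P X r z) \<partial>\<nu>)"
  shows "(\<integral>\<^sup>+z. G r z y \<partial>\<mu>) \<le> (\<integral>\<^sup>+z. G r z y \<partial>\<nu>)"
proof -
  have [measurable]: "S \<in> sets borel" using S by simp
  interpret m: sigma_finite_measure m by (rule sigma_finite_m)
  note [measurable_cong] = sets sets_m
  have coex: "dual.resolvent_excessive r (\<lambda>v. \<integral>\<^sup>+z. G r z v \<partial>\<kappa>)"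
    if "finite_measure \<kappa>" and [measurable_cong]: "sets \<kappa> = sets borel" for \<kappa>
  proof (rule dual.resolvent_excessive_integral[OF \<open>0 \<le> r\<close>])
    interpret finite_measure \<kappa> by (rule that)
    show "sigma_finite_measure \<kappa>" ..
    show "(\<lambda>(z, v). G r z v) \<in> borel_measurable (\<kappa> \<Otimes>\<^sub>M borel)"
      using \<open>0 \<le> r\<close> by (simp add: case_prod_beta')
    show "dual.resolvent_excessive r (G r z)" for z
      by (rule dual.excessive_imp_resolvent_excessive[OF green_dual_excessive[OF \<open>0 \<le> r\<close>]])
  qed
  define u where "u \<kappa> v = (\<integral>\<^sup>+z. G r z v \<partial>\<kappa>)" for \<kappa> v
  have key: "(\<integral>\<^sup>+v. u \<kappa> v * indicator S v \<partial>resolvent P' X' q y) =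
      (\<integral>\<^sup>+z. (\<integral>\<^sup>+v. G q v y * indicator S v \<partial>resolvent P X r z) \<partial>\<kappa>)"
    if "finite_measure \<kappa>" and [measurable_cong]: "sets \<kappa> = sets borel" and "0 \<le> q" for \<kappa> q
  proof -
    interpret k: finite_measure \<kappa> by (rule that)
    interpret pair_sigma_finite \<kappa> m ..
    have [measurable]: "u \<kappa> \<in> borel_measurable borel"
      using coex[OF that(1,2)] by (simp add: u_def[abs_def] dual.resolvent_excessive_def)
    have "(\<integral>\<^sup>+v. u \<kappa> v * indicator S v \<partial>resolvent P' X' q y) = (\<integral>\<^sup>+v. G q v y * (u \<kappa> v * indicator S v) \<partial>m)"
      by (rule nn_integral_resolvent_green) (use \<open>0 \<le> q\<close> in measurable)
    also have "\<dots> = (\<integral>\<^sup>+v. (\<integral>\<^sup>+z. G r z v * (G q v y * indicator S v) \<partial>\<kappa>) \<partial>m)"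
    proof (rule nn_integral_cong)
      fix v
      have [measurable]: "(\<lambda>z. G r z v) \<in> borel_measurable \<kappa>" using \<open>0 \<le> r\<close> by simp
      show "G q v y * (u \<kappa> v * indicator S v) = (\<integral>\<^sup>+z. G r z v * (G q v y * indicator S v) \<partial>\<kappa>)"
        by (subst nn_integral_multc) (simp_all add: u_def mult_ac)
    qed
    also have "\<dots> = (\<integral>\<^sup>+z. (\<integral>\<^sup>+v. G r z v * (G q v y * indicator S v) \<partial>m) \<partial>\<kappa>)"
      by (rule Fubini') (use \<open>0 \<le> r\<close> \<open>0 \<le> q\<close> in \<open>simp add: case_prod_beta'\<close>)
    also have "\<dots> = (\<integral>\<^sup>+z. (\<integral>\<^sup>+v. G q v y * indicator S v \<partial>resolvent P X r z) \<partial>\<kappa>)"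
      by (intro nn_integral_cong nn_integral_resolvent_green[symmetric])
        (use \<open>0 \<le> r\<close> \<open>0 \<le> q\<close> in measurable)
    finally show ?thesis .
  qed
  have "u \<mu> y \<le> liminf (\<lambda>n. ennreal (real (Suc n)) *
      (\<integral>\<^sup>+v. u \<mu> v * indicator S v \<partial>resolvent P' X' (r + real (Suc n)) y))"
    using coex[OF fin(1) sets(1)] \<open>0 \<le> r\<close> S unfolding u_def by (rule coexcessive_localization)
  also have "\<dots> = liminf (\<lambda>n. ennreal (real (Suc n)) *
      (\<integral>\<^sup>+v. u \<nu> v * indicator S v \<partial>resolvent P' X' (r + real (Suc n)) y))"
  proof -
    have "(\<integral>\<^sup>+v. u \<mu> v * indicator S v \<partial>resolvent P' X' q y) = (\<integral>\<^sup>+v. u \<nu> v * indicator S v \<partial>resolvent P' X' q y)"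
      if "0 \<le> q" for q
      unfolding key[OF fin(1) sets(1) that] key[OF fin(2) sets(2) that]
      by (rule eq) (use that in simp_all)
    then show ?thesis using \<open>0 \<le> r\<close> by simp
  qed
  also have "\<dots> \<le> liminf (\<lambda>n. u \<nu> y)"
  proof (intro Liminf_mono always_eventually allI)
    fix n
    have "ennreal (real (Suc n)) * (\<integral>\<^sup>+v. u \<nu> v * indicator S v \<partial>resolvent P' X' (r + real (Suc n)) y) \<le>
        ennreal (real (Suc n)) * (\<integral>\<^sup>+v. u \<nu> v \<partial>resolvent P' X' (r + real (Suc n)) y)"
      by (intro mult_left_mono nn_integral_mono) (auto simp: indicator_def)
    also have "\<dots> \<le> u \<nu> y"
      using coex[OF fin(2) sets(2)] unfolding u_def
      by (rule dual.resolvent_excessive_le) simp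
    finally show "ennreal (real (Suc n)) *
      (\<integral>\<^sup>+v. u \<nu> v * indicator S v \<partial>resolvent P' X' (r + real (Suc n)) y) \<le> u \<nu> y" .
  qed
  also have "\<dots> = u \<nu> y" by (simp add: Liminf_const)
  finally show ?thesis by (simp add: u_def)
qed

text \<open>
  Entering a set that contains \<open>y\<close> in its interior does not change the Green kernel at \<open>y\<close>. For \<open>s = 0\<close>
  this is Hunt's identity for \<open>G\<^sub>r(x,y)\<close>; general \<open>s\<close> serves the behaviour at large times.
\<close>

lemma green_balayage:
  assumes "0 \<le> r" "0 \<le> s" "open S" "y \<in> S"
  shows "(\<integral>\<^sup>+z. G r z y \<partial>X.stopped_law r (\<lambda>_. ennreal s) x) =
    (\<integral>\<^sup>+z. G r z y \<partial>X.stopped_law r (entrance_after X s S) x)"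
  by (rule antisym; rule green_integral_le_of_resolvent_eq[OF assms(1) _ _ _ _ assms(3,4)])
    (use assms X.resolvent_at_entrance[OF assms(2,3)] X.const_stopping_time X.entrance_after_open_stopping
      in \<open>auto intro: X.finite_measure_stopped_law\<close>)

definition potential :: "real \<Rightarrow> real measure \<Rightarrow> real set \<Rightarrow> real \<Rightarrow> ennreal" where
  "potential r \<sigma> D x = (\<integral>\<^sup>+y\<in>D. G r x y \<partial>\<sigma>)"

lemma potential_measurable:
  assumes "0 \<le> r" "sigma_finite_measure \<sigma>" and s [measurable_cong]: "sets \<sigma> = sets borel"
    and [measurable]: "D \<in> sets borel"
  shows "potential r \<sigma> D \<in> borel_measurable borel"
proof -
  interpret sigma_finite_measure \<sigma> by (rule assms)
  show ?thesis unfolding potential_def[abs_def] using \<open>0 \<le> r\<close> by measurable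
qed

lemma integral_potential:
  assumes "0 \<le> r" "sigma_finite_measure \<sigma>" and s [measurable_cong]: "sets \<sigma> = sets borel"
    and [measurable]: "D \<in> sets borel"
    and "finite_measure \<mu>" and mu [measurable_cong]: "sets \<mu> = sets borel"
  shows "(\<integral>\<^sup>+z. potential r \<sigma> D z \<partial>\<mu>) = (\<integral>\<^sup>+y\<in>D. (\<integral>\<^sup>+z. G r z y \<partial>\<mu>) \<partial>\<sigma>)"
proof -
  interpret sg: sigma_finite_measure \<sigma> by (rule assms)
  interpret mu: finite_measure \<mu> by (rule assms)
  interpret pair_sigma_finite \<mu> \<sigma> ..
  have "(\<integral>\<^sup>+z. potential r \<sigma> D z \<partial>\<mu>) = (\<integral>\<^sup>+y. (\<integral>\<^sup>+z. G r z y * indicator D y \<partial>\<mu>) \<partial>\<sigma>)"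
    unfolding potential_def by (rule Fubini'[symmetric]) (use \<open>0 \<le> r\<close> in \<open>simp add: case_prod_beta'\<close>)
  also have "\<dots> = (\<integral>\<^sup>+y\<in>D. (\<integral>\<^sup>+z. G r z y \<partial>\<mu>) \<partial>\<sigma>)"
  proof (rule nn_integral_cong)
    fix y
    have "(\<lambda>z. G r z y) \<in> borel_measurable \<mu>" using \<open>0 \<le> r\<close> by simp
    then show "(\<integral>\<^sup>+z. G r z y * indicator D y \<partial>\<mu>) = (\<integral>\<^sup>+z. G r z y \<partial>\<mu>) * indicator D y"
      by (rule nn_integral_multc)
  qed
  finally show ?thesis .
qed

lemma potential_balayage:
  assumes "0 \<le> r" "0 \<le> s" "open S" "D \<subseteq> S" "sigma_finite_measure \<sigma>" "sets \<sigma> = sets borel" "D \<in> sets borel"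
  shows "(\<integral>\<^sup>+z. potential r \<sigma> D z \<partial>X.stopped_law r (\<lambda>_. ennreal s) x) =
    (\<integral>\<^sup>+z. potential r \<sigma> D z \<partial>X.stopped_law r (entrance_after X s S) x)"
proof -
  have fin: "finite_measure (X.stopped_law r (\<lambda>_. ennreal s) x)"
    "finite_measure (X.stopped_law r (entrance_after X s S) x)"
    using assms X.const_stopping_time X.entrance_after_open_stopping by (auto intro: X.finite_measure_stopped_law)
  show ?thesis
    unfolding integral_potential[OF assms(1,5,6,7) fin(1) X.sets_stopped_law]
      integral_potential[OF assms(1,5,6,7) fin(2) X.sets_stopped_law]
    using green_balayage[OF assms(1,2,3)] \<open>D \<subseteq> S\<close>
    by (intro nn_integral_cong) (auto simp: indicator_def)
qed

lemma potential_supermedian: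
  assumes "0 \<le> r" "sigma_finite_measure \<sigma>" "sets \<sigma> = sets borel" "D \<in> sets borel"
  shows "X.supermedian r (potential r \<sigma> D)"
  unfolding X.supermedian_def
proof (intro conjI allI impI)
  show V: "potential r \<sigma> D \<in> borel_measurable borel" by (rule potential_measurable[OF assms])
  fix t x :: real assume t: "0 \<le> t"
  have "ennreal (exp (- r * t)) * X.transition t (potential r \<sigma> D) x =
      (\<integral>\<^sup>+y\<in>D. (\<integral>\<^sup>+z. G r z y \<partial>X.stopped_law r (\<lambda>_. ennreal t) x) \<partial>\<sigma>)"
    unfolding X.stopped_law_const[OF V t, symmetric]
    by (rule integral_potential[OF assms])
      (use \<open>0 \<le> r\<close> X.const_stopping_time in \<open>auto intro: X.finite_measure_stopped_law\<close>)
  also have "\<dots> \<le> potential r \<sigma> D x"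
    unfolding potential_def
  proof (intro nn_integral_mono mult_right_mono)
    fix y
    have "excessive P X r (\<lambda>x. G r x y)" by (rule green_excessive[OF \<open>0 \<le> r\<close>])
    then show "(\<integral>\<^sup>+z. G r z y \<partial>X.stopped_law r (\<lambda>_. ennreal t) x) \<le> G r x y"
      using t by (subst X.stopped_law_const) (auto simp: excessive_def X.transition_def)
  qed simp
  finally show "ennreal (exp (- r * t)) * X.transition t (potential r \<sigma> D) x \<le> potential r \<sigma> D x" .
qed

end

section \<open>The optimal stopping problem\<close>

locale stopping_problem = dual_hunt_processes M P X M' P' X' m G
  for M :: "'w measure" and P :: "real \<Rightarrow> 'w measure" and X :: "real \<Rightarrow> 'w \<Rightarrow> real"
    and M' :: "'v measure" and P' :: "real \<Rightarrow> 'v measure" and X' :: "real \<Rightarrow> 'v \<Rightarrow> real"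
    and m :: "real measure" and G :: "real \<Rightarrow> real \<Rightarrow> real \<Rightarrow> ennreal" +
  fixes g :: "real \<Rightarrow> real" and r xs :: real and \<sigma> :: "real measure" and V :: "real \<Rightarrow> ennreal"
  assumes g_cont: "continuous_on UNIV g"
    and g_nonneg: "\<And>x. 0 \<le> g x"
    and r_nonneg: "0 \<le> r"
    and g_sup: "\<And>x. (\<integral>\<^sup>+\<omega>. (SUP t\<in>{0..}. ennreal (exp (- r * t) * g (X t \<omega>))) \<partial>P x) < \<infinity>"
    and sigma_radon: "radon_measure \<sigma>"
    and V_def: "\<And>x. V x = (\<integral>\<^sup>+y\<in>{xs..}. G r x y \<partial>\<sigma>)"
    and V_cont: "continuous_on UNIV V"
    and V_eq: "\<And>x. xs \<le> x \<Longrightarrow> V x = ennreal (g x)"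
    and V_ge: "\<And>x. x < xs \<Longrightarrow> ennreal (g x) \<le> V x"
begin

lemma g_le_V: "ennreal (g x) \<le> V x"
  using V_eq[of x] V_ge[of x] by (cases "xs \<le> x") auto

lemma sets_sigma: "sets \<sigma> = sets borel"
  using sigma_radon by (simp add: radon_measure_def)

lemma sigma_finite_sigma: "sigma_finite_measure \<sigma>"
  by (rule radon_measure_sigma_finite[OF sigma_radon])

lemma V_potential: "V = potential r \<sigma> {xs..}"
  by (simp add: fun_eq_iff V_def potential_def)

lemma V_measurable [measurable]: "V \<in> borel_measurable borel"
  using V_cont by (rule borel_measurable_continuous_onI)

lemma g_measurable [measurable]: "g \<in> borel_measurable borel"
  using g_cont by (rule borel_measurable_continuous_onI)

lemma V_supermedian: "X.supermedian r V"
  unfolding V_potential by (rule potential_supermedian[OF r_nonneg sigma_finite_sigma sets_sigma]) simp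

definition reward :: "real \<Rightarrow> 'w \<Rightarrow> ennreal" where
  "reward t \<omega> = ennreal (exp (- r * t) * g (X t \<omega>))"

lemma reward_le: "reward t \<omega> \<le> ennreal (exp (- r * t)) * V (X t \<omega>)"
proof -
  have "reward t \<omega> = ennreal (exp (- r * t)) * ennreal (g (X t \<omega>))"
    using g_nonneg by (simp add: reward_def ennreal_mult)
  also have "\<dots> \<le> ennreal (exp (- r * t)) * V (X t \<omega>)" by (intro mult_left_mono g_le_V) simp
  finally show ?thesis .
qed

lemma reward_measurable: "X t \<in> borel_measurable F \<Longrightarrow> reward t \<in> borel_measurable F"
  unfolding reward_def[abs_def] by measurable

text \<open>
  Half of right-continuity; including the time \<open>t\<close> itself in the interval makes the lemma fit grids that
  may contain \<open>t\<close>.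
\<close>

lemma reward_right_lsc:
  assumes "\<omega> \<in> space M" "0 \<le> t" "c < reward t \<omega>"
  obtains b where "t < b" "\<And>s. t \<le> s \<Longrightarrow> s < b \<Longrightarrow> c < reward s \<omega>"
proof -
  have "((\<lambda>s. g (X s \<omega>)) \<longlongrightarrow> g (X t \<omega>)) (at_right t)"
    using continuous_on_tendsto_compose[OF g_cont X.X_tendsto_right[OF assms(1,2)]] by simp
  then have "((\<lambda>s. reward s \<omega>) \<longlongrightarrow> reward t \<omega>) (at_right t)"
    unfolding reward_def by (intro tendsto_intros tendsto_ennrealI)
  then have "eventually (\<lambda>s. c < reward s \<omega>) (at_right t)"
    using assms(3) by (rule order_tendstoD(1))
  then obtain b where b: "t < b" "\<And>s. t < s \<Longrightarrow> s < b \<Longrightarrow> c < reward s \<omega>"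
    by (auto simp: eventually_at_right_field)
  show thesis
    using that[OF b(1)] b(2) assms(3) by (metis less_eq_real_def)
qed

text \<open>
  Rational times make the supremum measurable.
\<close>

definition reward_sup :: "'w \<Rightarrow> ennreal" where
  "reward_sup \<omega> = (SUP q\<in>{q\<in>\<rat>. 0 \<le> q}. reward q \<omega>)"

lemma reward_sup_measurable: "reward_sup \<in> borel_measurable M"
  unfolding reward_sup_def[abs_def]
proof (rule borel_measurable_SUP)
  show "countable {q\<in>\<rat>. 0 \<le> (q::real)}" by (rule countable_subset[OF _ countable_rat]) auto
qed (use X.measurable_X in \<open>auto intro: reward_measurable\<close>)

lemma reward_le_sup:
  assumes "\<omega> \<in> space M" "0 \<le> t"
  shows "reward t \<omega> \<le> reward_sup \<omega>"
proof (rule ccontr)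
  assume "\<not> reward t \<omega> \<le> reward_sup \<omega>"
  then obtain b where b: "t < b" "\<And>s. t \<le> s \<Longrightarrow> s < b \<Longrightarrow> reward_sup \<omega> < reward s \<omega>"
    using reward_right_lsc[OF assms] by (metis not_le)
  obtain q where q: "q \<in> \<rat>" "t < q" "q < b" using Rats_dense_in_real[OF b(1)] by blast
  have "reward q \<omega> \<le> reward_sup \<omega>"
    unfolding reward_sup_def using q assms by (intro SUP_upper) auto
  then show False using b(2)[of q] q by auto
qed

lemma reward_sup_finite: "(\<integral>\<^sup>+\<omega>. reward_sup \<omega> \<partial>P x) < \<infinity>"
proof -
  have "(\<integral>\<^sup>+\<omega>. reward_sup \<omega> \<partial>P x) \<le> (\<integral>\<^sup>+\<omega>. (SUP t\<in>{0..}. ennreal (exp (- r * t) * g (X t \<omega>))) \<partial>P x)"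
    unfolding reward_sup_def reward_def by (intro nn_integral_mono SUP_subset_mono) auto
  also have "\<dots> < \<infinity>" by (rule g_sup)
  finally show ?thesis .
qed

abbreviation "outer \<equiv> X.outer_entrance xs"

definition outer_value :: "nat \<Rightarrow> 'w \<Rightarrow> ennreal" where
  "outer_value n \<omega> = X.discount r (outer n) \<omega> * V (at_time X (outer n) \<omega>)"

text \<open>
  The half line \<open>(x\<^sup>* - 1/(n+1),\<infinity>)\<close> contains the support of \<open>\<sigma>\<close> in its interior. For \<open>[x\<^sup>*,\<infinity>)\<close> itself the
  balayage identity could fail at \<open>x\<^sup>*\<close>.
\<close>

lemma V_eq_outer: "V x = (\<integral>\<^sup>+\<omega>. outer_value n \<omega> \<partial>P x)"
proof -
  define S where "S = {xs - 1 / real (Suc n)<..}"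
  have S: "open S" "{xs..} \<subseteq> S" by (auto simp: S_def intro: less_le_trans[of _ xs])
  have "(\<integral>\<^sup>+z. potential r \<sigma> {xs..} z \<partial>X.stopped_law r (\<lambda>_. ennreal 0) x) =
    (\<integral>\<^sup>+z. potential r \<sigma> {xs..} z \<partial>X.stopped_law r (entrance_after X 0 S) x)"
    by (rule potential_balayage[OF r_nonneg order.refl S sigma_finite_sigma sets_sigma]) simp
  then have "(\<integral>\<^sup>+z. V z \<partial>X.stopped_law r (\<lambda>_. ennreal 0) x) = (\<integral>\<^sup>+z. V z \<partial>X.stopped_law r (outer n) x)"
    unfolding V_potential[symmetric] X.outer_entrance_def S_def .
  then have "V x = (\<integral>\<^sup>+z. V z \<partial>X.stopped_law r (outer n) x)"
    using X.stopped_law_const[OF V_measurable order.refl, of r x] by (simp add: X.transition_0)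
  also have "\<dots> = (\<integral>\<^sup>+\<omega>. outer_value n \<omega> \<partial>P x)"
    unfolding outer_value_def
    by (rule X.nn_integral_stopped_law[OF X.outer_entrance_stopping V_measurable])
  finally show ?thesis .
qed

text \<open>
  An integrable majorant: to the right of \<open>x\<^sup>*\<close> the function \<open>V\<close> equals the reward, and in the remaining
  small interval \<open>V\<close> is close to \<open>V(x\<^sup>*) = g(x\<^sup>*)\<close> by continuity.
\<close>

lemma outer_value_bound:
  obtains n0 where "\<And>n \<omega>. n0 \<le> n \<Longrightarrow> \<omega> \<in> space M \<Longrightarrow> outer_value n \<omega> \<le> reward_sup \<omega> + ennreal (g xs + 1)"
proof -
  have "V xs < ennreal (g xs + 1)" using V_eq[of xs] g_nonneg[of xs] by (simp add: ennreal_less_iff)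
  moreover have "(V \<longlongrightarrow> V xs) (at xs)"
    using V_cont by (simp add: continuous_on_eq_continuous_at continuous_at)
  ultimately have "eventually (\<lambda>x. V x < ennreal (g xs + 1)) (at xs)" by (rule order_tendstoD(2)[rotated])
  then obtain d where d: "0 < d" "\<And>x. x \<noteq> xs \<Longrightarrow> dist x xs < d \<Longrightarrow> V x < ennreal (g xs + 1)"
    by (auto simp: eventually_at)
  obtain n0 where n0: "1 / real (Suc n0) < d" using nat_approx_posE[OF d(1)] by blast
  show thesis
  proof (rule that[of n0])
    fix n \<omega> assume n: "n0 \<le> n" and w: "\<omega> \<in> space M"
    define p where "p = at_time X (outer n) \<omega>"
    show "outer_value n \<omega> \<le> reward_sup \<omega> + ennreal (g xs + 1)"
    proof (cases "outer n \<omega> < \<infinity>")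
      case True
      have p: "xs - 1 / real (Suc n) \<le> p"
        unfolding p_def by (rule X.outer_entrance_position[OF w True])
      show ?thesis
      proof (cases "xs \<le> p")
        case True
        have "outer_value n \<omega> \<le> reward (enn2real (outer n \<omega>)) \<omega>"
          using V_eq[OF True] g_nonneg
          by (auto simp: outer_value_def X.discount_def reward_def p_def at_time_def ennreal_mult indicator_def)
        also have "\<dots> \<le> reward_sup \<omega>" by (rule reward_le_sup[OF w]) simp
        finally show ?thesis by (simp add: add_increasing2)
      next
        case False
        have "1 / real (Suc n) \<le> 1 / real (Suc n0)" using n by (simp add: frac_le)
        then have "dist p xs < d" using p n0 False by (simp add: dist_real_def)
        then have "V p \<le> ennreal (g xs + 1)" using d(2)[of p] False by (auto intro: less_imp_le)
        then have "X.discount r (outer n) \<omega> * V p \<le> 1 * ennreal (g xs + 1)"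
          using X.discount_le_1[OF r_nonneg] by (intro mult_mono) auto
        then show ?thesis by (simp add: outer_value_def p_def add_increasing)
      qed
    qed (simp add: outer_value_def X.discount_def)
  qed
qed

lemma bound_finite: "(\<integral>\<^sup>+\<omega>. reward_sup \<omega> + ennreal (g xs + 1) \<partial>P x) < \<infinity>"
proof -
  interpret Px: prob_space "P x" by (rule X.prob_space_P)
  have "reward_sup \<in> borel_measurable (P x)" using reward_sup_measurable by simp
  then have "(\<integral>\<^sup>+\<omega>. reward_sup \<omega> + ennreal (g xs + 1) \<partial>P x) = (\<integral>\<^sup>+\<omega>. reward_sup \<omega> \<partial>P x) + ennreal (g xs + 1)"
    using Px.emeasure_space_1 by (subst nn_integral_add) auto
  then show ?thesis using reward_sup_finite[of x] by (simp add: less_top)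
qed

lemma V_finite: "V x < \<infinity>"
proof -
  obtain n0 where n0: "\<And>n \<omega>. n0 \<le> n \<Longrightarrow> \<omega> \<in> space M \<Longrightarrow> outer_value n \<omega> \<le> reward_sup \<omega> + ennreal (g xs + 1)"
    using outer_value_bound by blast
  have "V x = (\<integral>\<^sup>+\<omega>. outer_value n0 \<omega> \<partial>P x)" by (rule V_eq_outer)
  also have "\<dots> \<le> (\<integral>\<^sup>+\<omega>. reward_sup \<omega> + ennreal (g xs + 1) \<partial>P x)"
    using n0 by (intro nn_integral_mono) auto
  finally show ?thesis using bound_finite[of x] by (rule order.strict_trans1)
qed

text \<open>
  If the outer entrance times have a finite limit, it is \<open>\<tau>\<^sup>*\<close>, and the positions converge to a point of
  \<open>[x\<^sup>*,\<infinity>)\<close>, where \<open>V = g\<close>. Otherwise the path stays below \<open>x\<^sup>*\<close>, so every finite outer entrance happens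
  in \<open>[x\<^sup>* - 1, x\<^sup>*)\<close>; by transience this stops occurring, and the values vanish eventually.
\<close>

lemma limsup_outer_value_le:
  "AE \<omega> in P x. limsup (\<lambda>n. outer_value n \<omega>) \<le> discounted_reward X g r (entrance_time X {xs..}) \<omega>"
proof -
  have "AE \<omega> in P x. eventually (\<lambda>t. X t \<omega> \<notin> {xs - 1..xs}) at_top"
    by (rule X.transient) simp
  with X.outer_entrance_limit[of xs x] AE_space show ?thesis
  proof eventually_elim
    case (elim \<omega>)
    then have w: "\<omega> \<in> space M" by simp
    define S where "S = (SUP n. outer n \<omega>)"
    have tau: "entrance_time X {xs..} \<omega> = S"
      unfolding S_def by (rule X.entrance_time_eq_outer) (use elim in blast)
    have le: "outer n \<omega> \<le> S" for n unfolding S_def by (rule SUP_upper) simp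
    have lim_outer: "(\<lambda>n. outer n \<omega>) \<longlonglongrightarrow> S"
      unfolding S_def using X.outer_entrance_mono by (intro LIMSEQ_SUP incseq_SucI)
    show ?case
    proof (cases "S < \<infinity>")
      case True
      define p where "p = at_time X (\<lambda>\<omega>. SUP n. outer n \<omega>) \<omega>"
      have p: "xs \<le> p" "(\<lambda>n. at_time X (outer n) \<omega>) \<longlonglongrightarrow> p"
        using elim True by (auto simp: S_def p_def)
      have fin: "outer n \<omega> < \<infinity>" for n using le[of n] True by (rule order.strict_trans1)
      have "(\<lambda>n. enn2real (outer n \<omega>)) \<longlonglongrightarrow> enn2real S"
        using lim_outer True by (intro tendsto_enn2real) (auto simp: less_top)
      then have "(\<lambda>n. ennreal (exp (- r * enn2real (outer n \<omega>)))) \<longlonglongrightarrow> ennreal (exp (- r * enn2real S))"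
        by (intro tendsto_ennrealI tendsto_exp tendsto_mult tendsto_const)
      moreover have "(\<lambda>n. V (at_time X (outer n) \<omega>)) \<longlonglongrightarrow> V p"
        using continuous_on_tendsto_compose[OF V_cont p(2)] by simp
      ultimately have "(\<lambda>n. ennreal (exp (- r * enn2real (outer n \<omega>))) * V (at_time X (outer n) \<omega>))
          \<longlonglongrightarrow> ennreal (exp (- r * enn2real S)) * V p"
        by (rule tendsto_mult_ennreal) (use V_finite[of p] in \<open>auto simp: ennreal_eq_0_iff\<close>)
      moreover have "ennreal (exp (- r * enn2real (outer n \<omega>))) * V (at_time X (outer n) \<omega>) = outer_value n \<omega>" for n
        using fin by (simp add: outer_value_def X.discount_def)
      moreover have "ennreal (exp (- r * enn2real S)) * V p = discounted_reward X g r (entrance_time X {xs..}) \<omega>"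
      proof -
        have "p = X (enn2real S) \<omega>" by (simp add: p_def at_time_def S_def)
        moreover have "S \<noteq> \<infinity>" using True by auto
        ultimately show ?thesis
          using V_eq[OF p(1)] g_nonneg
          by (simp add: discounted_reward_def at_time_def tau ennreal_mult)
      qed
      ultimately have "(\<lambda>n. outer_value n \<omega>) \<longlonglongrightarrow> discounted_reward X g r (entrance_time X {xs..}) \<omega>"
        by simp
      then show ?thesis by (simp add: lim_imp_Limsup)
    next
      case False
      then have S: "S = \<infinity>" by (auto simp: less_top[symmetric])
      have below: "X t \<omega> < xs" if "0 \<le> t" for t
      proof (rule ccontr)
        assume "\<not> X t \<omega> < xs"
        then have "entrance_time X {xs..} \<omega> \<le> ennreal t"
          unfolding entrance_time_def using that by (intro Inf_lower) auto
        then show False using tau S by (simp add: top_unique)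
      qed
      obtain t0 where t0: "\<And>t. t0 \<le> t \<Longrightarrow> X t \<omega> \<notin> {xs - 1..xs}"
        using elim by (auto simp: eventually_at_top_linorder)
      have "eventually (\<lambda>n. ennreal t0 < outer n \<omega>) sequentially"
        using lim_outer S by (intro order_tendstoD(1)) auto
      then have "eventually (\<lambda>n. outer_value n \<omega> = 0) sequentially"
      proof eventually_elim
        case (elim n)
        show ?case
        proof (cases "outer n \<omega> < \<infinity>")
          case True
          define u where "u = enn2real (outer n \<omega>)"
          have u: "outer n \<omega> = ennreal u" "0 \<le> u" using True by (auto simp: u_def less_top[symmetric])
          have "t0 \<le> u"
          proof (rule ccontr)
            assume "\<not> t0 \<le> u"
            then have "ennreal u \<le> ennreal t0" by (intro ennreal_leI) simp
            then show False using elim u by simp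
          qed
          have "1 / real (Suc n) \<le> 1" by simp
          then have "xs - 1 \<le> X u \<omega>"
            using X.outer_entrance_position[OF w True] unfolding at_time_def u_def by linarith
          then show ?thesis using t0[OF \<open>t0 \<le> u\<close>] below[OF u(2)] by auto
        qed (simp add: outer_value_def X.discount_def)
      qed
      then have "(\<lambda>n. outer_value n \<omega>) \<longlonglongrightarrow> 0" by (rule tendsto_eventually)
      then show ?thesis by (simp add: lim_imp_Limsup)
    qed
  qed
qed

lemma V_le_expected_reward:
  "V x \<le> expected_reward P X g r (entrance_time X {xs..}) x"
proof -
  let ?C = "completion (P x)"
  obtain n0 where n0: "\<And>n \<omega>. n0 \<le> n \<Longrightarrow> \<omega> \<in> space M \<Longrightarrow> outer_value n \<omega> \<le> reward_sup \<omega> + ennreal (g xs + 1)"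
    using outer_value_bound by blast
  have [measurable]: "reward_sup \<in> borel_measurable ?C"
    using reward_sup_measurable by (intro measurable_completion) simp
  have [measurable]: "outer_value n \<in> borel_measurable ?C" for n
  proof -
    note [measurable] = X.at_time_measurable_completion[OF X.outer_entrance_stopping]
      X.discount_measurable_completion[OF X.outer_entrance_stopping]
    show ?thesis unfolding outer_value_def[abs_def] by measurable
  qed
  have "V x = limsup (\<lambda>n. \<integral>\<^sup>+\<omega>. outer_value (n + n0) \<omega> \<partial>?C)"
    unfolding nn_integral_completion V_eq_outer[of x, symmetric] by (simp add: Limsup_const)
  also have "\<dots> \<le> (\<integral>\<^sup>+\<omega>. limsup (\<lambda>n. outer_value (n + n0) \<omega>) \<partial>?C)"
  proof (rule nn_integral_limsup)
    show "AE \<omega> in ?C. outer_value (i + n0) \<omega> \<le> reward_sup \<omega> + ennreal (g xs + 1)" for i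
      using n0 by (intro AE_I2) simp
    show "(\<integral>\<^sup>+\<omega>. reward_sup \<omega> + ennreal (g xs + 1) \<partial>?C) < \<infinity>"
      using bound_finite by (simp add: nn_integral_completion)
  qed measurable
  also have "\<dots> \<le> expected_reward P X g r (entrance_time X {xs..}) x"
    unfolding expected_reward_def
  proof (rule nn_integral_mono_AE)
    show "AE \<omega> in ?C. limsup (\<lambda>n. outer_value (n + n0) \<omega>) \<le> discounted_reward X g r (entrance_time X {xs..}) \<omega>"
      using AE_completion[OF limsup_outer_value_le]
    proof eventually_elim
      case (elim \<omega>)
      have "limsup ((\<lambda>n. outer_value n \<omega>) \<circ> (\<lambda>n. n + n0)) \<le> limsup (\<lambda>n. outer_value n \<omega>)"
        by (rule limsup_subseq_mono) (simp add: strict_mono_def)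
      then show ?case using elim by (simp add: comp_def)
    qed
  qed
  finally show ?thesis .
qed


text \<open>
  The discounted mean \<open>e\<^bsup>-rn\<^esup>E\<^sub>x(V(X\<^sub>n))\<close>.
\<close>

definition mean_value :: "real \<Rightarrow> nat \<Rightarrow> ennreal" where
  "mean_value x n = (\<integral>\<^sup>+z. V z \<partial>X.stopped_law r (\<lambda>_. ennreal (real n)) x)"

lemma mean_value_eq: "mean_value x n = ennreal (exp (- r * real n)) * X.transition (real n) V x"
  unfolding mean_value_def by (rule X.stopped_law_const) auto

text \<open>
  The measure \<open>\<sigma>\<close> is cut at \<open>k\<close>. Balayage from time \<open>n\<close> onto a bounded neighbourhood of \<open>[x\<^sup>*,k]\<close> replaces
  the potential of the near part by its values on that neighbourhood, where \<open>V\<close> is bounded; the far part only decreases in the mean.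
\<close>

lemma mean_value_split_le:
  obtains C where "C < \<infinity>" "\<And>n. mean_value x n \<le>
    C * (\<integral>\<^sup>+\<omega>. indicator {\<omega>. entrance_after X (real n) {xs - 1<..<k + 1} \<omega> < \<infinity>} \<omega> \<partial>P x) +
    potential r \<sigma> ({xs..} \<inter> {k<..}) x"
proof -
  define S where "S = {xs - 1<..<k + 1}"
  define A where "A = {xs..} \<inter> {..k}"
  define B where "B = {xs..} \<inter> {k<..}"
  note pot = r_nonneg sigma_finite_sigma sets_sigma
  have S: "open S" "A \<subseteq> S" by (auto simp: S_def A_def)
  have closure_S: "closure S \<subseteq> {xs - 1..k + 1}"
    by (rule closure_minimal) (auto simp: S_def)
  have [measurable]: "A \<in> sets borel" "B \<in> sets borel" by (simp_all add: A_def B_def)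
  have [measurable]: "potential r \<sigma> A \<in> borel_measurable borel" "potential r \<sigma> B \<in> borel_measurable borel"
    by (rule potential_measurable[OF pot]; measurable)+
  obtain C where C: "C < \<infinity>" "\<And>z. z \<in> {xs - 1..k + 1} \<Longrightarrow> V z \<le> C"
  proof (cases "{xs - 1..k + 1} = {}")
    case True
    then show thesis using that[of 0] by auto
  next
    case False
    have "\<exists>z\<in>{xs - 1..k + 1}. \<forall>y\<in>{xs - 1..k + 1}. V y \<le> V z"
      using False by (intro continuous_attains_sup continuous_on_subset[OF V_cont]) auto
    then obtain z where "\<forall>y\<in>{xs - 1..k + 1}. V y \<le> V z" by blast
    then show thesis using that[of "V z"] V_finite[of z] by blast
  qed
  have split: "V z = potential r \<sigma> A z + potential r \<sigma> B z" for z
  proof -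
    have "(\<lambda>y. G r z y) \<in> borel_measurable borel" using r_nonneg by simp
    then have [measurable]: "(\<lambda>y. G r z y) \<in> borel_measurable \<sigma>"
      by (simp add: measurable_cong_sets[OF sets_sigma refl])
    have [measurable]: "A \<in> sets \<sigma>" "B \<in> sets \<sigma>" by (simp_all add: sets_sigma)
    have "(indicator {xs..} y :: ennreal) = indicator A y + indicator B y" for y
      by (auto simp: indicator_def A_def B_def)
    then show ?thesis
      unfolding V_def potential_def by (simp add: nn_integral_add[symmetric] distrib_left)
  qed
  have bound: "mean_value x n \<le>
    C * (\<integral>\<^sup>+\<omega>. indicator {\<omega>. entrance_after X (real n) S \<omega> < \<infinity>} \<omega> \<partial>P x) + potential r \<sigma> B x" for n
  proof -
    let ?T = "entrance_after X (real n) S"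
    let ?L = "X.stopped_law r (\<lambda>_. ennreal (real n)) x"
    have T: "?T \<in> stopping_times M P X" using S by (intro X.entrance_after_open_stopping) auto
    have Tm [measurable]: "?T \<in> borel_measurable (completion (P x))" by (rule X.stopping_times_measurable[OF T])
    have "mean_value x n = (\<integral>\<^sup>+z. potential r \<sigma> A z \<partial>?L) + (\<integral>\<^sup>+z. potential r \<sigma> B z \<partial>?L)"
      unfolding mean_value_def split by (rule nn_integral_add) auto
    also have "(\<integral>\<^sup>+z. potential r \<sigma> A z \<partial>?L) = (\<integral>\<^sup>+z. potential r \<sigma> A z \<partial>X.stopped_law r ?T x)"
      by (rule potential_balayage[OF r_nonneg _ S(1,2) sigma_finite_sigma sets_sigma]) simp_all
    also have "\<dots> = (\<integral>\<^sup>+\<omega>. X.discount r ?T \<omega> * potential r \<sigma> A (at_time X ?T \<omega>) \<partial>P x)"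
      by (rule X.nn_integral_stopped_law[OF T]) measurable
    also have "\<dots> \<le> (\<integral>\<^sup>+\<omega>. C * indicator {\<omega>. ?T \<omega> < \<infinity>} \<omega> \<partial>P x)"
    proof (rule nn_integral_mono)
      fix \<omega> assume "\<omega> \<in> space (P x)"
      then have w: "\<omega> \<in> space M" by simp
      show "X.discount r ?T \<omega> * potential r \<sigma> A (at_time X ?T \<omega>) \<le> C * indicator {\<omega>. ?T \<omega> < \<infinity>} \<omega>"
      proof (cases "?T \<omega> < \<infinity>")
        case True
        have "at_time X ?T \<omega> \<in> {xs - 1..k + 1}"
          using X.entrance_after_closure[OF w _ True] closure_S by auto
        then have "potential r \<sigma> A (at_time X ?T \<omega>) \<le> C"
          using C(2) split[of "at_time X ?T \<omega>"] by (metis order.trans le_iff_add)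
        then have "X.discount r ?T \<omega> * potential r \<sigma> A (at_time X ?T \<omega>) \<le> 1 * C"
          by (intro mult_mono X.discount_le_1[OF r_nonneg]) auto
        then show ?thesis using True by simp
      qed (simp add: X.discount_def)
    qed
    also have "\<dots> = C * (\<integral>\<^sup>+\<omega>. indicator {\<omega>. ?T \<omega> < \<infinity>} \<omega> \<partial>P x)"
    proof -
      have "(\<integral>\<^sup>+\<omega>. C * indicator {\<omega>. ?T \<omega> < \<infinity>} \<omega> \<partial>completion (P x)) =
          C * (\<integral>\<^sup>+\<omega>. indicator {\<omega>. ?T \<omega> < \<infinity>} \<omega> \<partial>completion (P x))"
        by (rule nn_integral_cmult) measurable
      then show ?thesis by (simp only: nn_integral_completion)
    qed
    finally have "mean_value x n \<le> C * (\<integral>\<^sup>+\<omega>. indicator {\<omega>. ?T \<omega> < \<infinity>} \<omega> \<partial>P x) + (\<integral>\<^sup>+z. potential r \<sigma> B z \<partial>?L)"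
      by (simp add: add_right_mono)
    also have "(\<integral>\<^sup>+z. potential r \<sigma> B z \<partial>?L) \<le> potential r \<sigma> B x"
      using potential_supermedian[OF pot, of B]
      by (subst X.stopped_law_const) (auto simp: X.supermedian_def)
    finally show ?thesis by (simp add: add_left_mono)
  qed
  show thesis using that[OF C(1)] bound unfolding S_def B_def by blast
qed

lemma potential_tail_tendsto_0: "(\<lambda>k. potential r \<sigma> ({xs..} \<inter> {real k<..}) x) \<longlonglongrightarrow> 0"
proof -
  have "(\<lambda>y. G r x y) \<in> borel_measurable borel" using r_nonneg by simp
  then have [measurable]: "(\<lambda>y. G r x y) \<in> borel_measurable \<sigma>"
    by (simp add: measurable_cong_sets[OF sets_sigma refl])
  have [measurable]: "{xs..} \<in> sets \<sigma>" "{real k<..} \<in> sets \<sigma>" for k by (simp_all add: sets_sigma)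
  have "(\<lambda>k. \<integral>\<^sup>+y\<in>{xs..} \<inter> {real k<..}. G r x y \<partial>\<sigma>) \<longlonglongrightarrow> (\<integral>\<^sup>+y. 0 \<partial>\<sigma>)"
  proof (rule nn_integral_dominated_convergence[where w="\<lambda>y. G r x y * indicator {xs..} y"])
    show "(\<integral>\<^sup>+y. G r x y * indicator {xs..} y \<partial>\<sigma>) < \<infinity>" using V_finite[of x] by (simp add: V_def)
    have "eventually (\<lambda>k. G r x y * indicator ({xs..} \<inter> {real k<..}) y = 0) sequentially" for y
    proof -
      obtain k0 :: nat where "y \<le> real k0" using real_arch_simple by blast
      then have "\<not> real k < y" if "k0 \<le> k" for k using that by (auto simp: not_less intro: order.trans)
      then show ?thesis unfolding eventually_sequentially by (intro exI[of _ k0]) (auto simp: indicator_def)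
    qed
    then show "AE y in \<sigma>. (\<lambda>k. G r x y * indicator ({xs..} \<inter> {real k<..}) y) \<longlonglongrightarrow> 0"
      by (intro AE_I2 tendsto_eventually)
  qed (auto simp: indicator_def)
  then show ?thesis by (simp add: potential_def)
qed

lemma mean_value_tendsto_0: "mean_value x \<longlonglongrightarrow> 0"
proof -
  have "limsup (mean_value x) \<le> potential r \<sigma> ({xs..} \<inter> {real k<..}) x" for k
  proof -
    define S where "S = {xs - 1<..<real k + 1}"
    define p where "p n = (\<integral>\<^sup>+\<omega>. indicator {\<omega>. entrance_after X (real n) S \<omega> < \<infinity>} \<omega> \<partial>P x :: ennreal)" for n
    define b where "b = potential r \<sigma> ({xs..} \<inter> {real k<..}) x"
    obtain C where C: "C < \<infinity>" "\<And>n. mean_value x n \<le> C * p n + b"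
      using mean_value_split_le[of x "real k"] unfolding p_def S_def b_def by blast
    have "p \<longlonglongrightarrow> 0"
      unfolding p_def[abs_def]
      by (rule X.entrance_probability_tendsto_0[of "{xs - 1..real k + 1}"]) (auto simp: S_def)
    then have "(\<lambda>n. C * p n + b) \<longlonglongrightarrow> C * 0 + b"
      using C by (intro tendsto_add tendsto_const ennreal_tendsto_cmult) auto
    then have "limsup (\<lambda>n. C * p n + b) = b" by (simp add: lim_imp_Limsup)
    moreover have "limsup (mean_value x) \<le> limsup (\<lambda>n. C * p n + b)"
      using C by (intro Limsup_mono always_eventually) simp
    ultimately show ?thesis by (simp add: b_def)
  qed
  then have "limsup (mean_value x) \<le> 0"
    by (intro LIMSEQ_le_const[OF potential_tail_tendsto_0[of x]]) auto
  then show ?thesis by (intro tendsto_0_if_Limsup_eq_0_ennreal) simp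
qed

text \<open>
  The disjointed sets are the events that \<open>A\<close> occurs for the first time at a given grid point, so the sum is the
  reward at the first occurrence.
\<close>

lemma grid_stopping_le:
  assumes "0 \<le> s" and A: "\<And>i. A i \<in> sets (natural_filtration M P X (ennreal (grid s k i)))"
  shows "(\<integral>\<^sup>+\<omega>. (\<Sum>i<N. reward (grid s k i) \<omega> * indicator (disjointed A i) \<omega>) \<partial>P x) \<le>
    ennreal (exp (- r * s)) * X.transition s V x"
proof -
  interpret F: filtration "space M" "natural_filtration M P X" by (rule X.filtration_natural)
  let ?C = "completion (P x)"
  have D: "disjointed A i \<in> sets (natural_filtration M P X (ennreal (grid s k i)))" for i
  proof -
    have "A j \<in> sets (natural_filtration M P X (ennreal (grid s k i)))" if "j \<le> i" for j
      using A[of j] F.sets_F_mono[of "ennreal (grid s k j)" "ennreal (grid s k i)"]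
        monoD[OF mono_grid that, of s k] by (auto intro: ennreal_leI)
    then show ?thesis unfolding disjointed_def by (intro sets.Diff sets.finite_UN) auto
  qed
  have [measurable]: "disjointed A i \<in> sets ?C" for i using D X.natural_subset_completion by blast
  have [measurable]: "reward (grid s k i) \<in> borel_measurable ?C" for i
    by (intro reward_measurable X.X_measurable_completion grid_nonneg \<open>0 \<le> s\<close>)
  have "(\<integral>\<^sup>+\<omega>. (\<Sum>i<N. reward (grid s k i) \<omega> * indicator (disjointed A i) \<omega>) \<partial>?C) =
      (\<Sum>i<N. \<integral>\<^sup>+\<omega>\<in>disjointed A i. reward (grid s k i) \<omega> \<partial>?C)"
    by (rule nn_integral_sum) measurable
  also have "\<dots> \<le> (\<Sum>i<N. \<integral>\<^sup>+\<omega>\<in>disjointed A i. ennreal (exp (- r * grid s k i)) * V (X (grid s k i) \<omega>) \<partial>?C)"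
    by (intro sum_mono nn_integral_mono mult_right_mono reward_le) simp
  also have "\<dots> \<le> ennreal (exp (- r * grid s k 0)) * X.transition (grid s k 0) V x"
    unfolding nn_integral_completion
  proof (rule X.discrete_optional_stopping[OF V_supermedian _ mono_grid D])
    show "0 \<le> grid s k 0" by (rule grid_nonneg[OF \<open>0 \<le> s\<close>])
    show "disjointed A i \<inter> disjointed A j = {}" if "i < j" for i j
      using disjoint_family_disjointed[of A] that by (auto simp: disjoint_family_on_def)
  qed
  also have "grid s k 0 = s" by (simp add: grid_def)
  finally show ?thesis by (simp only: nn_integral_completion)
qed

definition exceed :: "real \<Rightarrow> nat \<Rightarrow> nat \<Rightarrow> 'w set" where
  "exceed e n k = (\<Union>i<(Suc k)\<^sup>2. {\<omega>\<in>space M. ennreal e < reward (grid (real n) k i) \<omega>})"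

lemma exceed_measurable: "exceed e n k \<in> sets M"
proof -
  have "{\<omega>\<in>space M. ennreal e < reward (grid (real n) k i) \<omega>} \<in> sets M" for i
  proof -
    have [measurable]: "reward (grid (real n) k i) \<in> borel_measurable M"
      by (intro reward_measurable X.measurable_X grid_nonneg) simp
    show ?thesis by measurable
  qed
  then show ?thesis unfolding exceed_def by (intro sets.finite_UN) auto
qed

text \<open>
  Stopping at the first grid point where the reward exceeds \<open>e\<close> yields at least \<open>e\<close> on the event \<open>exceed\<close>.
\<close>

lemma maximal_inequality:
  "(\<integral>\<^sup>+\<omega>. ennreal e * indicator (exceed e n k) \<omega> \<partial>P x) \<le> mean_value x n"
proof -
  define A where "A i = {\<omega>\<in>space M. ennreal e < reward (grid (real n) k i) \<omega>}" for i
  have "A i \<in> sets (natural_filtration M P X (ennreal (grid (real n) k i)))" for i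
  proof -
    have [measurable]: "reward (grid (real n) k i) \<in> borel_measurable (natural_filtration M P X (ennreal (grid (real n) k i)))"
      by (intro reward_measurable X.X_measurable_natural grid_nonneg) auto
    have "{\<omega>\<in>space (natural_filtration M P X (ennreal (grid (real n) k i))). ennreal e < reward (grid (real n) k i) \<omega>}
        \<in> sets (natural_filtration M P X (ennreal (grid (real n) k i)))" by measurable
    then show ?thesis by (simp add: A_def)
  qed
  from grid_stopping_le[OF _ this, where N="(Suc k)\<^sup>2" and x=x]
  have le: "(\<integral>\<^sup>+\<omega>. (\<Sum>i<(Suc k)\<^sup>2. reward (grid (real n) k i) \<omega> * indicator (disjointed A i) \<omega>) \<partial>P x) \<le> mean_value x n"
    by (simp only: mean_value_eq of_nat_0_le_iff)
  have "ennreal e * indicator (exceed e n k) \<omega> \<le>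
      (\<Sum>i<(Suc k)\<^sup>2. reward (grid (real n) k i) \<omega> * indicator (disjointed A i) \<omega>)" for \<omega>
  proof (cases "\<omega> \<in> exceed e n k")
    case True
    then obtain j where j: "j < (Suc k)\<^sup>2" "\<omega> \<in> A j" by (auto simp: exceed_def A_def)
    define i where "i = (LEAST i. \<omega> \<in> A i)"
    have i: "\<omega> \<in> A i" "i \<le> j" "\<And>l. l < i \<Longrightarrow> \<omega> \<notin> A l"
      unfolding i_def using j(2) by (auto intro: LeastI Least_le dest: not_less_Least)
    then have "\<omega> \<in> disjointed A i" by (auto simp: disjointed_def)
    then have "ennreal e \<le> reward (grid (real n) k i) \<omega> * indicator (disjointed A i) \<omega>"
      using i(1) by (simp add: A_def less_imp_le)
    also have "\<dots> \<le> (\<Sum>i<(Suc k)\<^sup>2. reward (grid (real n) k i) \<omega> * indicator (disjointed A i) \<omega>)"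
      using i(2) j(1) by (intro member_le_sum) auto
    finally show ?thesis using True by simp
  qed simp
  then have "(\<integral>\<^sup>+\<omega>. ennreal e * indicator (exceed e n k) \<omega> \<partial>P x) \<le>
      (\<integral>\<^sup>+\<omega>. (\<Sum>i<(Suc k)\<^sup>2. reward (grid (real n) k i) \<omega> * indicator (disjointed A i) \<omega>) \<partial>P x)"
    by (intro nn_integral_mono)
  also note le
  finally show ?thesis .
qed

text \<open>
  If the reward exceeds \<open>e\<close> at some time after \<open>n\<close>, then by right-continuity all sufficiently fine grids notice it. The
  limes inferior over the grids is measurable, and its mean is at most the discounted mean of \<open>V\<close>, which tends to \<open>0\<close>.
\<close>

lemma AE_eventually_reward_le:
  assumes "0 < e"
  shows "AE \<omega> in P x. eventually (\<lambda>t. reward t \<omega> \<le> ennreal e) at_top"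
proof -
  define F where "F n \<omega> = liminf (\<lambda>k. ennreal e * indicator (exceed e n k) \<omega>)" for n \<omega>
  have [measurable]: "exceed e n k \<in> sets (P x)" for n k using exceed_measurable by simp
  have [measurable]: "F n \<in> borel_measurable (P x)" for n
    unfolding F_def[abs_def] by measurable
  have "(\<integral>\<^sup>+\<omega>. F n \<omega> \<partial>P x) \<le> mean_value x n" for n
  proof -
    have "(\<integral>\<^sup>+\<omega>. F n \<omega> \<partial>P x) \<le> liminf (\<lambda>k. \<integral>\<^sup>+\<omega>. ennreal e * indicator (exceed e n k) \<omega> \<partial>P x)"
      unfolding F_def by (rule nn_integral_liminf) measurable
    also have "\<dots> \<le> liminf (\<lambda>k. mean_value x n)"
      by (intro Liminf_mono always_eventually allI maximal_inequality)
    finally show ?thesis by (simp add: Liminf_const)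
  qed
  then have "(\<integral>\<^sup>+\<omega>. (INF n. F n \<omega>) \<partial>P x) \<le> mean_value x n" for n
    by (rule order.trans[rotated]) (intro nn_integral_mono INF_lower, simp)
  then have "(\<integral>\<^sup>+\<omega>. (INF n. F n \<omega>) \<partial>P x) \<le> 0"
    by (intro LIMSEQ_le_const[OF mean_value_tendsto_0[of x]]) auto
  then have "AE \<omega> in P x. (INF n. F n \<omega>) = 0"
    by (subst (asm) le_zero_eq, subst (asm) nn_integral_0_iff_AE) auto
  then show ?thesis using AE_space
  proof eventually_elim
    case (elim \<omega>)
    then have w: "\<omega> \<in> space M" by simp
    have "(INF n. F n \<omega>) < ennreal e" using elim assms by simp
    then obtain n where n: "F n \<omega> < ennreal e" by (auto simp: INF_less_iff)
    have "reward t \<omega> \<le> ennreal e" if "real n \<le> t" for t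
    proof (rule ccontr)
      assume "\<not> reward t \<omega> \<le> ennreal e"
      then have "ennreal e < reward t \<omega>" by simp
      moreover have "0 \<le> t" using that by (rule order.trans[rotated]) simp
      ultimately obtain b where b: "t < b" "\<And>s. t \<le> s \<Longrightarrow> s < b \<Longrightarrow> ennreal e < reward s \<omega>"
        using reward_right_lsc[OF w] by metis
      have "eventually (\<lambda>k. ennreal e \<le> ennreal e * indicator (exceed e n k) \<omega>) sequentially"
        using grid_hits[OF that b(1)]
      proof eventually_elim
        case (elim k)
        then have "\<omega> \<in> exceed e n k" using b(2) w by (auto simp: exceed_def)
        then show ?case by simp
      qed
      then have "ennreal e \<le> F n \<omega>" unfolding F_def by (rule Liminf_bounded)
      then show False using n by simp
    qed
    then show ?case by (auto simp: eventually_at_top_linorder)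
  qed
qed

lemma AE_limsup_reward: "AE \<omega> in P x. Limsup at_top (\<lambda>t. reward t \<omega>) = 0"
proof -
  have "AE \<omega> in P x. \<forall>j. eventually (\<lambda>t. reward t \<omega> \<le> ennreal (1 / real (Suc j))) at_top"
    unfolding AE_all_countable by (intro allI AE_eventually_reward_le) simp
  then show ?thesis
  proof eventually_elim
    case (elim \<omega>)
    then have "Limsup at_top (\<lambda>t. reward t \<omega>) \<le> ennreal (1 / real (Suc j))" for j
      by (intro Limsup_bounded) auto
    moreover have "(\<lambda>j. ennreal (1 / real (Suc j))) \<longlonglongrightarrow> ennreal 0"
      by (intro tendsto_ennrealI) real_asymp
    ultimately have "Limsup at_top (\<lambda>t. reward t \<omega>) \<le> ennreal 0"
      by (intro LIMSEQ_le_const) auto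
    then show ?case by simp
  qed
qed

text \<open>
  Rounding \<open>T\<close> up to the grid gives stopping rules to which discrete optional stopping applies. As the mesh
  shrinks, the rounded times converge to \<open>T\<close> from above, and right-continuity of the reward with Fatou's
  lemma gives the bound on \<open>{T < \<infinity>}\<close>; on \<open>{T = \<infinity>}\<close> the gain is almost surely zero.
\<close>

lemma expected_reward_le_V:
  assumes T: "T \<in> stopping_times M P X"
  shows "expected_reward P X g r T x \<le> V x"
proof -
  interpret F: filtration "space M" "natural_filtration M P X" by (rule X.filtration_natural)
  let ?C = "completion (P x)"
  define A where "A k i = {\<omega>\<in>space M. T \<omega> \<le> ennreal (grid 0 k i)}" for k i
  define Z where "Z k \<omega> = (\<Sum>i<(Suc k)\<^sup>2. reward (grid 0 k i) \<omega> * indicator (disjointed (A k) i) \<omega>)" for k \<omega>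
  have A: "A k i \<in> sets (natural_filtration M P X (ennreal (grid 0 k i)))" for k i
    using stopping_timeD[of "natural_filtration M P X" T "ennreal (grid 0 k i)"] T
    by (simp add: X.stopping_times_iff A_def pred_def)
  have Z_le: "(\<integral>\<^sup>+\<omega>. Z k \<omega> \<partial>?C) \<le> V x" for k
    using grid_stopping_le[OF order.refl A, where k=k and N="(Suc k)\<^sup>2" and x=x] X.transition_0[of V x]
    by (simp add: Z_def nn_integral_completion)
  have Zm: "Z k \<in> borel_measurable ?C" for k
  proof -
    have AC: "A k i \<in> sets ?C" for i using A X.natural_subset_completion by blast
    have [measurable]: "disjointed (A k) i \<in> sets ?C" for i
      using sets.range_disjointed_sets[of "A k" ?C] AC by auto
    have [measurable]: "reward (grid 0 k i) \<in> borel_measurable ?C" for i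
      by (intro reward_measurable X.X_measurable_completion grid_nonneg) simp
    show ?thesis unfolding Z_def[abs_def] by measurable
  qed
  have "expected_reward P X g r T x \<le> (\<integral>\<^sup>+\<omega>. liminf (\<lambda>k. Z k \<omega>) \<partial>?C)"
    unfolding expected_reward_def
  proof (rule nn_integral_mono_AE)
    show "AE \<omega> in ?C. discounted_reward X g r T \<omega> \<le> liminf (\<lambda>k. Z k \<omega>)"
      using AE_completion[OF AE_limsup_reward[of x]] AE_space
    proof eventually_elim
      case (elim \<omega>)
      then have w: "\<omega> \<in> space M" by simp
      show ?case
      proof (cases "T \<omega>")
        case (real s)
        have d: "discounted_reward X g r T \<omega> = reward s \<omega>"
          using real by (simp add: discounted_reward_def reward_def at_time_def)
        show ?thesis unfolding d
        proof (rule dense_le)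
          fix c assume "c < reward s \<omega>"
          then obtain b where b: "s < b" "\<And>u. s \<le> u \<Longrightarrow> u < b \<Longrightarrow> c < reward u \<omega>"
            using reward_right_lsc[OF w real(1)] by metis
          show "c \<le> liminf (\<lambda>k. Z k \<omega>)"
          proof (rule Liminf_bounded)
            show "eventually (\<lambda>k. c \<le> Z k \<omega>) sequentially"
              using grid_hits[OF real(1) b(1)]
            proof eventually_elim
              case (elim k)
              then obtain j where j: "j < (Suc k)\<^sup>2" "s \<le> grid 0 k j" "grid 0 k j < b" by blast
              have inA: "\<omega> \<in> A k l \<longleftrightarrow> s \<le> grid 0 k l" for l
                using w real grid_nonneg[of 0 k l] by (simp add: A_def ennreal_le_iff)
              have jA: "\<omega> \<in> A k j" using j(2) inA by simp
              \<comment> \<open>The grid point to which \<open>T\<close> is rounded up.\<close>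
              define i where "i = (LEAST i. \<omega> \<in> A k i)"
              have i: "\<omega> \<in> A k i" "i \<le> j" "\<And>l. l < i \<Longrightarrow> \<omega> \<notin> A k l"
                unfolding i_def using jA by (auto intro: LeastI Least_le dest: not_less_Least)
              then have "\<omega> \<in> disjointed (A k) i" by (auto simp: disjointed_def)
              moreover have "grid 0 k i < b" using monoD[OF mono_grid i(2), of 0 k] j(3) by simp
              ultimately have "c \<le> reward (grid 0 k i) \<omega> * indicator (disjointed (A k) i) \<omega>"
                using i(1) inA b(2)[of "grid 0 k i"] by (simp add: less_imp_le)
              also have "\<dots> \<le> Z k \<omega>"
                unfolding Z_def using i(2) j(1) by (intro member_le_sum) auto
              finally show ?case .
            qed
          qed
        qed
      next
        case top
        then show ?thesis using elim by (simp add: discounted_reward_def reward_def)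
      qed
    qed
  qed
  also have "\<dots> \<le> liminf (\<lambda>k. \<integral>\<^sup>+\<omega>. Z k \<omega> \<partial>?C)" by (rule nn_integral_liminf[OF Zm])
  also have "\<dots> \<le> liminf (\<lambda>k. V x)" by (intro Liminf_mono always_eventually allI Z_le)
  finally show ?thesis by (simp add: Liminf_const)
qed

end

theorem theorem3p1:
  fixes M :: "'w measure" and P :: "real \<Rightarrow> 'w measure" and X :: "real \<Rightarrow> 'w \<Rightarrow> real"
    and M' :: "'v measure" and P' :: "real \<Rightarrow> 'v measure" and X' :: "real \<Rightarrow> 'v \<Rightarrow> real"
    and m :: "real measure" and G :: "real \<Rightarrow> real \<Rightarrow> real \<Rightarrow> ennreal"
    and g :: "real \<Rightarrow> real" and r xs :: real and \<sigma> :: "real measure"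
    and V :: "real \<Rightarrow> ennreal" and \<tau>s :: "'w \<Rightarrow> ennreal"
  assumes standing: "dual_hunt_processes M P X M' P' X' m G"
    and g_cont: "continuous_on UNIV g"
    and g_nonneg: "\<And>x. 0 \<le> g x"
    and r_nonneg: "0 \<le> r"
    and g_sup: "\<And>x. (\<integral>\<^sup>+\<omega>. (SUP t\<in>{0..}. ennreal (exp (- r * t) * g (X t \<omega>))) \<partial>P x) < \<infinity>"
    and sigma_radon: "radon_measure \<sigma>"
    and sigma_support: "emeasure \<sigma> {..<xs} = 0"
    and V_def: "\<And>x. V x = (\<integral>\<^sup>+y\<in>{xs..}. G r x y \<partial>\<sigma>)"
    and a: "continuous_on UNIV V"
    and b: "(V \<longlongrightarrow> 0) at_bot"
    and c: "\<And>x. xs \<le> x \<Longrightarrow> V x = ennreal (g x)"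
    and d: "\<And>x. x < xs \<Longrightarrow> ennreal (g x) \<le> V x"
    and tau_def: "\<tau>s = entrance_time X {xs..}"
  shows "\<tau>s \<in> stopping_times M P X \<and>
    (\<forall>x. V x = (SUP \<tau>\<in>stopping_times M P X. expected_reward P X g r \<tau> x) \<and>
         (SUP \<tau>\<in>stopping_times M P X. expected_reward P X g r \<tau> x) = expected_reward P X g r \<tau>s x)"
proof -
  interpret stopping_problem M P X M' P' X' m G g r xs \<sigma> V
    by (intro stopping_problem.intro stopping_problem_axioms.intro)
      (fact standing g_cont g_nonneg r_nonneg g_sup sigma_radon V_def a c d)+
  have stop: "\<tau>s \<in> stopping_times M P X"
    unfolding tau_def by (rule X.entrance_time_closed_stopping)
  have "V x = (SUP \<tau>\<in>stopping_times M P X. expected_reward P X g r \<tau> x) \<and>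
      (SUP \<tau>\<in>stopping_times M P X. expected_reward P X g r \<tau> x) = expected_reward P X g r \<tau>s x" for x
  proof -
    have "V x \<le> expected_reward P X g r \<tau>s x"
      unfolding tau_def by (rule V_le_expected_reward)
    moreover have "expected_reward P X g r \<tau>s x \<le> (SUP \<tau>\<in>stopping_times M P X. expected_reward P X g r \<tau> x)"
      using stop by (rule SUP_upper)
    moreover have "(SUP \<tau>\<in>stopping_times M P X. expected_reward P X g r \<tau> x) \<le> V x"
      by (rule SUP_least) (rule expected_reward_le_V)
    ultimately show ?thesis by (auto intro: antisym order.trans)
  qed
  with stop show ?thesis by blast
qed

end
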